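(* A linking $\lambda$ on a MALL sequent $\Gamma$ is a conflict net (that is, a slicing with $\{\lambda\}\leadsto^*\emptyset$) if and only if it is sequentializable, i.e. (up to isomorphism of links) the translation of some cut-free MALL proof of $\Gamma$.
   Context: Fix literals with an involution $a\mapsto\bar a$ ($\bar a\neq a$, $\bar{\bar a}=a$). MALL formulas are built from literals by $\otimes,⅋,\&,\oplus$; a sequent is a finite list of formulas, identified with the disjoint union of the parse trees of its formulas (leaves labelled by literals, internal vertices by connectives, edges directed towards roots). A root is a vertex with no outgoing edge. Two leaves are dual if their literals are dual. MALL proofs use: axiom $\vdash P,\bar P$; permutation (from $A_1..A_n$ infer $A_{\sigma1}..A_{\sigma n}$); $⅋$ (from $\Gamma,A,B$ infer $\Gamma,A⅋B$); $\oplus_i$ (from $\Gamma,A_i$ infer $\Gamma,A_0\oplus A_1$); $\otimes$ (from $\Gamma,A$ and $B,\Delta$ infer $\Gamma,A\otimes B,\Delta$); $\&$ (from $\Gamma,A$ and $\Gamma,B$ infer $\Gamma,A\&B$). Each rule induces inclusions of the premises' leaves into the conclusion's leaves (for $\&$ the leaves of $\Gamma$ in both premises go to the same leaves). A coherence space $X$ is a set $|X|$ of tokens with a symmetric irreflexive relation $\frown$; for distinct tokens, $x\#y$ iff not $x\frown y$. A map $X\to Y$ is a relation $R\subseteq|X|\times|Y|$ such that whenever $x_1Ry_1,x_2Ry_2$: $x_1\frown x_2\Rightarrow y_1\frown y_2$, and $y_1\#y_2\Rightarrow x_1\#x_2$. $X$ is contractible if $|X|$ is finite and $(|X|,\#)$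 has no induced 4-vertex path. $\mathrm{coh}(\Gamma)$ has the leaves of $\Gamma$ as tokens, with $x\#y$ iff $x\ne y$, both lie in one formula and the smallest subformula containing both has main connective $\&$ or $\oplus$. A linking on $\Gamma$ is a relation $\lambda\subseteq|L|\times\mathrm{leaves}(\Gamma)$, $L$ a finite coherence space whose tokens are links, such that each link is related to exactly two leaves, which are dual, and distinct links related to a common leaf are in conflict. A slicing is a linking with $L$ contractible and $\lambda$ a maximal (under inclusion) map $L\to\mathrm{coh}(\Gamma)$. Translation of a proof to a linking, by induction: an axiom gives one link related to both leaves; for permutation, $⅋$ and $\oplus_i$ the premise's $L,\lambda$ is kept, transported along the leaf inclusion; for $\otimes$ with premise linkings on $L$ and $M$, the result is $\lambda\cup\mu$ (transported) on $L\times M$, the disjoint union of the token sets with their relations and every token of $L$ strictly coherent with every token of $M$; for $\&$ the same on $L+M$, where every token of $L$ is in conflict with every token of $M$. For a slicing $\lambda$, let $\lambda^{\#}$ be the graph whose vertices are the vertices of $\Gamma$ and the links, with edges the parse-forest edges, $l$—$l'$ for $l\#l'$, and $l$—$x$ for $(l,x)\in\lambda$. $\lambda$ is connected if $|L|\ne\emptyset$ and $\lambda^{\#}$ is connected. A piece of $\lambda$ is its restriction to a connected component of $(|L|,\frown)$. For a root $r$ of $A_0\diamond A_1$ ($\diamond\in\{\&,\oplus\}$), a slicing touches $A_i$ if some leaf of $A_i$ is related to a link, chooses $A_i$ if it touches $A_i$ but not $A_{1-i}$, and $r$ is unary under it if it touches exactly one $A_i$. For a connected slicing $\lambda$ on $\Gamma$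 and a root $r$ of the formula $A_0\square A_1$ of $\Gamma$: $\square=\otimes$: ready if deleting $r$ from $\lambda^{\#}$ leaves two components; $\lambda\setminus r=\{\lambda_0,\lambda_1\}$, $\lambda_i$ the restriction to the links and formulas in the component containing $A_i$, on the sequent of those formulas in $\Gamma$'s order with $A_i$ in place of $A_0\otimes A_1$. $\square=⅋$: always ready; $\lambda\setminus r=\{\lambda_0\}$, same $L,\lambda$ on $\Gamma$ with $A_0,A_1$ in place of $A_0⅋A_1$. $\square=\oplus$: ready if $r$ is unary under $\lambda$, say $\lambda$ chooses $A_j$; $\lambda\setminus r$ is the same $L,\lambda$ on $\Gamma$ with $A_j$ in place of $A_0\oplus A_1$. $\square=\&$: ready if $r$ is unary under every piece; $\lambda\setminus r=\{\lambda_0,\lambda_1\}$ with $\lambda_i$ the union of pieces choosing $A_i$, on $\Gamma$ with $A_i$ in place of $A_0\&A_1$. A cluster is a set of slicings or the error symbol $\mathsf E$. Erasure: $Y\leadsto\mathsf E$ if $Y$ contains a disconnected slicing; $X\cup\{\lambda\}\leadsto X\cup(\lambda\setminus r)$ if $\lambda\notin X$, $\lambda$ connected, $r$ a ready root of $\lambda$, and all slicings of $X$ connected; $X\cup\{\lambda\}\leadsto X$ if $\lambda\notin X$, $\lambda$ is the single-link slicing on $P,\bar P$, and all slicings of $X$ connected. $\leadsto^*$ is the reflexive-transitive closure. *)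

theory Defs
  imports Main
begin

section \<open>MALL formulas, sequents, positions\<close>

text \<open>Binary connectives of MALL.\<close>
datatype conn = CTens | CPar | CWith | CPlus

text \<open>MALL formulas over literals of type 'a; the involution on literals is a
  separate parameter dual (assumed: dual a \<noteq> a, dual (dual a) = a).\<close>
datatype 'a fm = Lit 'a | Bin conn "'a fm" "'a fm"

text \<open>A vertex of (the parse forest of) a sequent is a position (i, p): i is the index
  of the formula in the list, p the path from its root (False = left / A_0,
  True = right / A_1).\<close>
type_synonym pos = "nat \<times> bool list"

fun subf :: "'a fm \<Rightarrow> bool list \<Rightarrow> 'a fm option" where
  "subf A [] = Some A"
| "subf (Bin c A B) (b # p) = subf (if b then B else A) p"
| "subf (Lit a) (b # p) = None"

fun sub :: "bool \<Rightarrow> 'a fm \<Rightarrow> 'a fm" where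
  "sub b (Bin c A B) = (if b then B else A)"
| "sub b (Lit a) = Lit a"

definition vertices :: "'a fm list \<Rightarrow> pos set" where
  "vertices \<Gamma> = {(i, p). i < length \<Gamma> \<and> subf (\<Gamma> ! i) p \<noteq> None}"

definition leaves :: "'a fm list \<Rightarrow> pos set" where
  "leaves \<Gamma> = {(i, p). i < length \<Gamma> \<and> (\<exists>a. subf (\<Gamma> ! i) p = Some (Lit a))}"

definition dual_leaves :: "('a \<Rightarrow> 'a) \<Rightarrow> 'a fm list \<Rightarrow> pos \<Rightarrow> pos \<Rightarrow> bool" where
  "dual_leaves dual \<Gamma> x y \<longleftrightarrow>
     (\<exists>a. subf (\<Gamma> ! fst x) (snd x) = Some (Lit a) \<and> subf (\<Gamma> ! fst y) (snd y) = Some (Lit (dual a)))"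

text \<open>Longest common prefix of two paths = position of the smallest common subformula.\<close>
fun lcp :: "bool list \<Rightarrow> bool list \<Rightarrow> bool list" where
  "lcp (a # xs) (b # ys) = (if a = b then a # lcp xs ys else [])"
| "lcp _ _ = []"

text \<open>Conflict relation of the coherence space coh(Gamma) on leaves.\<close>
definition coh_conflict :: "'a fm list \<Rightarrow> pos \<Rightarrow> pos \<Rightarrow> bool" where
  "coh_conflict \<Gamma> x y \<longleftrightarrow> x \<in> leaves \<Gamma> \<and> y \<in> leaves \<Gamma> \<and> x \<noteq> y \<and> fst x = fst y \<and>
     (\<exists>c A B. subf (\<Gamma> ! fst x) (lcp (snd x) (snd y)) = Some (Bin c A B) \<and> c \<in> {CWith, CPlus})"

definition coh_strict :: "'a fm list \<Rightarrow> pos \<Rightarrow> pos \<Rightarrow> bool" where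
  "coh_strict \<Gamma> x y \<longleftrightarrow> x \<in> leaves \<Gamma> \<and> y \<in> leaves \<Gamma> \<and> x \<noteq> y \<and> \<not> coh_conflict \<Gamma> x y"

section \<open>Coherence spaces of links, linkings, slicings\<close>

text \<open>A linking: (T, C, R) with T the set of links (tokens), C the strict coherence
  relation on T, R the relation between links and leaves.\<close>
type_synonym 'l linking = "'l set \<times> ('l \<times> 'l) set \<times> ('l \<times> pos) set"

definition coh_space :: "'l set \<Rightarrow> ('l \<times> 'l) set \<Rightarrow> bool" where
  "coh_space T C \<longleftrightarrow> C \<subseteq> T \<times> T \<and> sym C \<and> (\<forall>x. (x, x) \<notin> C)"

definition conf :: "'l set \<Rightarrow> ('l \<times> 'l) set \<Rightarrow> 'l \<Rightarrow> 'l \<Rightarrow> bool" where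
  "conf T C x y \<longleftrightarrow> x \<in> T \<and> y \<in> T \<and> x \<noteq> y \<and> (x, y) \<notin> C"

definition contractible :: "'l set \<Rightarrow> ('l \<times> 'l) set \<Rightarrow> bool" where
  "contractible T C \<longleftrightarrow> finite T \<and>
     \<not> (\<exists>a b c d. conf T C a b \<and> conf T C b c \<and> conf T C c d \<and>
          a \<noteq> c \<and> b \<noteq> d \<and> a \<noteq> d \<and>
          \<not> conf T C a c \<and> \<not> conf T C b d \<and> \<not> conf T C a d)"

text \<open>R is a map of coherence spaces (T, C) \<rightarrow> coh(Gamma).\<close>
definition is_map :: "'a fm list \<Rightarrow> 'l set \<Rightarrow> ('l \<times> 'l) set \<Rightarrow> ('l \<times> pos) set \<Rightarrow> bool" where
  "is_map \<Gamma> T C R \<longleftrightarrow> R \<subseteq> T \<times> leaves \<Gamma> \<and>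
     (\<forall>x1 y1 x2 y2. (x1, y1) \<in> R \<longrightarrow> (x2, y2) \<in> R \<longrightarrow>
        ((x1, x2) \<in> C \<longrightarrow> coh_strict \<Gamma> y1 y2) \<and>
        (coh_conflict \<Gamma> y1 y2 \<longrightarrow> conf T C x1 x2))"

definition linking :: "('a \<Rightarrow> 'a) \<Rightarrow> 'a fm list \<Rightarrow> 'l linking \<Rightarrow> bool" where
  "linking dual \<Gamma> \<Lambda> \<longleftrightarrow> (case \<Lambda> of (T, C, R) \<Rightarrow>
     finite T \<and> coh_space T C \<and> R \<subseteq> T \<times> leaves \<Gamma> \<and>
     (\<forall>l\<in>T. \<exists>x y. x \<noteq> y \<and> {v. (l, v) \<in> R} = {x, y} \<and> dual_leaves dual \<Gamma> x y) \<and>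
     (\<forall>l l' x. l \<noteq> l' \<longrightarrow> (l, x) \<in> R \<longrightarrow> (l', x) \<in> R \<longrightarrow> conf T C l l'))"

definition slicing :: "('a \<Rightarrow> 'a) \<Rightarrow> 'a fm list \<Rightarrow> 'l linking \<Rightarrow> bool" where
  "slicing dual \<Gamma> \<Lambda> \<longleftrightarrow> (case \<Lambda> of (T, C, R) \<Rightarrow>
     linking dual \<Gamma> \<Lambda> \<and> contractible T C \<and> is_map \<Gamma> T C R \<and>
     (\<forall>R'. R \<subseteq> R' \<longrightarrow> is_map \<Gamma> T C R' \<longrightarrow> R' = R))"

section \<open>Translation of cut-free MALL proofs into linkings\<close>

definition transport :: "(pos \<Rightarrow> pos) \<Rightarrow> 'l linking \<Rightarrow> 'l linking" where
  "transport f \<Lambda> = (case \<Lambda> of (T, C, R) \<Rightarrow> (T, C, {(l, f x) | l x. (l, x) \<in> R}))"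

text \<open>Tagging links to realise disjoint unions.\<close>
definition tag :: "bool \<Rightarrow> bool list linking \<Rightarrow> bool list linking" where
  "tag b \<Lambda> = (case \<Lambda> of (T, C, R) \<Rightarrow>
     ((\<lambda>l. b # l) ` T, {(b # x, b # y) | x y. (x, y) \<in> C}, {(b # l, v) | l v. (l, v) \<in> R}))"

text \<open>Disjoint union of (already tagged) linkings; mixed = True: every token of the
  first strictly coherent with every token of the second (L \<times> M); mixed = False:
  in conflict (L + M).\<close>
definition join :: "bool \<Rightarrow> bool list linking \<Rightarrow> bool list linking \<Rightarrow> bool list linking" where
  "join mixed \<Lambda> M = (case \<Lambda> of (T1, C1, R1) \<Rightarrow> case M of (T2, C2, R2) \<Rightarrow>
     (T1 \<union> T2, C1 \<union> C2 \<union> (if mixed then T1 \<times> T2 \<union> T2 \<times> T1 else {}), R1 \<union> R2))"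

text \<open>Leaf inclusions: n is the length of the context Gamma.\<close>
definition parmap :: "nat \<Rightarrow> pos \<Rightarrow> pos" where
  "parmap n x = (case x of (i, p) \<Rightarrow>
     if i < n then (i, p) else if i = n then (n, False # p) else (n, True # p))"

definition inmap :: "nat \<Rightarrow> bool \<Rightarrow> pos \<Rightarrow> pos" where
  "inmap n b x = (case x of (i, p) \<Rightarrow> if i < n then (i, p) else (n, b # p))"

definition tmap :: "nat \<Rightarrow> pos \<Rightarrow> pos" where
  "tmap n x = (case x of (j, p) \<Rightarrow> if j = 0 then (n, True # p) else (n + j, p))"

text \<open>transl dual Gamma Lambda: Lambda is the translation of some cut-free MALL proof of
  Gamma (defined by induction on the proof).\<close>
inductive transl :: "('a \<Rightarrow> 'a) \<Rightarrow> 'a fm list \<Rightarrow> bool list linking \<Rightarrow> bool" for dual where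
  ax: "transl dual [Lit P, Lit (dual P)] ({[]}, {}, {([], (0, [])), ([], (1, []))})"
| perm: "transl dual \<Gamma> (T, C, R) \<Longrightarrow> bij_betw \<sigma> {..<length \<Gamma>} {..<length \<Gamma>} \<Longrightarrow>
    transl dual (map (\<lambda>i. \<Gamma> ! \<sigma> i) [0..<length \<Gamma>])
      (T, C, {(l, (i, p)) | l i p. i < length \<Gamma> \<and> (l, (\<sigma> i, p)) \<in> R})"
| parr: "transl dual (\<Gamma> @ [A, B]) \<Lambda> \<Longrightarrow>
    transl dual (\<Gamma> @ [Bin CPar A B]) (transport (parmap (length \<Gamma>)) \<Lambda>)"
| plusr: "transl dual (\<Gamma> @ [if b then B else A]) \<Lambda> \<Longrightarrow>
    transl dual (\<Gamma> @ [Bin CPlus A B]) (transport (inmap (length \<Gamma>) b) \<Lambda>)"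
| tensr: "transl dual (\<Gamma> @ [A]) \<Lambda> \<Longrightarrow> transl dual (B # \<Delta>) M \<Longrightarrow>
    transl dual (\<Gamma> @ [Bin CTens A B] @ \<Delta>)
      (join True (tag False (transport (inmap (length \<Gamma>) False) \<Lambda>))
                 (tag True (transport (tmap (length \<Gamma>)) M)))"
| withr: "transl dual (\<Gamma> @ [A]) \<Lambda> \<Longrightarrow> transl dual (\<Gamma> @ [B]) M \<Longrightarrow>
    transl dual (\<Gamma> @ [Bin CWith A B])
      (join False (tag False (transport (inmap (length \<Gamma>) False) \<Lambda>))
                  (tag True (transport (inmap (length \<Gamma>) True) M)))"

text \<open>Isomorphism of linkings (renaming of links).\<close>
definition iso_linking :: "'l linking \<Rightarrow> 'm linking \<Rightarrow> bool" where
  "iso_linking \<Lambda> M \<longleftrightarrow> (case \<Lambda> of (T, C, R) \<Rightarrow> case M of (T', C', R') \<Rightarrow>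
     (\<exists>f. bij_betw f T T' \<and>
        (\<forall>x\<in>T. \<forall>y\<in>T. (x, y) \<in> C \<longleftrightarrow> (f x, f y) \<in> C') \<and>
        (\<forall>x\<in>T. \<forall>v. (x, v) \<in> R \<longleftrightarrow> (f x, v) \<in> R')))"

definition sequentializable :: "('a \<Rightarrow> 'a) \<Rightarrow> 'a fm list \<Rightarrow> 'l linking \<Rightarrow> bool" where
  "sequentializable dual \<Gamma> \<Lambda> \<longleftrightarrow> (\<exists>M. transl dual \<Gamma> M \<and> iso_linking \<Lambda> M)"

section \<open>The graph lambda-sharp, connectedness\<close>

definition sharp_V :: "'a fm list \<Rightarrow> 'l linking \<Rightarrow> ('l + pos) set" where
  "sharp_V \<Gamma> \<Lambda> = (case \<Lambda> of (T, C, R) \<Rightarrow> Inl ` T \<union> Inr ` vertices \<Gamma>)"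

definition sharp_E0 :: "'a fm list \<Rightarrow> 'l linking \<Rightarrow> (('l + pos) \<times> ('l + pos)) set" where
  "sharp_E0 \<Gamma> \<Lambda> = (case \<Lambda> of (T, C, R) \<Rightarrow>
      {(Inr (i, p @ [b]), Inr (i, p)) | i p b. (i, p @ [b]) \<in> vertices \<Gamma>}
    \<union> {(Inl l, Inl l') | l l'. conf T C l l'}
    \<union> {(Inl l, Inr x) | l x. (l, x) \<in> R})"

text \<open>Undirected edge relation of lambda-sharp.\<close>
definition sharp_E :: "'a fm list \<Rightarrow> 'l linking \<Rightarrow> (('l + pos) \<times> ('l + pos)) set" where
  "sharp_E \<Gamma> \<Lambda> = sharp_E0 \<Gamma> \<Lambda> \<union> (sharp_E0 \<Gamma> \<Lambda>)\<inverse>"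

definition sl_connected :: "'a fm list \<Rightarrow> 'l linking \<Rightarrow> bool" where
  "sl_connected \<Gamma> \<Lambda> \<longleftrightarrow> fst \<Lambda> \<noteq> {} \<and>
     (\<forall>u\<in>sharp_V \<Gamma> \<Lambda>. \<forall>v\<in>sharp_V \<Gamma> \<Lambda>.
        (u, v) \<in> (sharp_E \<Gamma> \<Lambda> \<inter> sharp_V \<Gamma> \<Lambda> \<times> sharp_V \<Gamma> \<Lambda>)\<^sup>*)"

text \<open>Connected component of v in lambda-sharp with the root (k, []) deleted.\<close>
definition comp_minus :: "'a fm list \<Rightarrow> 'l linking \<Rightarrow> nat \<Rightarrow> ('l + pos) \<Rightarrow> ('l + pos) set" where
  "comp_minus \<Gamma> \<Lambda> k v = (let V' = sharp_V \<Gamma> \<Lambda> - {Inr (k, [])} in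
     {u. (v, u) \<in> (sharp_E \<Gamma> \<Lambda> \<inter> V' \<times> V')\<^sup>*})"

definition comps_minus :: "'a fm list \<Rightarrow> 'l linking \<Rightarrow> nat \<Rightarrow> ('l + pos) set set" where
  "comps_minus \<Gamma> \<Lambda> k = {comp_minus \<Gamma> \<Lambda> k v | v. v \<in> sharp_V \<Gamma> \<Lambda> - {Inr (k, [])}}"

section \<open>Restrictions, pieces, touching\<close>

definition restrict_links :: "'l linking \<Rightarrow> 'l set \<Rightarrow> 'l linking" where
  "restrict_links \<Lambda> S = (case \<Lambda> of (T, C, R) \<Rightarrow>
     (T \<inter> S, C \<inter> (T \<inter> S) \<times> (T \<inter> S), {(l, x). (l, x) \<in> R \<and> l \<in> S}))"

definition pieces :: "'l linking \<Rightarrow> 'l set set" where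
  "pieces \<Lambda> = (case \<Lambda> of (T, C, R) \<Rightarrow> {{l'. (l, l') \<in> C\<^sup>*} | l. l \<in> T})"

text \<open>The links in P touch the subformula A_b of the formula at index k.\<close>
definition touches :: "'l linking \<Rightarrow> 'l set \<Rightarrow> nat \<Rightarrow> bool \<Rightarrow> bool" where
  "touches \<Lambda> P k b \<longleftrightarrow> (\<exists>l\<in>P. \<exists>q. (l, (k, b # q)) \<in> snd (snd \<Lambda>))"

definition unary :: "'l linking \<Rightarrow> 'l set \<Rightarrow> nat \<Rightarrow> bool" where
  "unary \<Lambda> P k \<longleftrightarrow> (touches \<Lambda> P k False \<noteq> touches \<Lambda> P k True)"

section \<open>Ready roots and erasure of a root\<close>

definition is_root_of :: "'a fm list \<Rightarrow> nat \<Rightarrow> conn \<Rightarrow> bool" where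
  "is_root_of \<Gamma> k c \<longleftrightarrow> k < length \<Gamma> \<and> (\<exists>A B. \<Gamma> ! k = Bin c A B)"

definition ready :: "'a fm list \<Rightarrow> 'l linking \<Rightarrow> nat \<Rightarrow> bool" where
  "ready \<Gamma> \<Lambda> k \<longleftrightarrow>
     (is_root_of \<Gamma> k CTens \<and> card (comps_minus \<Gamma> \<Lambda> k) = 2)
   \<or> is_root_of \<Gamma> k CPar
   \<or> (is_root_of \<Gamma> k CPlus \<and> unary \<Lambda> (fst \<Lambda>) k)
   \<or> (is_root_of \<Gamma> k CWith \<and> (\<forall>P\<in>pieces \<Lambda>. unary \<Lambda> P k))"

definition relabel :: "(pos \<Rightarrow> pos) \<Rightarrow> 'l linking \<Rightarrow> 'l linking" where
  "relabel g \<Lambda> = transport g \<Lambda>"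

text \<open>Tensor: the part lambda_b in the component containing A_b.\<close>
definition tens_part :: "'a fm list \<Rightarrow> 'l linking \<Rightarrow> nat \<Rightarrow> bool \<Rightarrow> 'a fm list \<times> 'l linking" where
  "tens_part \<Gamma> \<Lambda> k b = (let K = comp_minus \<Gamma> \<Lambda> k (Inr (k, [b]));
       S = {j. j < length \<Gamma> \<and> j \<noteq> k \<and> Inr (j, []) \<in> K} \<union> {k};
       rank = (\<lambda>j. card {s\<in>S. s < j});
       \<Gamma>' = map (\<lambda>j. if j = k then sub b (\<Gamma> ! k) else \<Gamma> ! j) (sorted_list_of_set S);
       g = (\<lambda>(j, p). if j = k then (rank j, tl p) else (rank j, p))
     in (\<Gamma>', relabel g (restrict_links \<Lambda> {l. Inl l \<in> K})))"

definition par_part :: "'a fm list \<Rightarrow> 'l linking \<Rightarrow> nat \<Rightarrow> 'a fm list \<times> 'l linking" where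
  "par_part \<Gamma> \<Lambda> k = (take k \<Gamma> @ [sub False (\<Gamma> ! k), sub True (\<Gamma> ! k)] @ drop (Suc k) \<Gamma>,
     relabel (\<lambda>(j, p). if j < k then (j, p)
                      else if j = k then (if hd p then Suc k else k, tl p)
                      else (Suc j, p)) \<Lambda>)"

definition choose_part :: "'a fm list \<Rightarrow> 'l linking \<Rightarrow> nat \<Rightarrow> bool \<Rightarrow> 'a fm list \<times> 'l linking" where
  "choose_part \<Gamma> \<Lambda> k b = (\<Gamma>[k := sub b (\<Gamma> ! k)],
     relabel (\<lambda>(j, p). if j = k then (k, tl p) else (j, p)) \<Lambda>)"

definition erase :: "'a fm list \<Rightarrow> 'l linking \<Rightarrow> nat \<Rightarrow> ('a fm list \<times> 'l linking) set" where
  "erase \<Gamma> \<Lambda> k =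
     (if is_root_of \<Gamma> k CTens then {tens_part \<Gamma> \<Lambda> k False, tens_part \<Gamma> \<Lambda> k True}
      else if is_root_of \<Gamma> k CPar then {par_part \<Gamma> \<Lambda> k}
      else if is_root_of \<Gamma> k CPlus then
        {choose_part \<Gamma> \<Lambda> k (touches \<Lambda> (fst \<Lambda>) k True)}
      else if is_root_of \<Gamma> k CWith then
        {choose_part \<Gamma> (restrict_links \<Lambda>
            (\<Union>{P\<in>pieces \<Lambda>. touches \<Lambda> P k b \<and> \<not> touches \<Lambda> P k (\<not> b)})) k b | b. b \<in> {False, True}}
      else {})"

section \<open>Clusters and erasure\<close>

text \<open>A cluster: None is the error symbol E, Some Y a set of slicings.\<close>
definition is_cluster :: "('a \<Rightarrow> 'a) \<Rightarrow> ('a fm list \<times> 'l linking) set option \<Rightarrow> bool" where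
  "is_cluster dual c \<longleftrightarrow> (case c of None \<Rightarrow> True | Some Y \<Rightarrow> (\<forall>(\<Gamma>, \<Lambda>)\<in>Y. slicing dual \<Gamma> \<Lambda>))"

definition all_connected :: "('a fm list \<times> 'l linking) set \<Rightarrow> bool" where
  "all_connected X \<longleftrightarrow> (\<forall>(\<Gamma>, \<Lambda>)\<in>X. sl_connected \<Gamma> \<Lambda>)"

inductive erase_raw :: "('a \<Rightarrow> 'a) \<Rightarrow> ('a fm list \<times> 'l linking) set option \<Rightarrow>
    ('a fm list \<times> 'l linking) set option \<Rightarrow> bool" for dual where
  err: "(\<Gamma>, \<Lambda>) \<in> Y \<Longrightarrow> \<not> sl_connected \<Gamma> \<Lambda> \<Longrightarrow> erase_raw dual (Some Y) None"
| root: "(\<Gamma>, \<Lambda>) \<notin> X \<Longrightarrow> sl_connected \<Gamma> \<Lambda> \<Longrightarrow> ready \<Gamma> \<Lambda> k \<Longrightarrow> all_connected X \<Longrightarrow>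
    erase_raw dual (Some (insert (\<Gamma>, \<Lambda>) X)) (Some (X \<union> erase \<Gamma> \<Lambda> k))"
| axiom: "(\<Gamma>, \<Lambda>) \<notin> X \<Longrightarrow>
    \<Gamma> = [Lit P, Lit (dual P)] \<Longrightarrow> \<Lambda> = ({l}, {}, {(l, (0, [])), (l, (1, []))}) \<Longrightarrow>
    all_connected X \<Longrightarrow> erase_raw dual (Some (insert (\<Gamma>, \<Lambda>) X)) (Some X)"

definition erase_step :: "('a \<Rightarrow> 'a) \<Rightarrow> ('a fm list \<times> 'l linking) set option \<Rightarrow>
    ('a fm list \<times> 'l linking) set option \<Rightarrow> bool" where
  "erase_step dual c c' \<longleftrightarrow> is_cluster dual c \<and> is_cluster dual c' \<and> erase_raw dual c c'"

definition conflict_net :: "('a \<Rightarrow> 'a) \<Rightarrow> 'a fm list \<Rightarrow> 'l linking \<Rightarrow> bool" where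
  "conflict_net dual \<Gamma> \<Lambda> \<longleftrightarrow> slicing dual \<Gamma> \<Lambda> \<and>
     (erase_step dual)\<^sup>*\<^sup>* (Some {(\<Gamma>, \<Lambda>)}) (Some {})"

end

theory Submission
  imports Defs
begin

text \<open>
  A derivation is read as a tree of rules whose principal formula may sit at any index of the sequent,
  which absorbs the permutation rule. Two invariants of the linking of a derivation carry the proof.
  First, for every link \<open>l\<close> and every formula of the sequent, \<open>l\<close> itself or some link coherent with
  \<open>l\<close> has a leaf in that formula; hence a link cannot be extended into an unchosen branch of \<open>&\<close> or
  \<open>\<oplus>\<close>, which gives maximality, and every piece of a \<open>&\<close>-conclusion chooses exactly the side it comes
  from. Secondly, after contracting each parse tree to a point the graph of links and formulas is
  connected; hence deleting a tensor root leaves precisely the two premises as components. So the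
  last rule of a derivation can always be erased and yields its premises. Conversely, readiness of a
  root says exactly that the linking is recovered from its erasures by the corresponding rule.
  Erasure replaces a slicing by at most two slicings with fewer connectives, so assigning
  \<open>3\<close> to the power of the number of connectives to every slicing of a cluster gives a decreasing
  measure.
\<close>

text \<open>Translations and erasures disagree on bookkeeping: a translated rule acts at a fixed
  place of the sequent and tags boolean lists, while an erasure acts in place, keeps the order of
  the remaining formulas and keeps the links themselves. \<open>derives\<close> is the neutral
  middle: a premise is known only up to order, and a binary rule asks only for disjoint sets of
  links of an arbitrary type. Both sides of the equivalence are compared with it, so that reordering
  and renaming are settled once. Clusters are sets, and nothing in a step keeps an erased slicing
  different from those already present. Derivability is a property of single members, which makes
  such mergers harmless. The order of erasures is immaterial: for a derivable slicing the last rule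
  of a derivation supplies a root to erase, and in the other direction derivability is pulled back
  along whatever steps were taken.\<close>

definition rename :: "('l \<Rightarrow> 'm) \<Rightarrow> 'l linking \<Rightarrow> 'm linking" where
  "rename f \<Lambda> = (case \<Lambda> of (T, C, R) \<Rightarrow> (f ` T, map_prod f f ` C, apfst f ` R))"

text \<open>This is \<open>join\<close> for links of arbitrary type; the disjointness that tags
  provide there is assumed where it is used.\<close>

definition link_union :: "bool \<Rightarrow> 'l linking \<Rightarrow> 'l linking \<Rightarrow> 'l linking" where
  "link_union mixed \<Lambda> M = (case \<Lambda> of (T1, C1, R1) \<Rightarrow> case M of (T2, C2, R2) \<Rightarrow>
     (T1 \<union> T2, C1 \<union> C2 \<union> (if mixed then T1 \<times> T2 \<union> T2 \<times> T1 else {}), R1 \<union> R2))"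

text \<open>One shape for all leaf inclusions: a permutation is the case where every
  \<open>snd (e i)\<close> is empty, and a logical rule prefixes one branch step to the paths of its
  active formulas.\<close>

definition lift :: "(nat \<Rightarrow> pos) \<Rightarrow> pos \<Rightarrow> pos" where
  "lift e x = (fst (e (fst x)), snd (e (fst x)) @ snd x)"

text \<open>The part of well-formedness that does not mention formulas. It makes two transports
  equal once their maps agree on the indices below \<open>n\<close>.\<close>

definition supported :: "nat \<Rightarrow> 'l linking \<Rightarrow> bool" where
  "supported n \<Lambda> \<longleftrightarrow> (case \<Lambda> of (T, C, R) \<Rightarrow> C \<subseteq> T \<times> T \<and> R \<subseteq> T \<times> ({..<n} \<times> UNIV))"

section \<open>Transport along maps of positions\<close>

lemma transport_simp: "transport f (T, C, R) = (T, C, apsnd f ` R)"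
  by (force simp: transport_def)

lemma apsnd_image_iff: "(l, y) \<in> apsnd f ` R \<longleftrightarrow> (\<exists>x. (l, x) \<in> R \<and> y = f x)"
  by force

lemma transport_transport: "transport f (transport g \<Lambda>) = transport (f \<circ> g) \<Lambda>"
  by (cases \<Lambda>) (simp add: transport_simp image_image apsnd_compose)

lemma transport_cong:
  assumes "\<And>l x. (l, x) \<in> snd (snd \<Lambda>) \<Longrightarrow> f x = g x"
  shows "transport f \<Lambda> = transport g \<Lambda>"
proof -
  obtain T C R where "\<Lambda> = (T, C, R)" by (cases \<Lambda>)
  moreover have "apsnd f ` R = apsnd g ` R"
    using assms calculation by (intro image_cong) auto
  ultimately show ?thesis by (simp add: transport_simp)
qed

lemma transport_ident:
  assumes "\<And>l x. (l, x) \<in> snd (snd \<Lambda>) \<Longrightarrow> f x = x"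
  shows "transport f \<Lambda> = \<Lambda>"
proof -
  obtain T C R where L: "\<Lambda> = (T, C, R)" by (cases \<Lambda>)
  have "apsnd f ` R = id ` R"
    using assms L by (intro image_cong) auto
  then show ?thesis by (simp add: L transport_simp)
qed

lemma fst_transport [simp]: "fst (transport f \<Lambda>) = fst \<Lambda>"
  by (cases \<Lambda>) (simp add: transport_simp)

lemma lift_lift: "lift e (lift (\<lambda>i. (\<rho> i, [])) x) = lift (\<lambda>i. e (\<rho> i)) x"
  by (simp add: lift_def)

lemma subf_append: "subf A q = Some A' \<Longrightarrow> subf A (q @ p) = subf A' p"
  by (induction A q rule: subf.induct) auto

lemma subf_prefix: "subf A (q @ p) \<noteq> None \<Longrightarrow> subf A q \<noteq> None"
  by (induction A q rule: subf.induct) auto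

lemma lcp_append: "lcp (q @ p) (q @ p') = q @ lcp p p'"
  by (induction q) auto

section \<open>Derivations with the principal formula at any index\<close>

text \<open>
  A premise of a rule is encoded by the set of positions of its formulas inside the conclusion; \<open>e\<close>
  enumerates this set in the order of the premise, and \<open>lift e\<close> is the induced inclusion of leaves.
\<close>

definition part :: "nat set \<Rightarrow> nat \<Rightarrow> bool set \<Rightarrow> pos set" where
  "part S k B = (\<lambda>j. (j, [])) ` S \<union> (\<lambda>b. (k, [b])) ` B"

definition lists_at :: "'a fm list \<Rightarrow> pos set \<Rightarrow> 'a fm list \<Rightarrow> (nat \<Rightarrow> pos) \<Rightarrow> bool" where
  "lists_at \<Gamma> E \<Gamma>' e \<longleftrightarrow> bij_betw e {..<length \<Gamma>'} E \<and>
     (\<forall>i<length \<Gamma>'. subf (\<Gamma> ! fst (e i)) (snd (e i)) = Some (\<Gamma>' ! i))"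

text \<open>\<open>lists_at\<close> fixes the set of positions but not the order of a premise, so
  exchange is built into every rule. Disjoint link sets replace tags in the binary rules, so that
  restrictions of a given linking can serve as premises directly.\<close>

inductive derives :: "('a \<Rightarrow> 'a) \<Rightarrow> 'a fm list \<Rightarrow> 'l linking \<Rightarrow> bool" for dual where
  ax: "derives dual [Lit P, Lit (dual P)] ({l}, {}, {(l, (0, [])), (l, (1, []))})"
| par: "k \<notin> S \<Longrightarrow> insert k S = {..<length \<Gamma>} \<Longrightarrow> \<Gamma> ! k = Bin CPar A B \<Longrightarrow>
    lists_at \<Gamma> (part S k UNIV) \<Gamma>' e \<Longrightarrow> derives dual \<Gamma>' \<Lambda> \<Longrightarrow>
    derives dual \<Gamma> (transport (lift e) \<Lambda>)"
| plus: "k \<notin> S \<Longrightarrow> insert k S = {..<length \<Gamma>} \<Longrightarrow> \<Gamma> ! k = Bin CPlus A B \<Longrightarrow>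
    lists_at \<Gamma> (part S k {b}) \<Gamma>' e \<Longrightarrow> derives dual \<Gamma>' \<Lambda> \<Longrightarrow>
    derives dual \<Gamma> (transport (lift e) \<Lambda>)"
| tens: "k \<notin> S0 \<Longrightarrow> k \<notin> S1 \<Longrightarrow> S0 \<inter> S1 = {} \<Longrightarrow> insert k (S0 \<union> S1) = {..<length \<Gamma>} \<Longrightarrow>
    \<Gamma> ! k = Bin CTens A B \<Longrightarrow>
    lists_at \<Gamma> (part S0 k {False}) \<Gamma>0 e0 \<Longrightarrow> lists_at \<Gamma> (part S1 k {True}) \<Gamma>1 e1 \<Longrightarrow>
    derives dual \<Gamma>0 \<Lambda>0 \<Longrightarrow> derives dual \<Gamma>1 \<Lambda>1 \<Longrightarrow> fst \<Lambda>0 \<inter> fst \<Lambda>1 = {} \<Longrightarrow>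
    derives dual \<Gamma> (link_union True (transport (lift e0) \<Lambda>0) (transport (lift e1) \<Lambda>1))"
| withr: "k \<notin> S \<Longrightarrow> insert k S = {..<length \<Gamma>} \<Longrightarrow> \<Gamma> ! k = Bin CWith A B \<Longrightarrow>
    lists_at \<Gamma> (part S k {False}) \<Gamma>0 e0 \<Longrightarrow> lists_at \<Gamma> (part S k {True}) \<Gamma>1 e1 \<Longrightarrow>
    derives dual \<Gamma>0 \<Lambda>0 \<Longrightarrow> derives dual \<Gamma>1 \<Lambda>1 \<Longrightarrow> fst \<Lambda>0 \<inter> fst \<Lambda>1 = {} \<Longrightarrow>
    derives dual \<Gamma> (link_union False (transport (lift e0) \<Lambda>0) (transport (lift e1) \<Lambda>1))"

section \<open>Translations are slicings\<close>

text \<open>\<open>bounds\<close> is an inclusion so that a tensor premise, which takes only some of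
  the context, is covered as well. \<open>branch\<close> says that an additive rule keeps a single
  branch of its principal formula; this is what makes the inclusion of leaves reflect and preserve
  conflict.\<close>

locale premise =
  fixes \<Gamma> :: "'a fm list" and S :: "nat set" and k :: nat and B :: "bool set"
    and \<Gamma>' :: "'a fm list" and e :: "nat \<Rightarrow> pos" and c :: conn and A0 A1 :: "'a fm"
  assumes kS: "k \<notin> S" and bounds: "insert k S \<subseteq> {..<length \<Gamma>}"
    and formula: "\<Gamma> ! k = Bin c A0 A1"
    and lists: "lists_at \<Gamma> (part S k B) \<Gamma>' e"
    and branch: "c \<notin> {CWith, CPlus} \<or> (\<exists>b. B = {b})"
    and Bne: "B \<noteq> {}"
begin

lemma e_bij: "bij_betw e {..<length \<Gamma>'} (part S k B)"
  using lists by (simp add: lists_at_def)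

lemma e_in: "i < length \<Gamma>' \<Longrightarrow> e i \<in> part S k B"
  using e_bij by (auto simp: bij_betw_def)

lemma e_eq: "i < length \<Gamma>' \<Longrightarrow> i' < length \<Gamma>' \<Longrightarrow> e i = e i' \<longleftrightarrow> i = i'"
  using e_bij by (auto simp: bij_betw_def inj_on_def)

lemma e_surj: "y \<in> part S k B \<Longrightarrow> \<exists>i<length \<Gamma>'. e i = y"
  using e_bij unfolding bij_betw_def by (metis imageE lessThan_iff)

lemma fst_e: "i < length \<Gamma>' \<Longrightarrow> fst (e i) < length \<Gamma>"
  using e_in[of i] bounds by (auto simp: part_def)

lemma subf_lift: "i < length \<Gamma>' \<Longrightarrow> subf (\<Gamma> ! fst (lift e (i, p))) (snd (lift e (i, p))) = subf (\<Gamma>' ! i) p"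
  using lists by (simp add: lift_def lists_at_def subf_append)

text \<open>Two formulas of the premise share an index of the conclusion only at \<open>k\<close>,
  where the first step of the path tells the branches apart. Hence different entries of
  \<open>part\<close> cannot be extended to the same position.\<close>

lemma lift_eq:
  assumes "i < length \<Gamma>'" "i' < length \<Gamma>'" "lift e (i, p) = lift e (i', p')"
  shows "i = i' \<and> p = p'"
proof -
  have "e i = e i'"
    using e_in[OF assms(1)] e_in[OF assms(2)] assms(3) kS by (auto simp: part_def lift_def)
  then show ?thesis using assms e_eq by (simp add: lift_def)
qed

lemma leavesD: "x \<in> leaves \<Gamma>' \<Longrightarrow> fst x < length \<Gamma>'"
  by (auto simp: leaves_def)

lemma lift_inj: "x \<in> leaves \<Gamma>' \<Longrightarrow> y \<in> leaves \<Gamma>' \<Longrightarrow> lift e x = lift e y \<longleftrightarrow> x = y"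
  using lift_eq leavesD by (metis prod.collapse)

lemma lift_leaf: "x \<in> leaves \<Gamma>' \<Longrightarrow> lift e x \<in> leaves \<Gamma>"
  using subf_lift[of "fst x" "snd x"] fst_e by (force simp: leaves_def lift_def)

lemma lift_dual: 
  assumes "x \<in> leaves \<Gamma>'" "y \<in> leaves \<Gamma>'"
  shows "dual_leaves d \<Gamma> (lift e x) (lift e y) \<longleftrightarrow> dual_leaves d \<Gamma>' x y"
  using subf_lift[of "fst x" "snd x"] subf_lift[of "fst y" "snd y"] assms
  by (simp add: dual_leaves_def leavesD)

text \<open>Tests membership in the image of the inclusion by index and first branch alone; the
  maximality arguments locate leaves by this test.\<close>

lemma lift_cover:
  assumes "(j, p) \<in> leaves \<Gamma>" "j \<in> S \<or> j = k \<and> hd p \<in> B"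
  shows "\<exists>x\<in>leaves \<Gamma>'. (j, p) = lift e x"
proof -
  obtain i q p' where i: "i < length \<Gamma>'" "e i = (j, q)" "p = q @ p'"
  proof (cases "j \<in> S")
    case True
    then have "(j, []) \<in> part S k B" by (simp add: part_def)
    then show ?thesis using e_surj that by (metis append_Nil)
  next
    case False
    then have *: "j = k" "hd p \<in> B" using assms by auto
    then have "p \<noteq> []" using assms(1) formula by (auto simp: leaves_def)
    then have "p = [hd p] @ tl p" by simp
    moreover have "(j, [hd p]) \<in> part S k B" using * by (simp add: part_def)
    ultimately show ?thesis using e_surj that by metis
  qed
  then have "lift e (i, p') = (j, p)" by (simp add: lift_def)
  moreover have "(i, p') \<in> leaves \<Gamma>'"
    using subf_lift[OF i(1), of p'] calculation assms(1) i(1) by (auto simp: leaves_def)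
  ultimately show ?thesis by metis
qed

text \<open>Inside one formula of the premise all paths receive the same prefix, so the vertex where
  two leaves meet keeps its connective. Leaves of two different formulas can meet in the conclusion
  only at the principal connective, which by \<open>branch\<close> is not additive when both of its
  subformulas are present.\<close>

lemma lift_conflict:
  assumes x: "x \<in> leaves \<Gamma>'" and y: "y \<in> leaves \<Gamma>'"
  shows "coh_conflict \<Gamma> (lift e x) (lift e y) \<longleftrightarrow> coh_conflict \<Gamma>' x y"
proof -
  obtain i p i' p' where xy: "x = (i, p)" "y = (i', p')" by (cases x, cases y)
  have i: "i < length \<Gamma>'" "i' < length \<Gamma>'" using x y xy by (auto simp: leaves_def)
  have ineq: "lift e x = lift e y \<longleftrightarrow> x = y" using x y by (rule lift_inj)
  show ?thesis
  proof (cases "i = i'")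
    case True
    then have "subf (\<Gamma> ! fst (lift e x)) (lcp (snd (lift e x)) (snd (lift e y))) = subf (\<Gamma>' ! i) (lcp p p')"
      using subf_lift[OF i(1), of "lcp p p'"] xy by (simp add: lift_def lcp_append)
    then show ?thesis
      unfolding coh_conflict_def ineq using lift_leaf[OF x] lift_leaf[OF y] x y True xy by (simp add: lift_def)
  next
    case False
    then have ne: "e i \<noteq> e i'" using e_eq i by simp
    have "\<not> coh_conflict \<Gamma> (lift e x) (lift e y)"
    proof (cases "fst (e i) = fst (e i')")
      case True
      then obtain b b' where b: "e i = (k, [b])" "e i' = (k, [b'])" "b \<noteq> b'" "b \<in> B" "b' \<in> B"
        using e_in[OF i(1)] e_in[OF i(2)] ne kS by (auto simp: part_def)
      then have "c \<notin> {CWith, CPlus}" using branch by auto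
      then show ?thesis using b xy formula by (simp add: coh_conflict_def lift_def)
    qed (use xy in \<open>simp add: coh_conflict_def lift_def\<close>)
    then show ?thesis using False xy by (simp add: coh_conflict_def)
  qed
qed

lemma lift_strict:
  assumes x: "x \<in> leaves \<Gamma>'" and y: "y \<in> leaves \<Gamma>'"
  shows "coh_strict \<Gamma> (lift e x) (lift e y) \<longleftrightarrow> coh_strict \<Gamma>' x y"
  using lift_conflict[OF x y] lift_inj[OF x y] lift_leaf x y by (simp add: coh_strict_def)

lemma lift_map:
  assumes "R \<subseteq> T \<times> leaves \<Gamma>'"
  shows "is_map \<Gamma> T C (apsnd (lift e) ` R) \<longleftrightarrow> is_map \<Gamma>' T C R"
proof -
  have sub: "apsnd (lift e) ` R \<subseteq> T \<times> leaves \<Gamma>" using assms lift_leaf by auto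
  show ?thesis
  proof
    assume m: "is_map \<Gamma> T C (apsnd (lift e) ` R)"
    have "((x1, x2) \<in> C \<longrightarrow> coh_strict \<Gamma>' y1 y2) \<and> (coh_conflict \<Gamma>' y1 y2 \<longrightarrow> conf T C x1 x2)"
      if "(x1, y1) \<in> R" "(x2, y2) \<in> R" for x1 y1 x2 y2
    proof -
      have "(x1, lift e y1) \<in> apsnd (lift e) ` R" "(x2, lift e y2) \<in> apsnd (lift e) ` R"
        using that by force+
      then show ?thesis using m that assms lift_strict[of y1 y2] lift_conflict[of y1 y2]
        unfolding is_map_def by blast
    qed
    then show "is_map \<Gamma>' T C R" using assms unfolding is_map_def by blast
  next
    assume m: "is_map \<Gamma>' T C R"
    have "((x1, x2) \<in> C \<longrightarrow> coh_strict \<Gamma> y1 y2) \<and> (coh_conflict \<Gamma> y1 y2 \<longrightarrow> conf T C x1 x2)"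
      if r: "(x1, y1) \<in> apsnd (lift e) ` R" "(x2, y2) \<in> apsnd (lift e) ` R" for x1 y1 x2 y2
    proof -
      obtain z1 z2 where z: "(x1, z1) \<in> R" "(x2, z2) \<in> R" "y1 = lift e z1" "y2 = lift e z2"
        using r unfolding apsnd_image_iff by fastforce
      then show ?thesis using m assms lift_strict[of z1 z2] lift_conflict[of z1 z2]
        unfolding is_map_def by blast
    qed
    then show "is_map \<Gamma> T C (apsnd (lift e) ` R)" using sub unfolding is_map_def by blast
  qed
qed

text \<open>A competitor that stays on lifted leaves is pulled back along the injective inclusion
  and compared in the premise. That it cannot leave these leaves depends on the rule; this becomes
  the hypothesis \<open>cover\<close> of \<open>lift_slicing\<close>.\<close>

lemma lift_maximal:
  assumes max: "\<And>R'. R \<subseteq> R' \<Longrightarrow> is_map \<Gamma>' T C R' \<Longrightarrow> R' = R" and RL: "R \<subseteq> T \<times> leaves \<Gamma>'"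
    and X: "apsnd (lift e) ` R \<subseteq> X" "is_map \<Gamma> T C X" "X \<subseteq> T \<times> lift e ` leaves \<Gamma>'"
  shows "X = apsnd (lift e) ` R"
proof -
  define Y where "Y = {(l, x). x \<in> leaves \<Gamma>' \<and> (l, lift e x) \<in> X}"
  have XY: "X = apsnd (lift e) ` Y" using X(3) by (force simp: Y_def)
  have "Y \<subseteq> T \<times> leaves \<Gamma>'" using X(3) by (auto simp: Y_def)
  then have "is_map \<Gamma>' T C Y" using lift_map[of Y T C] X(2) XY by blast
  moreover have "R \<subseteq> Y" using X(1) RL by (force simp: Y_def)
  ultimately have "Y = R" using max by simp
  then show ?thesis using XY by simp
qed

lemma lift_linking:
  assumes "linking d \<Gamma>' (T, C, R)"
  shows "linking d \<Gamma> (T, C, apsnd (lift e) ` R)"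
proof -
  have RL: "R \<subseteq> T \<times> leaves \<Gamma>'" using assms by (simp add: linking_def)
  have "\<exists>x y. x \<noteq> y \<and> {v. (l, v) \<in> apsnd (lift e) ` R} = {x, y} \<and> dual_leaves d \<Gamma> x y" if l: "l \<in> T" for l
  proof -
    obtain x y where xy: "x \<noteq> y" "{v. (l, v) \<in> R} = {x, y}" "dual_leaves d \<Gamma>' x y"
      using assms l unfolding linking_def by (simp only: split) blast
    have "{v. (l, v) \<in> apsnd (lift e) ` R} = lift e ` {v. (l, v) \<in> R}" by force
    then have "{v. (l, v) \<in> apsnd (lift e) ` R} = {lift e x, lift e y}" using xy by simp
    moreover have "x \<in> leaves \<Gamma>'" "y \<in> leaves \<Gamma>'" using xy RL by blast+
    ultimately show ?thesis using xy lift_inj lift_dual by metis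
  qed
  moreover have "conf T C l l'"
    if r: "l \<noteq> l'" "(l, x) \<in> apsnd (lift e) ` R" "(l', x) \<in> apsnd (lift e) ` R" for l l' x
  proof -
    obtain z z' where z: "(l, z) \<in> R" "(l', z') \<in> R" "lift e z = lift e z'" using r unfolding apsnd_image_iff by fastforce
    moreover have "z \<in> leaves \<Gamma>'" "z' \<in> leaves \<Gamma>'" using z RL by blast+
    ultimately have "z = z'" using lift_inj by simp
    then show ?thesis using assms r(1) z unfolding linking_def by (simp only: split) blast
  qed
  moreover have "apsnd (lift e) ` R \<subseteq> T \<times> leaves \<Gamma>" using RL lift_leaf by auto
  moreover have "finite T" "coh_space T C" using assms by (simp_all add: linking_def)
  ultimately show ?thesis unfolding linking_def split by metis
qed

lemma lift_slicing:
  assumes sl: "slicing d \<Gamma>' (T, C, R)"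
    and cover: "\<And>X. apsnd (lift e) ` R \<subseteq> X \<Longrightarrow> is_map \<Gamma> T C X \<Longrightarrow> X \<subseteq> T \<times> lift e ` leaves \<Gamma>'"
  shows "slicing d \<Gamma> (T, C, apsnd (lift e) ` R)"
proof -
  have RL: "R \<subseteq> T \<times> leaves \<Gamma>'" using sl by (simp add: slicing_def linking_def)
  have max: "\<And>R'. R \<subseteq> R' \<Longrightarrow> is_map \<Gamma>' T C R' \<Longrightarrow> R' = R" using sl by (simp add: slicing_def)
  show ?thesis
    using sl lift_linking[of d T C R] lift_map[OF RL, of C] lift_maximal[OF max RL] cover
    unfolding slicing_def by simp
qed

end

text \<open>Coherence at distance one is the form that the map conditions can use: leaves in
  conflict force their links into conflict, so they belong neither to one link nor to two coherent
  links.\<close>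

definition touching :: "nat \<Rightarrow> 'l linking \<Rightarrow> bool" where
  "touching n \<Lambda> \<longleftrightarrow> (case \<Lambda> of (T, C, R) \<Rightarrow> T \<noteq> {} \<and>
     (\<forall>l\<in>T. \<forall>i<n. \<exists>l'\<in>T. \<exists>p. (l' = l \<or> (l, l') \<in> C) \<and> (l', (i, p)) \<in> R))"

text \<open>
  Connectedness of the graph of links and formulas with each parse tree contracted to a point, phrased
  by means of labellings that are constant along edges.
\<close>

definition coupled :: "nat \<Rightarrow> 'l linking \<Rightarrow> bool" where
  "coupled n \<Lambda> \<longleftrightarrow> (case \<Lambda> of (T, C, R) \<Rightarrow>
     \<forall>(ql :: 'l \<Rightarrow> bool) (qi :: nat \<Rightarrow> bool).
       (\<forall>l l'. conf T C l l' \<longrightarrow> ql l = ql l') \<longrightarrow> (\<forall>l i p. (l, (i, p)) \<in> R \<longrightarrow> ql l = qi i) \<longrightarrow>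
       (\<exists>b. (\<forall>l\<in>T. ql l = b) \<and> (\<forall>i<n. qi i = b)))"

lemma lcp_sym: "lcp p q = lcp q p"
  by (induction p q rule: lcp.induct) auto

lemma coh_conflict_sym: "coh_conflict \<Gamma> x y \<longleftrightarrow> coh_conflict \<Gamma> y x"
  by (auto simp: coh_conflict_def lcp_sym)

lemma is_map_restrict:
  assumes "is_map \<Gamma> T C X" "C0 \<subseteq> C" "\<And>x y. x \<in> T0 \<Longrightarrow> y \<in> T0 \<Longrightarrow> conf T C x y \<Longrightarrow> conf T0 C0 x y"
  shows "is_map \<Gamma> T0 C0 {(l, x). (l, x) \<in> X \<and> l \<in> T0}"
  using assms unfolding is_map_def by blast

text \<open>If \<open>z\<close> were unlinked and free of conflict with every linked leaf, it would
  be strictly coherent with all of them, and any link could be related to it as well, against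
  maximality. In a tensor this forbids a link of one side to reach the other.\<close>

lemma slicing_meets:
  assumes sl: "slicing d \<Gamma> (T, C, R)" and "T \<noteq> {}" and z: "z \<in> leaves \<Gamma>"
  shows "\<exists>m y. (m, y) \<in> R \<and> (y = z \<or> coh_conflict \<Gamma> z y)"
proof (rule ccontr)
  assume no: "\<not> ?thesis"
  obtain m where m: "m \<in> T" using assms(2) by blast
  have mp: "is_map \<Gamma> T C R" and irr: "\<And>x. (x, x) \<notin> C"
    and max: "\<And>R'. R \<subseteq> R' \<Longrightarrow> is_map \<Gamma> T C R' \<Longrightarrow> R' = R"
    using sl by (auto simp: slicing_def linking_def coh_space_def)
  have RL: "R \<subseteq> T \<times> leaves \<Gamma>" using mp by (simp add: is_map_def)
  have str: "coh_strict \<Gamma> z y \<and> coh_strict \<Gamma> y z \<and> \<not> coh_conflict \<Gamma> z y \<and> \<not> coh_conflict \<Gamma> y z"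
    if "(l, y) \<in> R" for l y
    using no that RL z coh_conflict_sym[of \<Gamma> z y] unfolding coh_strict_def by blast
  have zz: "\<not> coh_conflict \<Gamma> z z" by (simp add: coh_conflict_def)
  \<comment> \<open>The new pair against an old one is settled by \<open>str\<close>, and against
    itself by irreflexivity of coherence and conflict.\<close>
  have "is_map \<Gamma> T C (insert (m, z) R)"
    unfolding is_map_def
  proof (intro conjI allI impI)
    show "insert (m, z) R \<subseteq> T \<times> leaves \<Gamma>" using RL m z by blast
  next
    fix x1 y1 x2 y2 assume "(x1, y1) \<in> insert (m, z) R" "(x2, y2) \<in> insert (m, z) R" "(x1, x2) \<in> C"
    then show "coh_strict \<Gamma> y1 y2" using mp str irr unfolding is_map_def by blast
  next
    fix x1 y1 x2 y2 assume "(x1, y1) \<in> insert (m, z) R" "(x2, y2) \<in> insert (m, z) R" "coh_conflict \<Gamma> y1 y2"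
    then show "conf T C x1 x2" using mp str zz unfolding is_map_def by blast
  qed
  then have "insert (m, z) R = R" using max by blast
  then show False using no by blast
qed

section \<open>Transfer of the invariants and of maximality to the conclusion\<close>

context premise
begin

lemma lift_touch:
  assumes "touching (length \<Gamma>') (T, C, R)" "l \<in> T" "(j, q) \<in> part S k B"
  shows "\<exists>l'\<in>T. \<exists>p. (l' = l \<or> (l, l') \<in> C) \<and> (l', (j, q @ p)) \<in> apsnd (lift e) ` R"
proof -
  obtain i where i: "i < length \<Gamma>'" "e i = (j, q)" using e_surj assms(3) by blast
  then obtain l' p where l': "l' \<in> T" "l' = l \<or> (l, l') \<in> C" "(l', (i, p)) \<in> R"
    using assms(1,2) i(1) unfolding touching_def split by blast
  have "lift e (i, p) = (j, q @ p)" using i by (simp add: lift_def)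
  then show ?thesis using l' by (metis apsnd_image_iff)
qed

lemma lift_touch_index:
  assumes "touching (length \<Gamma>') (T, C, R)" "l \<in> T" "j \<in> insert k S"
  shows "\<exists>l'\<in>T. \<exists>p. (l' = l \<or> (l, l') \<in> C) \<and> (l', (j, p)) \<in> apsnd (lift e) ` R"
proof -
  obtain q where "(j, q) \<in> part S k B" using assms(3) Bne by (auto simp: part_def)
  then show ?thesis using lift_touch[OF assms(1,2), of j q] by metis
qed

text \<open>A labelling of the conclusion is pulled back by giving premise formula \<open>i\<close>
  the label of the index \<open>fst (e i)\<close> it comes from; the two halves of a par thus
  receive one label.\<close>

lemma lift_coupled:
  fixes ql :: "'l \<Rightarrow> bool"
  assumes "coupled (length \<Gamma>') (T, C, R)"
    and "\<And>l l'. conf T C l l' \<Longrightarrow> ql l = ql l'"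
    and q: "\<And>l i p. (l, (i, p)) \<in> apsnd (lift e) ` R \<Longrightarrow> ql l = qi i"
  shows "\<exists>b. (\<forall>l\<in>T. ql l = b) \<and> (\<forall>y\<in>part S k B. qi (fst y) = b)"
proof -
  have "ql l = qi (fst (e i))" if "(l, (i, p)) \<in> R" for l i p
    using q[of l "fst (e i)" "snd (e i) @ p"] that by (force simp: lift_def)
  then obtain b where b: "\<forall>l\<in>T. ql l = b" "\<forall>i<length \<Gamma>'. qi (fst (e i)) = b"
    using assms(1)[unfolded coupled_def split, rule_format, of ql "\<lambda>i. qi (fst (e i))"] assms(2) by blast
  then show ?thesis using e_surj by metis
qed

lemma lift_coupled_index:
  fixes ql :: "'l \<Rightarrow> bool"
  assumes "coupled (length \<Gamma>') (T, C, R)"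
    and "\<And>l l'. conf T C l l' \<Longrightarrow> ql l = ql l'"
    and q: "\<And>l i p. (l, (i, p)) \<in> apsnd (lift e) ` R \<Longrightarrow> ql l = qi i"
  shows "\<exists>b. (\<forall>l\<in>T. ql l = b) \<and> (\<forall>j\<in>insert k S. qi j = b)"
proof -
  have "\<exists>b. (\<forall>l\<in>T. ql l = b) \<and> (\<forall>y\<in>part S k B. qi (fst y) = b)"
    by (rule lift_coupled[OF assms(1)]) (erule assms(2), erule q)
  then obtain b where b: "\<forall>l\<in>T. ql l = b" "\<And>y. y\<in>part S k B \<Longrightarrow> qi (fst y) = b"
    by blast
  have "qi j = b" if j: "j \<in> insert k S" for j
  proof -
    obtain q where "(j, q) \<in> part S k B" using j Bne by (auto simp: part_def)
    then show ?thesis using b(2) by force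
  qed
  then show ?thesis using b(1) by blast
qed

text \<open>Serves par, with \<open>B = UNIV\<close>, and every additive premise. A link reaching
  the omitted branch would, by \<open>touching\<close>, be equal to or coherent with a link in the
  kept branch. The two leaves meet at the additive root and conflict, so their links would conflict
  too.\<close>

lemma lift_slicing_choice:
  assumes sl: "slicing d \<Gamma>' (T, C, R)" and t: "touching (length \<Gamma>') (T, C, R)"
    and all: "insert k S = {..<length \<Gamma>}" and c: "c \<in> {CWith, CPlus} \<or> B = UNIV"
  shows "slicing d \<Gamma> (T, C, apsnd (lift e) ` R)"
proof (rule lift_slicing[OF sl])
  fix X assume X: "apsnd (lift e) ` R \<subseteq> X" "is_map \<Gamma> T C X"
  show "X \<subseteq> T \<times> lift e ` leaves \<Gamma>'"
  proof clarify
    fix l j p assume lx: "(l, (j, p)) \<in> X"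
    then have l: "l \<in> T" "(j, p) \<in> leaves \<Gamma>" using X(2) by (auto simp: is_map_def)
    have "j \<in> S \<or> j = k \<and> hd p \<in> B"
    proof (rule ccontr)
      assume no: "\<not> ?thesis"
      moreover have "j < length \<Gamma>" using l by (simp add: leaves_def)
      ultimately have j: "j = k" "hd p \<notin> B" using all by auto
      then obtain p' where p: "p = hd p # p'"
        using l formula by (cases p) (auto simp: leaves_def)
      \<comment> \<open>With \<open>B = UNIV\<close> there is no omitted branch, so the rule is
        additive here.\<close>
      obtain b where b: "B = {b}" using branch c j by auto
      then obtain l' q where l': "l' = l \<or> (l, l') \<in> C" "(l', (k, [b] @ q)) \<in> apsnd (lift e) ` R"
        using lift_touch[OF t l(1), of k "[b]"] by (auto simp: part_def)
      then have lX: "(l', (k, b # q)) \<in> X" using X(1) by auto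
      then have "(k, b # q) \<in> leaves \<Gamma>" using X(2) by (auto simp: is_map_def)
      moreover have "lcp p (b # q) = []" "p \<noteq> b # q" using p j b by (cases p; simp)+
      ultimately have "coh_conflict \<Gamma> (j, p) (k, b # q)"
        using l(2) j b c formula unfolding coh_conflict_def by auto
      then have "conf T C l l'" using X(2) lx lX unfolding is_map_def by blast
      then show False using l' by (auto simp: conf_def)
    qed
    then show "l \<in> T \<and> (j, p) \<in> lift e ` leaves \<Gamma>'" using lift_cover[OF l(2)] l(1) by blast
  qed
qed

end

section \<open>Unions of coherence spaces and of linkings\<close>

lemma conf_union:
  assumes "T0 \<inter> T1 = {}" "C0 \<subseteq> T0 \<times> T0" "C1 \<subseteq> T1 \<times> T1"
  shows "conf (T0 \<union> T1) (C0 \<union> C1) x y \<longleftrightarrow>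
    conf T0 C0 x y \<or> conf T1 C1 x y \<or> x \<in> T0 \<and> y \<in> T1 \<or> x \<in> T1 \<and> y \<in> T0"
  using assms unfolding conf_def by blast

lemma conf_union_mixed:
  assumes "T0 \<inter> T1 = {}" "C0 \<subseteq> T0 \<times> T0" "C1 \<subseteq> T1 \<times> T1"
  shows "conf (T0 \<union> T1) (C0 \<union> C1 \<union> (T0 \<times> T1 \<union> T1 \<times> T0)) x y \<longleftrightarrow>
    conf T0 C0 x y \<or> conf T1 C1 x y"
  using assms unfolding conf_def by blast

lemma conf_mem: "conf T C x y \<Longrightarrow> x \<in> T \<and> y \<in> T \<and> x \<noteq> y"
  by (simp add: conf_def)

text \<open>Conflict never crosses the two sides, so a path of conflicts stays on one of
  them.\<close>

lemma contractible_union_mixed: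
  assumes "T0 \<inter> T1 = {}" "C0 \<subseteq> T0 \<times> T0" "C1 \<subseteq> T1 \<times> T1" "contractible T0 C0" "contractible T1 C1"
  shows "contractible (T0 \<union> T1) (C0 \<union> C1 \<union> (T0 \<times> T1 \<union> T1 \<times> T0))"
proof -
  have False if h: "conf T0 C0 a b \<or> conf T1 C1 a b" "conf T0 C0 b c \<or> conf T1 C1 b c"
    "conf T0 C0 c d \<or> conf T1 C1 c d" "a \<noteq> c" "b \<noteq> d" "a \<noteq> d"
    "\<not> (conf T0 C0 a c \<or> conf T1 C1 a c)" "\<not> (conf T0 C0 b d \<or> conf T1 C1 b d)"
    "\<not> (conf T0 C0 a d \<or> conf T1 C1 a d)" for a b c d
  proof (cases "b \<in> T0")
    case True
    then have "b \<notin> T1" using assms(1) by blast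
    then have 1: "conf T0 C0 a b" "conf T0 C0 b c" using h(1,2) conf_mem by metis+
    then have "c \<notin> T1" using assms(1) conf_mem by (metis disjoint_iff)
    then have "conf T0 C0 c d" using h(3) conf_mem by metis
    then show False using 1 h assms(4) unfolding contractible_def by blast
  next
    case False
    then have 1: "conf T1 C1 a b" "conf T1 C1 b c" using h(1,2) conf_mem by metis+
    then have "c \<notin> T0" using assms(1) conf_mem by (metis disjoint_iff)
    then have "conf T1 C1 c d" using h(3) conf_mem by metis
    then show False using 1 h assms(5) unfolding contractible_def by blast
  qed
  moreover have "finite (T0 \<union> T1)" using assms(4,5) by (simp add: contractible_def)
  ultimately show ?thesis unfolding contractible_def conf_union_mixed[OF assms(1-3)] by blast
qed

text \<open>The non-conflicts of an induced path \<open>a\<close>, \<open>b\<close>,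
  \<open>c\<close>, \<open>d\<close> are the pairs \<open>a\<close>-\<open>c\<close>,
  \<open>a\<close>-\<open>d\<close> and \<open>b\<close>-\<open>d\<close>, and these connect all
  four links. Since links on opposite sides conflict, all four lie on one side and violate its
  contractibility.\<close>

lemma contractible_union:
  assumes "T0 \<inter> T1 = {}" "C0 \<subseteq> T0 \<times> T0" "C1 \<subseteq> T1 \<times> T1" "contractible T0 C0" "contractible T1 C1"
  shows "contractible (T0 \<union> T1) (C0 \<union> C1)"
proof -
  let ?c = "conf (T0 \<union> T1) (C0 \<union> C1)"
  have False if h: "?c a b" "?c b c" "?c c d" "a \<noteq> c" "b \<noteq> d" "a \<noteq> d"
    "\<not> ?c a c" "\<not> ?c b d" "\<not> ?c a d" for a b c d
  proof -
    have T: "a \<in> T0 \<union> T1" "b \<in> T0 \<union> T1" "c \<in> T0 \<union> T1" "d \<in> T0 \<union> T1"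
      using h(1-3) conf_mem by metis+
    note cu = conf_union[OF assms(1-3)]
    have same: "x \<in> T0 \<longleftrightarrow> y \<in> T0" if "\<not> ?c x y" "x \<in> T0 \<union> T1" "y \<in> T0 \<union> T1" for x y
      using that unfolding cu by blast
    have eq: "a \<in> T0 \<longleftrightarrow> c \<in> T0" "b \<in> T0 \<longleftrightarrow> d \<in> T0" "a \<in> T0 \<longleftrightarrow> d \<in> T0"
      using same h(7-9) T by blast+
    show False
    proof (cases "a \<in> T0")
      case True
      then have "a \<notin> T1" "b \<notin> T1" "c \<notin> T1" "d \<notin> T1" using eq assms(1) by blast+
      then have "?c x y \<longleftrightarrow> conf T0 C0 x y" if "x \<in> {a,b,c,d}" "y \<in> {a,b,c,d}" for x y
        using that conf_mem[of T1 C1 x y] unfolding cu by blast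
      then show False using h assms(4) unfolding contractible_def by blast
    next
      case False
      then have "a \<notin> T0" "b \<notin> T0" "c \<notin> T0" "d \<notin> T0" using eq by blast+
      then have "?c x y \<longleftrightarrow> conf T1 C1 x y" if "x \<in> {a,b,c,d}" "y \<in> {a,b,c,d}" for x y
        using that conf_mem[of T0 C0 x y] unfolding cu by blast
      then show False using h assms(5) unfolding contractible_def by blast
    qed
  qed
  moreover have "finite (T0 \<union> T1)" using assms(4,5) by (simp add: contractible_def)
  ultimately show ?thesis unfolding contractible_def by blast
qed

text \<open>A leaf shared across the sides demands conflict between its links. The union with
  \<open>m = False\<close> supplies it; the mixed union makes these links coherent, hence the
  hypothesis \<open>sep\<close>.\<close>

lemma linking_union:
  assumes l0: "linking d \<Gamma> (T0, C0, R0)" and l1: "linking d \<Gamma> (T1, C1, R1)" and dis: "T0 \<inter> T1 = {}"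
    and sep: "m \<Longrightarrow> snd ` R0 \<inter> snd ` R1 = {}"
  shows "linking d \<Gamma> (T0 \<union> T1, C0 \<union> C1 \<union> (if m then T0 \<times> T1 \<union> T1 \<times> T0 else {}), R0 \<union> R1)"
proof -
  have C: "C0 \<subseteq> T0 \<times> T0" "C1 \<subseteq> T1 \<times> T1" and R: "R0 \<subseteq> T0 \<times> leaves \<Gamma>" "R1 \<subseteq> T1 \<times> leaves \<Gamma>"
    using l0 l1 by (auto simp: linking_def coh_space_def)
  let ?C = "C0 \<union> C1 \<union> (if m then T0 \<times> T1 \<union> T1 \<times> T0 else {})"
  have "coh_space (T0 \<union> T1) ?C"
    using l0 l1 dis by (auto simp: linking_def coh_space_def sym_def)
  moreover have "\<exists>x y. x \<noteq> y \<and> {v. (l, v) \<in> R0 \<union> R1} = {x, y} \<and> dual_leaves d \<Gamma> x y" if "l \<in> T0 \<union> T1" for l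
  proof (cases "l \<in> T0")
    case True
    then have "{v. (l, v) \<in> R0 \<union> R1} = {v. (l, v) \<in> R0}" using R dis by blast
    then show ?thesis using True l0 unfolding linking_def split by simp
  next
    case False
    then have "{v. (l, v) \<in> R0 \<union> R1} = {v. (l, v) \<in> R1}" using R dis by blast
    then show ?thesis using False that l1 unfolding linking_def split by simp
  qed
  moreover have "conf (T0 \<union> T1) ?C l l'" if h: "l \<noteq> l'" "(l, x) \<in> R0 \<union> R1" "(l', x) \<in> R0 \<union> R1" for l l' x
  proof -
    have "conf T0 C0 l l' \<or> conf T1 C1 l l' \<or> \<not> m \<and> (l \<in> T0 \<and> l' \<in> T1 \<or> l \<in> T1 \<and> l' \<in> T0)"
    proof (cases "(l, x) \<in> R0 \<longleftrightarrow> (l', x) \<in> R0")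
      case True
      then show ?thesis using h l0 l1 unfolding linking_def split by blast
    next
      case False
      then have "x \<in> snd ` R0 \<inter> snd ` R1" using h by force
      then have "\<not> m" using sep by blast
      then show ?thesis using False h R by blast
    qed
    then show ?thesis using conf_union[OF dis C] conf_union_mixed[OF dis C] by (cases m) auto
  qed
  moreover have "finite (T0 \<union> T1)" using l0 l1 by (simp add: linking_def)
  moreover have "R0 \<union> R1 \<subseteq> (T0 \<union> T1) \<times> leaves \<Gamma>" using R by blast
  ultimately show ?thesis unfolding linking_def split by metis
qed

text \<open>Conflict and coherence within a side are unchanged by the union, so a competitor
  restricts to a competitor on each side and is the union of the two restrictions.\<close>

lemma slicing_union:
  assumes s0: "slicing d \<Gamma> (T0, C0, R0)" and s1: "slicing d \<Gamma> (T1, C1, R1)" and dis: "T0 \<inter> T1 = {}"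
  shows "slicing d \<Gamma> (T0 \<union> T1, C0 \<union> C1, R0 \<union> R1)"
proof -
  have C: "C0 \<subseteq> T0 \<times> T0" "C1 \<subseteq> T1 \<times> T1" and R: "R0 \<subseteq> T0 \<times> leaves \<Gamma>" "R1 \<subseteq> T1 \<times> leaves \<Gamma>"
    and m: "is_map \<Gamma> T0 C0 R0" "is_map \<Gamma> T1 C1 R1"
    using s0 s1 by (auto simp: slicing_def linking_def coh_space_def)
  note cu = conf_union[OF dis C]
  have "is_map \<Gamma> (T0 \<union> T1) (C0 \<union> C1) (R0 \<union> R1)"
    unfolding is_map_def
  proof (intro conjI allI impI)
    show "R0 \<union> R1 \<subseteq> (T0 \<union> T1) \<times> leaves \<Gamma>" using R by blast
  next
    fix x1 y1 x2 y2 assume h: "(x1, y1) \<in> R0 \<union> R1" "(x2, y2) \<in> R0 \<union> R1" "(x1, x2) \<in> C0 \<union> C1"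
    then have "(x1, y1) \<in> R0 \<and> (x2, y2) \<in> R0 \<and> (x1, x2) \<in> C0 \<or> (x1, y1) \<in> R1 \<and> (x2, y2) \<in> R1 \<and> (x1, x2) \<in> C1"
      using R C dis by blast
    then show "coh_strict \<Gamma> y1 y2" using m unfolding is_map_def by blast
  next
    fix x1 y1 x2 y2 assume h: "(x1, y1) \<in> R0 \<union> R1" "(x2, y2) \<in> R0 \<union> R1" "coh_conflict \<Gamma> y1 y2"
    then show "conf (T0 \<union> T1) (C0 \<union> C1) x1 x2" using m R unfolding cu is_map_def by blast
  qed
  moreover have "X = R0 \<union> R1" if X: "R0 \<union> R1 \<subseteq> X" "is_map \<Gamma> (T0 \<union> T1) (C0 \<union> C1) X" for X
  proof -
    have "is_map \<Gamma> T0 C0 {(l, x). (l, x) \<in> X \<and> l \<in> T0}"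
      using is_map_restrict[OF X(2), of C0 T0] dis conf_mem[of T1 C1] unfolding cu by blast
    moreover have "R0 \<subseteq> {(l, x). (l, x) \<in> X \<and> l \<in> T0}" using X(1) R by blast
    ultimately have 0: "{(l, x). (l, x) \<in> X \<and> l \<in> T0} = R0" using s0 by (simp add: slicing_def)
    have "is_map \<Gamma> T1 C1 {(l, x). (l, x) \<in> X \<and> l \<in> T1}"
      using is_map_restrict[OF X(2), of C1 T1] dis conf_mem[of T0 C0] unfolding cu by blast
    moreover have "R1 \<subseteq> {(l, x). (l, x) \<in> X \<and> l \<in> T1}" using X(1) R by blast
    ultimately have 1: "{(l, x). (l, x) \<in> X \<and> l \<in> T1} = R1" using s1 by (simp add: slicing_def)
    have "X \<subseteq> (T0 \<union> T1) \<times> UNIV" using X(2) unfolding is_map_def by blast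
    then show ?thesis using 0 1 X(1) by blast
  qed
  moreover have "linking d \<Gamma> (T0 \<union> T1, C0 \<union> C1, R0 \<union> R1)"
    using linking_union[of d \<Gamma> T0 C0 R0 T1 C1 R1 False] s0 s1 dis by (simp add: slicing_def)
  moreover have "contractible (T0 \<union> T1) (C0 \<union> C1)"
    using contractible_union[OF dis C] s0 s1 by (simp add: slicing_def)
  ultimately show ?thesis unfolding slicing_def split by blast
qed

lemma (in premise) lift_coupled_all:
  fixes C :: "('l \<times> 'l) set"
  assumes "coupled (length \<Gamma>') (T, C, R)" "insert k S = {..<length \<Gamma>}"
  shows "coupled (length \<Gamma>) (T, C, apsnd (lift e) ` R)"
  unfolding coupled_def split
proof (intro allI impI)
  fix ql :: "'l \<Rightarrow> bool" and qi :: "nat \<Rightarrow> bool"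
  assume a: "\<forall>l l'. conf T C l l' \<longrightarrow> ql l = ql l'"
    and b: "\<forall>l i p. (l, i, p) \<in> apsnd (lift e) ` R \<longrightarrow> ql l = qi i"
  have "\<exists>b. (\<forall>l\<in>T. ql l = b) \<and> (\<forall>j\<in>insert k S. qi j = b)"
    by (rule lift_coupled_index[OF assms(1)]) (simp_all add: a b)
  then show "\<exists>b. (\<forall>l\<in>T. ql l = b) \<and> (\<forall>i<length \<Gamma>. qi i = b)"
    unfolding assms(2) lessThan_iff Ball_def .
qed

text \<open>The leaves of the premises exhaust those of the conclusion, and leaves from opposite
  sides lie in different formulas or meet at the tensor, so they are strictly coherent. This matches
  the coherence imposed between links of opposite sides; what remains is to keep a competitor from
  crossing.\<close>

lemma slicing_tensor:
  assumes k: "k \<notin> S0" "k \<notin> S1" and S: "S0 \<inter> S1 = {}" and all: "insert k (S0 \<union> S1) = {..<length \<Gamma>}"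
    and f: "\<Gamma> ! k = Bin CTens A B"
    and l0: "lists_at \<Gamma> (part S0 k {False}) \<Gamma>0 e0" and l1: "lists_at \<Gamma> (part S1 k {True}) \<Gamma>1 e1"
    and s0: "slicing d \<Gamma>0 (T0, C0, R0)" and s1: "slicing d \<Gamma>1 (T1, C1, R1)"
    and dis: "T0 \<inter> T1 = {}" and ne: "T0 \<noteq> {}" "T1 \<noteq> {}"
  shows "slicing d \<Gamma> (T0 \<union> T1, C0 \<union> C1 \<union> (T0 \<times> T1 \<union> T1 \<times> T0),
    apsnd (lift e0) ` R0 \<union> apsnd (lift e1) ` R1)"
proof -
  interpret p0: premise \<Gamma> S0 k "{False}" \<Gamma>0 e0 CTens A B
    using k all f l0 by unfold_locales auto
  interpret p1: premise \<Gamma> S1 k "{True}" \<Gamma>1 e1 CTens A B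
    using k all f l1 by unfold_locales auto
  have C: "C0 \<subseteq> T0 \<times> T0" "C1 \<subseteq> T1 \<times> T1" and R: "R0 \<subseteq> T0 \<times> leaves \<Gamma>0" "R1 \<subseteq> T1 \<times> leaves \<Gamma>1"
    and m: "is_map \<Gamma>0 T0 C0 R0" "is_map \<Gamma>1 T1 C1 R1"
    using s0 s1 by (auto simp: slicing_def linking_def coh_space_def)
  have max0: "\<And>R'. R0 \<subseteq> R' \<Longrightarrow> is_map \<Gamma>0 T0 C0 R' \<Longrightarrow> R' = R0"
    and max1: "\<And>R'. R1 \<subseteq> R' \<Longrightarrow> is_map \<Gamma>1 T1 C1 R' \<Longrightarrow> R' = R1"
    using s0 s1 by (auto simp: slicing_def)
  define Q0 Q1 where Q: "Q0 = apsnd (lift e0) ` R0" "Q1 = apsnd (lift e1) ` R1"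
  let ?T = "T0 \<union> T1" and ?C = "C0 \<union> C1 \<union> (T0 \<times> T1 \<union> T1 \<times> T0)"
  define L0 L1 where LL: "L0 = lift e0 ` leaves \<Gamma>0" "L1 = lift e1 ` leaves \<Gamma>1"
  note cu = conf_union_mixed[OF dis C]
  have M: "is_map \<Gamma> T0 C0 Q0" "is_map \<Gamma> T1 C1 Q1"
    using m p0.lift_map[OF R(1)] p1.lift_map[OF R(2)] unfolding Q by blast+
  have RL: "Q0 \<subseteq> T0 \<times> L0" "Q1 \<subseteq> T1 \<times> L1" using R unfolding Q LL by auto
  have L: "L0 \<subseteq> leaves \<Gamma>" "L1 \<subseteq> leaves \<Gamma>" using p0.lift_leaf p1.lift_leaf unfolding LL by auto
  have cov: "leaves \<Gamma> \<subseteq> L0 \<union> L1"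
  proof clarify
    fix j p assume jp: "(j, p) \<in> leaves \<Gamma>" and no: "(j, p) \<notin> L1"
    have "j < length \<Gamma>" using jp by (simp add: leaves_def)
    then have "(j \<in> S0 \<or> j = k \<and> hd p \<in> {False}) \<or> (j \<in> S1 \<or> j = k \<and> hd p \<in> {True})"
      using all by auto
    then show "(j, p) \<in> L0" using p0.lift_cover[OF jp] p1.lift_cover[OF jp] no unfolding LL by blast
  qed
  have cross: "coh_strict \<Gamma> x y \<and> coh_strict \<Gamma> y x \<and> \<not> coh_conflict \<Gamma> x y \<and> \<not> coh_conflict \<Gamma> y x"
    if x: "x \<in> L0" and y: "y \<in> L1" for x y
  proof -
    obtain u where u: "u \<in> leaves \<Gamma>0" "x = lift e0 u" using x unfolding LL by blast
    obtain v where v: "v \<in> leaves \<Gamma>1" "y = lift e1 v" using y unfolding LL by blast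
    have eu: "fst x \<in> S0 \<or> fst x = k \<and> (\<exists>p. snd x = False # p)"
      using p0.e_in[OF p0.leavesD[OF u(1)]] u(2) by (auto simp: part_def lift_def)
    have ev: "fst y \<in> S1 \<or> fst y = k \<and> (\<exists>p. snd y = True # p)"
      using p1.e_in[OF p1.leavesD[OF v(1)]] v(2) by (auto simp: part_def lift_def)
    have "x \<noteq> y" using eu ev S k by auto
    moreover have "\<not> coh_conflict \<Gamma> x y"
    proof
      assume c: "coh_conflict \<Gamma> x y"
      then have eq: "fst x = fst y" by (simp add: coh_conflict_def)
      then have kx: "fst x = k" using eu ev S k by auto
      then obtain p q where "snd x = False # p" "snd y = True # q" using eu ev k eq by auto
      then have "lcp (snd x) (snd y) = []" by simp
      then show False using c kx f by (simp add: coh_conflict_def)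
    qed
    ultimately show ?thesis using L x y coh_conflict_sym[of \<Gamma> x y] unfolding coh_strict_def by blast
  qed
  have "is_map \<Gamma> ?T ?C (Q0 \<union> Q1)"
    unfolding is_map_def
  proof (intro conjI allI impI)
    show "Q0 \<union> Q1 \<subseteq> ?T \<times> leaves \<Gamma>" using RL L by blast
  next
    fix x1 y1 x2 y2 assume h: "(x1, y1) \<in> Q0 \<union> Q1" "(x2, y2) \<in> Q0 \<union> Q1" "(x1, x2) \<in> ?C"
    consider "(x1, y1) \<in> Q0" "(x2, y2) \<in> Q0" | "(x1, y1) \<in> Q1" "(x2, y2) \<in> Q1"
      | "(x1, y1) \<in> Q0" "(x2, y2) \<in> Q1" | "(x1, y1) \<in> Q1" "(x2, y2) \<in> Q0"
      using h(1,2) by blast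
    then show "coh_strict \<Gamma> y1 y2"
    proof cases
      case 1
      then have "(x1, x2) \<in> C0" using h(3) RL dis C by blast
      then show ?thesis using M(1) 1 unfolding is_map_def by blast
    next
      case 2
      then have "(x1, x2) \<in> C1" using h(3) RL dis C by blast
      then show ?thesis using M(2) 2 unfolding is_map_def by blast
    next
      case 3
      then show ?thesis using cross RL by blast
    next
      case 4
      then show ?thesis using cross RL by blast
    qed
  next
    fix x1 y1 x2 y2 assume h: "(x1, y1) \<in> Q0 \<union> Q1" "(x2, y2) \<in> Q0 \<union> Q1" "coh_conflict \<Gamma> y1 y2"
    consider "(x1, y1) \<in> Q0" "(x2, y2) \<in> Q0" | "(x1, y1) \<in> Q1" "(x2, y2) \<in> Q1"
      | "(x1, y1) \<in> Q0" "(x2, y2) \<in> Q1" | "(x1, y1) \<in> Q1" "(x2, y2) \<in> Q0"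
      using h(1,2) by blast
    then show "conf ?T ?C x1 x2"
    proof cases
      case 1
      then show ?thesis using M(1) h(3) unfolding is_map_def cu by blast
    next
      case 2
      then show ?thesis using M(2) h(3) unfolding is_map_def cu by blast
    next
      case 3
      then show ?thesis using cross RL h(3) by blast
    next
      case 4
      then show ?thesis using cross RL h(3) by blast
    qed
  qed
  moreover have "X = Q0 \<union> Q1" if X: "Q0 \<union> Q1 \<subseteq> X" "is_map \<Gamma> ?T ?C X" for X
  proof -
    let ?X0 = "{(l, x). (l, x) \<in> X \<and> l \<in> T0}" and ?X1 = "{(l, x). (l, x) \<in> X \<and> l \<in> T1}"
    have XL: "X \<subseteq> ?T \<times> leaves \<Gamma>" using X(2) by (simp add: is_map_def)
    \<comment> \<open>A link of one side cannot reach a leaf of the other: it is coherent with all links there,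
      and by maximality of that side every leaf is equal to or in conflict with a linked one.\<close>
    have "x \<in> L0" if lx: "(l, x) \<in> X" "l \<in> T0" for l x
    proof (rule ccontr)
      assume "x \<notin> L0"
      then obtain z where z: "z \<in> leaves \<Gamma>1" "x = lift e1 z" using lx cov XL unfolding LL by blast
      then obtain n y where y: "(n, y) \<in> R1" "y = z \<or> coh_conflict \<Gamma>1 z y"
        using slicing_meets[OF s1 ne(2)] by blast
      then have "y \<in> leaves \<Gamma>1" "(n, lift e1 y) \<in> X" "n \<in> T1" using R X(1) unfolding Q by force+
      moreover have "coh_strict \<Gamma> x (lift e1 y)"
        using X(2) lx calculation unfolding is_map_def by blast
      ultimately show False using y(2) z p1.lift_conflict[of z y] unfolding coh_strict_def by blast
    qed
    then have X0: "?X0 \<subseteq> T0 \<times> L0" by blast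
    have "x \<in> L1" if lx: "(l, x) \<in> X" "l \<in> T1" for l x
    proof (rule ccontr)
      assume "x \<notin> L1"
      then obtain z where z: "z \<in> leaves \<Gamma>0" "x = lift e0 z" using lx cov XL unfolding LL by blast
      then obtain n y where y: "(n, y) \<in> R0" "y = z \<or> coh_conflict \<Gamma>0 z y"
        using slicing_meets[OF s0 ne(1)] by blast
      then have "y \<in> leaves \<Gamma>0" "(n, lift e0 y) \<in> X" "n \<in> T0" using R X(1) unfolding Q by force+
      moreover have "coh_strict \<Gamma> x (lift e0 y)"
        using X(2) lx calculation unfolding is_map_def by blast
      ultimately show False using y(2) z p0.lift_conflict[of z y] unfolding coh_strict_def by blast
    qed
    then have X1: "?X1 \<subseteq> T1 \<times> L1" by blast
    have "is_map \<Gamma> T0 C0 ?X0"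
      by (rule is_map_restrict[OF X(2)]) (use dis conf_mem[of T1 C1] in \<open>unfold cu, blast+\<close>)
    moreover have "Q0 \<subseteq> ?X0" using X(1) RL(1) by blast
    ultimately have 0: "?X0 = Q0" using p0.lift_maximal[OF max0 R(1)] X0 unfolding Q LL by blast
    have "is_map \<Gamma> T1 C1 ?X1"
      by (rule is_map_restrict[OF X(2)]) (use dis conf_mem[of T0 C0] in \<open>unfold cu, blast+\<close>)
    moreover have "Q1 \<subseteq> ?X1" using X(1) RL(2) by blast
    ultimately have 1: "?X1 = Q1" using p1.lift_maximal[OF max1 R(2)] X1 unfolding Q LL by blast
    have "X = ?X0 \<union> ?X1" using XL by blast
    then show ?thesis unfolding 0 1 .
  qed
  moreover have "linking d \<Gamma> (?T, ?C, Q0 \<union> Q1)"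
  proof -
    have "linking d \<Gamma> (T0, C0, Q0)" "linking d \<Gamma> (T1, C1, Q1)"
      using p0.lift_linking[of d T0 C0 R0] p1.lift_linking[of d T1 C1 R1] s0 s1 unfolding Q
      by (simp_all add: slicing_def)
    moreover have "snd ` Q0 \<inter> snd ` Q1 = {}"
    proof -
      have "snd ` Q0 \<subseteq> L0" "snd ` Q1 \<subseteq> L1" using RL by force+
      then show ?thesis using cross unfolding coh_strict_def by blast
    qed
    ultimately show ?thesis using linking_union[of d \<Gamma> T0 C0 Q0 T1 C1 Q1 True] dis by simp
  qed
  moreover have "contractible ?T ?C"
    using contractible_union_mixed[OF dis C] s0 s1 by (simp add: slicing_def)
  ultimately show ?thesis unfolding slicing_def split Q[symmetric] by blast
qed

lemma slicing_axiom:
  "slicing d [Lit P, Lit (d P)] ({l}, {}, {(l, (0, [])), (l, (1, []))})"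
proof -
  have lv: "leaves [Lit P, Lit (d P)] = {(0, []), (1, [])}"
  proof -
    have "subf (Lit Q) p = Some (Lit a) \<longleftrightarrow> p = [] \<and> a = Q" for Q a :: 'a and p
      by (cases p) auto
    then show ?thesis by (auto simp: leaves_def less_Suc_eq)
  qed
  have map: "is_map [Lit P, Lit (d P)] {l} {} {(l, (0, [])), (l, (1, []))}"
    by (auto simp: is_map_def lv coh_conflict_def)
  have max: "R' = {(l, (0, [])), (l, (1, []))}"
    if "{(l, (0, [])), (l, (1, []))} \<subseteq> R'" "is_map [Lit P, Lit (d P)] {l} {} R'" for R'
    using that unfolding is_map_def lv by blast
  have "{v. (l, v) \<in> {(l, (0, [])), (l, (1, []))}} = {(0 :: nat, [] :: bool list), (1, [])}"
    by auto
  moreover have "dual_leaves d [Lit P, Lit (d P)] (0, []) (1, [])"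
    by (simp add: dual_leaves_def)
  ultimately have "\<exists>x y. x \<noteq> y \<and> {v. (l, v) \<in> {(l, (0, [])), (l, (1, []))}} = {x, y} \<and>
      dual_leaves d [Lit P, Lit (d P)] x y"
    by (metis prod.inject zero_neq_one)
  then have "linking d [Lit P, Lit (d P)] ({l}, {}, {(l, (0, [])), (l, (1, []))})"
    by (simp add: linking_def coh_space_def lv) blast
  then show ?thesis
    using map max by (simp add: slicing_def contractible_def conf_def)
qed

text \<open>One induction for all three facts, since they feed each other: maximality in the
  conclusion rests on \<open>touching\<close> of the premises, and for a tensor on each premise
  having a link at all, which \<open>touching\<close> includes.\<close>

lemma derives_sound:
  assumes "derives d \<Gamma> \<Lambda>"
  shows "slicing d \<Gamma> \<Lambda> \<and> touching (length \<Gamma>) \<Lambda> \<and> coupled (length \<Gamma>) \<Lambda>"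
  using assms
proof (induction rule: derives.induct)
  case (ax P l)
  have "touching 2 ({l}, {}, {(l, (0, [])), (l, (1, []))})"
    by (auto simp: touching_def less_2_cases_iff)
  moreover have "coupled 2 ({l}, {}, {(l, (0, [])), (l, (1, []))})"
    unfolding coupled_def split
  proof (intro allI impI)
    fix ql :: "'b \<Rightarrow> bool" and qi :: "nat \<Rightarrow> bool"
    assume "\<forall>m i p. (m, i, p) \<in> {(l, 0, []), (l, 1, [])} \<longrightarrow> ql m = qi i"
    then have "ql l = qi 0" "ql l = qi 1" by blast+
    then show "\<exists>b. (\<forall>m\<in>{l}. ql m = b) \<and> (\<forall>i<2. qi i = b)" by (auto simp: less_2_cases_iff)
  qed
  ultimately show ?case using slicing_axiom by (simp add: numeral_2_eq_2)
next
  case (par k S \<Gamma> A B \<Gamma>' e \<Lambda>)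
  obtain T C R where L: "\<Lambda> = (T, C, R)" by (cases \<Lambda>)
  interpret premise \<Gamma> S k UNIV \<Gamma>' e CPar A B
    using par by unfold_locales auto
  note IH = par.IH[unfolded L]
  have "touching (length \<Gamma>) (T, C, apsnd (lift e) ` R)"
    using lift_touch_index[of T C R] IH par(2) unfolding touching_def split by blast
  moreover have "coupled (length \<Gamma>) (T, C, apsnd (lift e) ` R)"
    using lift_coupled_all[of T C R] IH par(2) by blast
  ultimately show ?case using lift_slicing_choice[of d T C R] IH par(2) by (simp add: L transport_simp)
next
  case (plus k S \<Gamma> A B b \<Gamma>' e \<Lambda>)
  obtain T C R where L: "\<Lambda> = (T, C, R)" by (cases \<Lambda>)
  interpret premise \<Gamma> S k "{b}" \<Gamma>' e CPlus A B
    using plus by unfold_locales auto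
  note IH = plus.IH[unfolded L]
  have "touching (length \<Gamma>) (T, C, apsnd (lift e) ` R)"
    using lift_touch_index[of T C R] IH plus(2) unfolding touching_def split by blast
  moreover have "coupled (length \<Gamma>) (T, C, apsnd (lift e) ` R)"
    using lift_coupled_all[of T C R] IH plus(2) by blast
  ultimately show ?case using lift_slicing_choice[of d T C R] IH plus(2) by (simp add: L transport_simp)
next
  case (tens k S0 S1 \<Gamma> A B \<Gamma>0 e0 \<Gamma>1 e1 \<Lambda>0 \<Lambda>1)
  obtain T0 C0 R0 where L0: "\<Lambda>0 = (T0, C0, R0)" by (cases \<Lambda>0)
  obtain T1 C1 R1 where L1: "\<Lambda>1 = (T1, C1, R1)" by (cases \<Lambda>1)
  interpret p0: premise \<Gamma> S0 k "{False}" \<Gamma>0 e0 CTens A B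
    using tens by unfold_locales auto
  interpret p1: premise \<Gamma> S1 k "{True}" \<Gamma>1 e1 CTens A B
    using tens by unfold_locales auto
  note IH = tens.IH[unfolded L0 L1]
  let ?R = "apsnd (lift e0) ` R0 \<union> apsnd (lift e1) ` R1" and ?C = "C0 \<union> C1 \<union> (T0 \<times> T1 \<union> T1 \<times> T0)"
  have ne: "T0 \<noteq> {}" "T1 \<noteq> {}" using IH by (auto simp: touching_def)
  have dis: "T0 \<inter> T1 = {}" using tens L0 L1 by simp
  have C: "C0 \<subseteq> T0 \<times> T0" "C1 \<subseteq> T1 \<times> T1" using IH by (auto simp: slicing_def linking_def coh_space_def)
  have lu: "link_union True (transport (lift e0) \<Lambda>0) (transport (lift e1) \<Lambda>1) = (T0 \<union> T1, ?C, ?R)"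
    by (simp add: link_union_def L0 L1 transport_simp)
  have "touching (length \<Gamma>) (T0 \<union> T1, ?C, ?R)"
    unfolding touching_def split
  proof (intro conjI ballI allI impI)
    show "T0 \<union> T1 \<noteq> {}" using ne by blast
    fix l i assume l: "l \<in> T0 \<union> T1" and i: "i < length \<Gamma>"
    have t0: "\<exists>l'\<in>T0. \<exists>p. (l' = m \<or> (m, l') \<in> C0) \<and> (l', (i, p)) \<in> apsnd (lift e0) ` R0"
      if "i \<in> insert k S0" "m \<in> T0" for m
      using p0.lift_touch_index[of T0 C0 R0 m i] that IH by blast
    have t1: "\<exists>l'\<in>T1. \<exists>p. (l' = m \<or> (m, l') \<in> C1) \<and> (l', (i, p)) \<in> apsnd (lift e1) ` R1"
      if "i \<in> insert k S1" "m \<in> T1" for m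
      using p1.lift_touch_index[of T1 C1 R1 m i] that IH by blast
    consider "i \<in> insert k S0" | "i \<in> insert k S1" using i tens(4) by blast
    then show "\<exists>l'\<in>T0 \<union> T1. \<exists>p. (l' = l \<or> (l, l') \<in> ?C) \<and> (l', (i, p)) \<in> ?R"
    proof cases
      case 1
      show ?thesis
      proof (cases "l \<in> T0")
        case True then show ?thesis using t0[OF 1, of l] by blast
      next
        case False
        \<comment> \<open>Any link of the other side will do: whichever link at or next to
          \<open>m\<close> meets formula \<open>i\<close> is coherent with \<open>l\<close>, because
          \<open>l\<close> lies on the opposite side.\<close>
        obtain m where "m \<in> T0" using ne by blast
        then show ?thesis using t0[OF 1, of m] False l by blast
      qed
    next
      case 2
      show ?thesis
      proof (cases "l \<in> T1")
        case True then show ?thesis using t1[OF 2, of l] by blast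
      next
        case False
        obtain m where "m \<in> T1" using ne by blast
        then show ?thesis using t1[OF 2, of m] False l by blast
      qed
    qed
  qed
  moreover have "coupled (length \<Gamma>) (T0 \<union> T1, ?C, ?R)"
    unfolding coupled_def split
  proof (intro allI impI)
    fix ql :: "'b \<Rightarrow> bool" and qi :: "nat \<Rightarrow> bool"
    assume a: "\<forall>l l'. conf (T0 \<union> T1) ?C l l' \<longrightarrow> ql l = ql l'" and b: "\<forall>l i p. (l, i, p) \<in> ?R \<longrightarrow> ql l = qi i"
    have "\<exists>b. (\<forall>l\<in>T0. ql l = b) \<and> (\<forall>j\<in>insert k S0. qi j = b)"
      by (rule p0.lift_coupled_index[of T0 C0 R0]) (use a b IH conf_union_mixed[OF dis C] in blast)+
    moreover have "\<exists>b. (\<forall>l\<in>T1. ql l = b) \<and> (\<forall>j\<in>insert k S1. qi j = b)"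
      by (rule p1.lift_coupled_index[of T1 C1 R1]) (use a b IH conf_union_mixed[OF dis C] in blast)+
    moreover have "i \<in> insert k S0 \<union> insert k S1" if "i < length \<Gamma>" for i using that tens(4) by blast
    \<comment> \<open>Both premises contain a subformula at index \<open>k\<close>, so their two
      constants agree.\<close>
    ultimately show "\<exists>b. (\<forall>l\<in>T0 \<union> T1. ql l = b) \<and> (\<forall>i<length \<Gamma>. qi i = b)"
      by (metis UnE insertI1)
  qed
  moreover have "slicing d \<Gamma> (T0 \<union> T1, ?C, ?R)"
    using slicing_tensor[OF tens(1-7) _ _ dis ne] IH by blast
  ultimately show ?case unfolding lu by blast
next
  case (withr k S \<Gamma> A B \<Gamma>0 e0 \<Gamma>1 e1 \<Lambda>0 \<Lambda>1)
  obtain T0 C0 R0 where L0: "\<Lambda>0 = (T0, C0, R0)" by (cases \<Lambda>0)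
  obtain T1 C1 R1 where L1: "\<Lambda>1 = (T1, C1, R1)" by (cases \<Lambda>1)
  interpret p0: premise \<Gamma> S k "{False}" \<Gamma>0 e0 CWith A B
    using withr by unfold_locales auto
  interpret p1: premise \<Gamma> S k "{True}" \<Gamma>1 e1 CWith A B
    using withr by unfold_locales auto
  note IH = withr.IH[unfolded L0 L1]
  let ?R = "apsnd (lift e0) ` R0 \<union> apsnd (lift e1) ` R1" and ?C = "C0 \<union> C1"
  have ne: "T0 \<noteq> {}" "T1 \<noteq> {}" using IH by (auto simp: touching_def)
  have dis: "T0 \<inter> T1 = {}" using withr L0 L1 by simp
  have C: "C0 \<subseteq> T0 \<times> T0" "C1 \<subseteq> T1 \<times> T1" using IH by (auto simp: slicing_def linking_def coh_space_def)
  have lu: "link_union False (transport (lift e0) \<Lambda>0) (transport (lift e1) \<Lambda>1) = (T0 \<union> T1, ?C, ?R)"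
    by (simp add: link_union_def L0 L1 transport_simp)
  have "touching (length \<Gamma>) (T0 \<union> T1, ?C, ?R)"
    unfolding touching_def split
  proof (intro conjI ballI allI impI)
    show "T0 \<union> T1 \<noteq> {}" using ne by blast
    fix l i assume l: "l \<in> T0 \<union> T1" and "i < length \<Gamma>"
    then have i: "i \<in> insert k S" using withr(2) by blast
    show "\<exists>l'\<in>T0 \<union> T1. \<exists>p. (l' = l \<or> (l, l') \<in> ?C) \<and> (l', (i, p)) \<in> ?R"
    proof (cases "l \<in> T0")
      case True then show ?thesis using p0.lift_touch_index[of T0 C0 R0 l i] i IH by blast
    next
      case False then show ?thesis using p1.lift_touch_index[of T1 C1 R1 l i] i l IH by blast
    qed
  qed
  moreover have "coupled (length \<Gamma>) (T0 \<union> T1, ?C, ?R)"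
    unfolding coupled_def split
  proof (intro allI impI)
    fix ql :: "'b \<Rightarrow> bool" and qi :: "nat \<Rightarrow> bool"
    assume a: "\<forall>l l'. conf (T0 \<union> T1) ?C l l' \<longrightarrow> ql l = ql l'" and b: "\<forall>l i p. (l, i, p) \<in> ?R \<longrightarrow> ql l = qi i"
    have "\<exists>b. (\<forall>l\<in>T0. ql l = b) \<and> (\<forall>j\<in>insert k S. qi j = b)"
      by (rule p0.lift_coupled_index[of T0 C0 R0]) (use a b IH conf_union[OF dis C] in blast)+
    moreover have "\<exists>b. (\<forall>l\<in>T1. ql l = b) \<and> (\<forall>j\<in>insert k S. qi j = b)"
      by (rule p1.lift_coupled_index[of T1 C1 R1]) (use a b IH conf_union[OF dis C] in blast)+
    ultimately show "\<exists>b. (\<forall>l\<in>T0 \<union> T1. ql l = b) \<and> (\<forall>i<length \<Gamma>. qi i = b)"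
      using withr(2) by (metis UnE insertI1 lessThan_iff)
  qed
  moreover have "slicing d \<Gamma> (T0 \<union> T1, ?C, ?R)"
    using slicing_union[OF p0.lift_slicing_choice p1.lift_slicing_choice dis] IH withr(2) by blast
  ultimately show ?case unfolding lu by blast
qed

lemma derives_supported:
  assumes "derives d \<Gamma> \<Lambda>"
  shows "supported (length \<Gamma>) \<Lambda>"
  using derives_sound[OF assms]
  by (cases \<Lambda>) (auto simp: supported_def slicing_def linking_def coh_space_def leaves_def)

section \<open>Independence of the order of formulas\<close>

lemma lists_at_unique:
  assumes "lists_at \<Gamma> E \<Gamma>1 e1" "lists_at \<Gamma> E \<Gamma>2 e2"
  obtains \<rho> where "length \<Gamma>2 = length \<Gamma>1" "bij_betw \<rho> {..<length \<Gamma>1} {..<length \<Gamma>1}"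
    "\<And>i. i < length \<Gamma>1 \<Longrightarrow> e2 (\<rho> i) = e1 i \<and> \<Gamma>2 ! \<rho> i = \<Gamma>1 ! i"
proof -
  let ?I1 = "{..<length \<Gamma>1}" and ?I2 = "{..<length \<Gamma>2}"
  have b: "bij_betw e1 ?I1 E" "bij_betw e2 ?I2 E" using assms by (auto simp: lists_at_def)
  have len: "length \<Gamma>2 = length \<Gamma>1"
    using bij_betw_same_card[OF b(1)] bij_betw_same_card[OF b(2)] by simp
  define \<rho> where "\<rho> = inv_into ?I2 e2 \<circ> e1"
  have bij: "bij_betw \<rho> ?I1 ?I2"
    unfolding \<rho>_def by (rule bij_betw_trans[OF b(1) bij_betw_inv_into[OF b(2)]])
  moreover have "e2 (\<rho> i) = e1 i \<and> \<Gamma>2 ! \<rho> i = \<Gamma>1 ! i" if "i < length \<Gamma>1" for i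
  proof -
    have "e1 i \<in> E" using that b(1) by (auto simp: bij_betw_def)
    then have e: "e2 (\<rho> i) = e1 i" using bij_betw_inv_into_right[OF b(2)] by (simp add: \<rho>_def)
    have "\<rho> i < length \<Gamma>2" using bij that by (auto simp: bij_betw_def)
    then have "Some (\<Gamma>2 ! \<rho> i) = Some (\<Gamma>1 ! i)"
      using assms that e unfolding lists_at_def by metis
    then show ?thesis using e by simp
  qed
  ultimately show thesis using that len by simp
qed

text \<open>Stated for an abstract \<open>P\<close> because it is applied both to
  \<open>derives\<close> and to translations up to renaming: a premise listed in one order may be
  replaced by the same premise in another order without changing its image in the
  conclusion.\<close>

lemma relist:
  assumes l: "lists_at \<Gamma> E \<Gamma>1 e1" "lists_at \<Gamma> E \<Gamma>2 e2" and s: "supported (length \<Gamma>1) \<Lambda>"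
    and closed: "\<And>\<rho>. length \<Gamma>2 = length \<Gamma>1 \<Longrightarrow> bij_betw \<rho> {..<length \<Gamma>1} {..<length \<Gamma>1} \<Longrightarrow>
      (\<And>i. i < length \<Gamma>1 \<Longrightarrow> \<Gamma>2 ! \<rho> i = \<Gamma>1 ! i) \<Longrightarrow> P (transport (lift (\<lambda>i. (\<rho> i, []))) \<Lambda>)"
  obtains M where "P M" "transport (lift e1) \<Lambda> = transport (lift e2) M" "fst M = fst \<Lambda>"
proof -
  obtain \<rho> where \<rho>: "length \<Gamma>2 = length \<Gamma>1" "bij_betw \<rho> {..<length \<Gamma>1} {..<length \<Gamma>1}"
    "\<And>i. i < length \<Gamma>1 \<Longrightarrow> e2 (\<rho> i) = e1 i \<and> \<Gamma>2 ! \<rho> i = \<Gamma>1 ! i"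
    using lists_at_unique[OF l] by blast
  have "transport (lift e1) \<Lambda> = transport (lift e2) (transport (lift (\<lambda>i. (\<rho> i, []))) \<Lambda>)"
    unfolding transport_transport
  proof (rule transport_cong)
    fix m x assume "(m, x) \<in> snd (snd \<Lambda>)"
    then have "fst x < length \<Gamma>1" using s by (cases \<Lambda>) (auto simp: supported_def)
    then show "lift e1 x = (lift e2 \<circ> lift (\<lambda>i. (\<rho> i, []))) x"
      using \<rho>(3) by (simp add: lift_lift) (simp add: lift_def)
  qed
  then show thesis using that closed[OF \<rho>(1,2)] \<rho>(3) by simp
qed

lemma lists_at_perm:
  assumes l: "lists_at \<Gamma> (part S k B) \<Gamma>' e" and b: "insert k S \<subseteq> {..<length \<Gamma>}"
    and \<pi>: "bij_betw \<pi> {..<length \<Gamma>} {..<length \<Gamma>}" and n: "\<And>i. i < length \<Gamma> \<Longrightarrow> \<Gamma>2 ! \<pi> i = \<Gamma> ! i"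
  shows "lists_at \<Gamma>2 (part (\<pi> ` S) (\<pi> k) B) \<Gamma>' (\<lambda>i. (\<pi> (fst (e i)), snd (e i)))"
proof -
  have e: "bij_betw e {..<length \<Gamma>'} (part S k B)" using l by (simp add: lists_at_def)
  have inj: "inj_on \<pi> (insert k S)" by (rule inj_on_subset[OF bij_betw_imp_inj_on[OF \<pi>] b])
  have fst_part: "fst y \<in> insert k S" if "y \<in> part S k B" for y using that by (auto simp: part_def)
  have "bij_betw (map_prod \<pi> id) (part S k B) (part (\<pi> ` S) (\<pi> k) B)"
    unfolding bij_betw_def
  proof
    show "inj_on (map_prod \<pi> id) (part S k B)"
    proof (rule inj_onI)
      fix x y assume xy: "x \<in> part S k B" "y \<in> part S k B" "map_prod \<pi> id x = map_prod \<pi> id y"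
      then have "\<pi> (fst x) = \<pi> (fst y)" "snd x = snd y" by (auto simp: map_prod_def split_beta)
      then show "x = y" using inj_onD[OF inj] fst_part xy(1,2) by (simp add: prod_eq_iff)
    qed
    show "map_prod \<pi> id ` part S k B = part (\<pi> ` S) (\<pi> k) B"
      by (simp add: part_def image_Un image_image)
  qed
  then have "bij_betw (map_prod \<pi> id \<circ> e) {..<length \<Gamma>'} (part (\<pi> ` S) (\<pi> k) B)"
    by (rule bij_betw_trans[OF e])
  moreover have "map_prod \<pi> id \<circ> e = (\<lambda>i. (\<pi> (fst (e i)), snd (e i)))"
    by (auto simp: map_prod_def split_beta)
  moreover have "fst (e i) < length \<Gamma>" if "i < length \<Gamma>'" for i
  proof -
    have "e i \<in> part S k B" using that e by (auto simp: bij_betw_def)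
    then show ?thesis using fst_part b by blast
  qed
  ultimately show ?thesis using l n by (simp add: lists_at_def)
qed

lemma transport_link_union:
  "transport f (link_union m \<Lambda> M) = link_union m (transport f \<Lambda>) (transport f M)"
  by (cases \<Lambda>; cases M) (simp add: link_union_def transport_simp image_Un)

lemma lift_comp_perm: "lift (\<lambda>i. (\<pi> i, [])) \<circ> lift e = lift (\<lambda>i. (\<pi> (fst (e i)), snd (e i)))"
  by (auto simp: lift_def)

text \<open>Only the last rule is inspected: permuting the conclusion moves \<open>k\<close>, the
  context and the enumerations, while the premises stay as they are. Swapping the axiom on
  \<open>P\<close> gives the axiom on \<open>d P\<close>, by involutivity.\<close>

lemma derives_perm:
  assumes inv: "\<forall>a. d (d a) = a" and der: "derives d \<Gamma> \<Lambda>"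
    and \<pi>: "bij_betw \<pi> {..<length \<Gamma>} {..<length \<Gamma>}"
    and len: "length \<Gamma>2 = length \<Gamma>" and n: "\<And>i. i < length \<Gamma> \<Longrightarrow> \<Gamma>2 ! \<pi> i = \<Gamma> ! i"
  shows "derives d \<Gamma>2 (transport (lift (\<lambda>i. (\<pi> i, []))) \<Lambda>)"
proof -
  have inj: "\<pi> i = \<pi> j \<longleftrightarrow> i = j" if "i < length \<Gamma>" "j < length \<Gamma>" for i j
    using \<pi> that by (auto simp: bij_betw_def inj_on_def)
  have img: "\<pi> ` {..<length \<Gamma>} = {..<length \<Gamma>2}" using \<pi> len by (simp add: bij_betw_def)
  have split1: "\<pi> k \<notin> \<pi> ` S" if "k \<notin> S" "insert k S \<subseteq> {..<length \<Gamma>}" for k S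
    using that inj by auto
  have split2: "insert (\<pi> k) (\<pi> ` S) = {..<length \<Gamma>2}" if "insert k S = {..<length \<Gamma>}" for k S
    using that img by (metis image_insert)
  show ?thesis
    using der
  proof cases
    case (ax P l)
    then have "length \<Gamma>2 = 2" using len by simp
    then obtain X Y where XY: "\<Gamma>2 = [X, Y]"
      by (auto simp: length_Suc_conv numeral_2_eq_2)
    have "\<pi> 0 < 2" "\<pi> 1 < 2" using bij_betwE[OF \<pi>] ax by (simp_all add: numeral_2_eq_2)
    moreover have "\<pi> 0 \<noteq> \<pi> 1" using inj[of 0 1] ax by simp
    ultimately consider "\<pi> 0 = 0" "\<pi> 1 = 1" | "\<pi> 0 = 1" "\<pi> 1 = 0" by linarith
    then show ?thesis
    proof cases
      case 1
      then have "\<Gamma>2 = [Lit P, Lit (d P)]" using n[of 0] n[of 1] ax XY by simp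
      moreover have "transport (lift (\<lambda>i. (\<pi> i, []))) \<Lambda> = \<Lambda>"
        using 1 ax by (intro transport_ident) (auto simp: lift_def)
      ultimately show ?thesis using derives.ax[of d P l] ax by simp
    next
      case 2
      then have "\<Gamma>2 = [Lit (d P), Lit (d (d P))]" using n[of 0] n[of 1] ax XY inv by simp
      moreover have "transport (lift (\<lambda>i. (\<pi> i, []))) \<Lambda> = ({l}, {}, {(l, (0, [])), (l, (1, []))})"
        using 2 ax by (auto simp: transport_simp lift_def)
      ultimately show ?thesis using derives.ax[of d "d P" l] by simp
    qed
  next
    case (par k S A B \<Gamma>' e M)
    then have "k < length \<Gamma>" by auto
    then show ?thesis
      unfolding par(1) transport_transport lift_comp_perm
      using par by (intro derives.par[OF split1 split2 _ lists_at_perm[OF _ _ \<pi> n]]) (auto simp: n)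
  next
    case (plus k S A B b \<Gamma>' e M)
    then have "k < length \<Gamma>" by auto
    then show ?thesis
      unfolding plus(1) transport_transport lift_comp_perm
      using plus by (intro derives.plus[OF split1 split2 _ lists_at_perm[OF _ _ \<pi> n]]) (auto simp: n)
  next
    case (tens k S0 S1 A B \<Gamma>0 e0 \<Gamma>1 e1 \<Lambda>0 \<Lambda>1)
    then have k: "k < length \<Gamma>" by auto
    have "\<pi> ` S0 \<inter> \<pi> ` S1 = {}" "insert (\<pi> k) (\<pi> ` S0 \<union> \<pi> ` S1) = {..<length \<Gamma>2}"
    proof -
      have "S0 \<subseteq> {..<length \<Gamma>}" "S1 \<subseteq> {..<length \<Gamma>}" using tens(5) by blast+
      then show "\<pi> ` S0 \<inter> \<pi> ` S1 = {}" using tens(4) \<pi> unfolding bij_betw_def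
        by (metis image_empty inj_on_image_Int)
      show "insert (\<pi> k) (\<pi> ` S0 \<union> \<pi> ` S1) = {..<length \<Gamma>2}" using split2[OF tens(5)] by (simp add: image_Un)
    qed
    then show ?thesis
      unfolding tens(1) transport_link_union transport_transport lift_comp_perm
      using tens k by (intro derives.tens[OF split1 split1 _ _ _ lists_at_perm[OF _ _ \<pi> n] lists_at_perm[OF _ _ \<pi> n]]) (auto simp: n)
  next
    case (withr k S A B \<Gamma>0 e0 \<Gamma>1 e1 \<Lambda>0 \<Lambda>1)
    then have k: "k < length \<Gamma>" by auto
    then show ?thesis
      unfolding withr(1) transport_link_union transport_transport lift_comp_perm
      using withr by (intro derives.withr[OF split1 split2 _ lists_at_perm[OF _ _ \<pi> n] lists_at_perm[OF _ _ \<pi> n]]) (auto simp: n)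
  qed
qed

section \<open>Renaming of links\<close>

lemma rename_simp: "rename f (T, C, R) = (f ` T, map_prod f f ` C, apfst f ` R)"
  by (simp add: rename_def)

lemma rename_transport: "rename f (transport g \<Lambda>) = transport g (rename f \<Lambda>)"
  by (cases \<Lambda>) (simp add: rename_simp transport_simp image_image)

lemma rename_link_union: "rename f (link_union m \<Lambda> M) = link_union m (rename f \<Lambda>) (rename f M)"
  by (cases \<Lambda>; cases M) (auto simp: rename_simp link_union_def image_Un map_prod_surj_on[OF refl refl])

lemma fst_rename [simp]: "fst (rename f \<Lambda>) = f ` fst \<Lambda>"
  by (cases \<Lambda>) (simp add: rename_simp)

lemma fst_link_union [simp]: "fst (link_union m \<Lambda> M) = fst \<Lambda> \<union> fst M"
  by (cases \<Lambda>; cases M) (simp add: link_union_def)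

text \<open>Injectivity on the links present keeps the premises of a binary rule disjoint.\<close>

lemma derives_rename:
  assumes "derives d \<Gamma> \<Lambda>" "inj_on f (fst \<Lambda>)"
  shows "derives d \<Gamma> (rename f \<Lambda>)"
  using assms
proof (induction rule: derives.induct)
  case (ax P l)
  show ?case using derives.ax[of d P "f l"] by (simp add: rename_simp)
next
  case (par k S \<Gamma> A B \<Gamma>' e \<Lambda>)
  then show ?case unfolding rename_transport by (auto intro: derives.par)
next
  case (plus k S \<Gamma> A B b \<Gamma>' e \<Lambda>)
  then show ?case unfolding rename_transport by (auto intro: derives.plus)
next
  case (tens k S0 S1 \<Gamma> A B \<Gamma>0 e0 \<Gamma>1 e1 \<Lambda>0 \<Lambda>1)
  then have i: "inj_on f (fst \<Lambda>0 \<union> fst \<Lambda>1)" by simp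
  then have "inj_on f (fst \<Lambda>0)" "inj_on f (fst \<Lambda>1)" by (auto intro: inj_on_subset)
  moreover have "f ` fst \<Lambda>0 \<inter> f ` fst \<Lambda>1 = {}"
    using tens(10) i by (metis image_empty inj_on_image_Int Un_upper1 Un_upper2)
  ultimately show ?case unfolding rename_transport rename_link_union
    using tens by (intro derives.tens[OF tens(1-7)]) auto
next
  case (withr k S \<Gamma> A B \<Gamma>0 e0 \<Gamma>1 e1 \<Lambda>0 \<Lambda>1)
  then have i: "inj_on f (fst \<Lambda>0 \<union> fst \<Lambda>1)" by simp
  then have "inj_on f (fst \<Lambda>0)" "inj_on f (fst \<Lambda>1)" by (auto intro: inj_on_subset)
  moreover have "f ` fst \<Lambda>0 \<inter> f ` fst \<Lambda>1 = {}"
    using withr(8) i by (metis image_empty inj_on_image_Int Un_upper1 Un_upper2)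
  ultimately show ?case unfolding rename_transport rename_link_union
    using withr by (intro derives.withr[OF withr(1-5)]) auto
qed

section \<open>Derivations and translations\<close>

lemma lists_atI:
  assumes "distinct ps" "set ps = E" "list_all2 (\<lambda>x A. subf (\<Gamma> ! fst x) (snd x) = Some A) ps \<Gamma>'"
  shows "lists_at \<Gamma> E \<Gamma>' ((!) ps)"
  using assms bij_betw_nth[of ps "{..<length \<Gamma>'}" E]
  by (auto simp: lists_at_def list_all2_conv_all_nth)

definition pos_list :: "nat list \<Rightarrow> pos list" where
  "pos_list = map (\<lambda>j. (j, []))"

text \<open>The rules of \<open>transl\<close> want the active formula at the end, or at the front
  for the right premise of a tensor. With \<open>s\<close> an arbitrary ordering of the context,
  this and its two companions present a premise in that shape.\<close>

lemma lists_at_last: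
  assumes "distinct s" "set s = S" "k \<notin> S" "\<Gamma> ! k = Bin c A0 A1"
  shows "lists_at \<Gamma> (part S k {b}) (map ((!) \<Gamma>) s @ [if b then A1 else A0]) ((!) (pos_list s @ [(k, [b])]))"
  using assms by (intro lists_atI)
    (auto simp: pos_list_def part_def distinct_map inj_on_def list_all2_map1 list_all2_map2 list_all2_same
      intro!: list_all2_appendI)

lemma lists_at_first:
  assumes "distinct s" "set s = S" "k \<notin> S" "\<Gamma> ! k = Bin c A0 A1"
  shows "lists_at \<Gamma> (part S k {b}) ((if b then A1 else A0) # map ((!) \<Gamma>) s) ((!) ((k, [b]) # pos_list s))"
  using assms by (intro lists_atI)
    (auto simp: pos_list_def part_def distinct_map inj_on_def list_all2_map1 list_all2_map2 list_all2_same)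

lemma lists_at_both:
  assumes "distinct s" "set s = S" "k \<notin> S" "\<Gamma> ! k = Bin c A0 A1"
  shows "lists_at \<Gamma> (part S k UNIV) (map ((!) \<Gamma>) s @ [A0, A1]) ((!) (pos_list s @ [(k, [False]), (k, [True])]))"
  using assms by (intro lists_atI)
    (auto simp: pos_list_def part_def distinct_map inj_on_def list_all2_map1 list_all2_map2 list_all2_same UNIV_bool
      intro!: list_all2_appendI)

text \<open>The inclusion of the rearranged premise factors into the rule's own leaf inclusion and
  the permutation that sends the canonical conclusion, listed by \<open>s\<close>, \<open>k\<close>,
  \<open>t\<close>, back to its indices in the sequent.\<close>

lemma lift_last:
  assumes "i < Suc (length s)"
  shows "lift ((!) (pos_list s @ [(k, [b])])) (i, p) = lift (\<lambda>i. ((s @ [k] @ t) ! i, [])) (inmap (length s) b (i, p))"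
  using assms by (cases "i = length s") (auto simp: pos_list_def lift_def inmap_def nth_append)

lemma lift_first:
  assumes "i < Suc (length t)"
  shows "lift ((!) ((k, [True]) # pos_list t)) (i, p) = lift (\<lambda>i. ((s @ [k] @ t) ! i, [])) (tmap (length s) (i, p))"
  using assms by (cases i) (auto simp: pos_list_def lift_def tmap_def nth_append)

lemma lift_both:
  assumes "i < Suc (Suc (length s))"
  shows "lift ((!) (pos_list s @ [(k, [False]), (k, [True])])) (i, p) =
    lift (\<lambda>i. ((s @ [k]) ! i, [])) (parmap (length s) (i, p))"
  using assms by (cases "i = length s"; cases "i = Suc (length s)")
    (auto simp: pos_list_def lift_def parmap_def nth_append)

lemma supportedD: "supported n \<Lambda> \<Longrightarrow> (l, x) \<in> snd (snd \<Lambda>) \<Longrightarrow> fst x < n \<and> l \<in> fst \<Lambda>"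
  by (cases \<Lambda>) (auto simp: supported_def)

lemma transport_last:
  assumes "supported (Suc (length s)) \<Lambda>"
  shows "transport (lift ((!) (pos_list s @ [(k, [b])]))) \<Lambda> =
    transport (lift (\<lambda>i. ((s @ [k] @ t) ! i, []))) (transport (inmap (length s) b) \<Lambda>)"
  unfolding transport_transport
proof (rule transport_cong)
  fix l x assume "(l, x) \<in> snd (snd \<Lambda>)"
  then show "lift ((!) (pos_list s @ [(k, [b])])) x = (lift (\<lambda>i. ((s @ [k] @ t) ! i, [])) \<circ> inmap (length s) b) x"
    using supportedD[OF assms] lift_last[of "fst x" s k b "snd x" t] by simp
qed

lemma transport_first:
  assumes "supported (Suc (length t)) \<Lambda>"
  shows "transport (lift ((!) ((k, [True]) # pos_list t))) \<Lambda> =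
    transport (lift (\<lambda>i. ((s @ [k] @ t) ! i, []))) (transport (tmap (length s)) \<Lambda>)"
  unfolding transport_transport
proof (rule transport_cong)
  fix l x assume "(l, x) \<in> snd (snd \<Lambda>)"
  then show "lift ((!) ((k, [True]) # pos_list t)) x = (lift (\<lambda>i. ((s @ [k] @ t) ! i, [])) \<circ> tmap (length s)) x"
    using supportedD[OF assms] lift_first[of "fst x" t k "snd x" s] by simp
qed

lemma transport_both:
  assumes "supported (Suc (Suc (length s))) \<Lambda>"
  shows "transport (lift ((!) (pos_list s @ [(k, [False]), (k, [True])]))) \<Lambda> =
    transport (lift (\<lambda>i. ((s @ [k]) ! i, []))) (transport (parmap (length s)) \<Lambda>)"
  unfolding transport_transport
proof (rule transport_cong)
  fix l x assume "(l, x) \<in> snd (snd \<Lambda>)"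
  then show "lift ((!) (pos_list s @ [(k, [False]), (k, [True])])) x = (lift (\<lambda>i. ((s @ [k]) ! i, [])) \<circ> parmap (length s)) x"
    using supportedD[OF assms] lift_both[of "fst x" s k "snd x"] by simp
qed

lemma supported_transport:
  assumes "supported m \<Lambda>" "\<And>i p. i < m \<Longrightarrow> fst (f (i, p)) < n"
  shows "supported n (transport f \<Lambda>)"
proof -
  obtain T C R where L: "\<Lambda> = (T, C, R)" by (cases \<Lambda>)
  have "apsnd f ` R \<subseteq> T \<times> ({..<n} \<times> UNIV)"
  proof
    fix y assume "y \<in> apsnd f ` R"
    then obtain l i p where y: "(l, i, p) \<in> R" "y = (l, f (i, p))" by auto
    then have "i < m" "l \<in> T" using assms(1) L by (auto simp: supported_def)
    then show "y \<in> T \<times> ({..<n} \<times> UNIV)" using assms(2)[of i p] y(2) by (cases "f (i, p)") auto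
  qed
  then show ?thesis using assms(1) by (simp add: L supported_def transport_simp)
qed

lemma supported_rename: "supported n \<Lambda> \<Longrightarrow> supported n (rename f \<Lambda>)"
  by (cases \<Lambda>) (force simp: supported_def rename_simp)

lemma tag_rename: "tag b \<Lambda> = rename ((#) b) \<Lambda>"
  by (cases \<Lambda>) (force simp: tag_def rename_simp)

lemma join_link_union: "join = link_union"
  by (simp add: fun_eq_iff join_def link_union_def)

lemma transport_upt:
  assumes "supported n \<Lambda>"
  shows "transport (lift (\<lambda>i. ([0..<n] ! i, []))) \<Lambda> = \<Lambda>"
  using supportedD[OF assms] by (intro transport_ident) (auto simp: lift_def)

text \<open>The permutation rule of \<open>transl\<close> reads leaves back along
  \<open>\<sigma>\<close>, whereas \<open>transport\<close> pushes them forward; the inverse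
  \<open>\<pi>\<close> mediates.\<close>

lemma perm_transport:
  assumes "supported n (T, C, R)" "bij_betw \<sigma> {..<n} {..<n}" "bij_betw \<pi> {..<n} {..<n}"
    and "\<And>i. i < n \<Longrightarrow> \<sigma> (\<pi> i) = i"
  shows "(T, C, {(l, (i, p)) | l i p. i < n \<and> (l, (\<sigma> i, p)) \<in> R}) = transport (lift (\<lambda>i. (\<pi> i, []))) (T, C, R)"
proof -
  have inv: "\<pi> (\<sigma> i) = i" if "i < n" for i
  proof -
    have "\<sigma> i < n" using bij_betwE[OF assms(2)] that by simp
    then have "\<pi> (\<sigma> i) < n" "\<sigma> (\<pi> (\<sigma> i)) = \<sigma> i" using bij_betwE[OF assms(3)] assms(4) by auto
    then show ?thesis using assms(2) that by (auto simp: bij_betw_def inj_on_def)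
  qed
  have "{(l, (i, p)) | l i p. i < n \<and> (l, (\<sigma> i, p)) \<in> R} = apsnd (lift (\<lambda>i. (\<pi> i, []))) ` R" (is "?A = ?B")
  proof (intro equalityI subsetI)
    fix x assume "x \<in> ?A"
    then obtain l i p where x: "x = (l, (i, p))" "i < n" "(l, (\<sigma> i, p)) \<in> R" by blast
    then have "x = apsnd (lift (\<lambda>i. (\<pi> i, []))) (l, (\<sigma> i, p))" by (simp add: lift_def inv)
    then show "x \<in> ?B" using x(3) by blast
  next
    fix x assume "x \<in> ?B"
    then obtain l i p where x: "x = (l, (\<pi> i, p))" "(l, (i, p)) \<in> R" by (auto simp: lift_def)
    then have "i < n" using assms(1) by (auto simp: supported_def)
    then have "\<pi> i < n" "\<sigma> (\<pi> i) = i" using bij_betwE[OF assms(3)] assms(4) by auto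
    then show "x \<in> ?A" using x by auto
  qed
  then show ?thesis by (simp add: transport_simp)
qed

text \<open>A logical rule of \<open>transl\<close> is the instance of a rule of
  \<open>derives\<close> with \<open>k\<close> the length of the left context and everything
  arranged identically, so the permutation in the factored inclusion is trivial
  (\<open>transport_upt\<close>). Tags are injective renamings, and they provide the disjointness
  required by the binary rules.\<close>

lemma transl_derives:
  assumes inv: "\<forall>a. d (d a) = a" and "transl d \<Gamma> \<Lambda>"
  shows "derives d \<Gamma> \<Lambda>"
  using assms(2)
proof (induction rule: transl.induct)
  case (ax P)
  show ?case by (rule derives.ax)
next
  case (perm \<Gamma> T C R \<sigma>)
  let ?n = "length \<Gamma>"
  define \<pi> where "\<pi> = inv_into {..<?n} \<sigma>"
  have \<pi>: "bij_betw \<pi> {..<?n} {..<?n}" unfolding \<pi>_def by (rule bij_betw_inv_into[OF perm(2)])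
  have s: "\<sigma> (\<pi> i) = i" if "i < ?n" for i
    using bij_betw_inv_into_right[OF perm(2)] that by (simp add: \<pi>_def)
  have "derives d (map (\<lambda>i. \<Gamma> ! \<sigma> i) [0..<?n]) (transport (lift (\<lambda>i. (\<pi> i, []))) (T, C, R))"
  proof (rule derives_perm[OF inv perm.IH \<pi>])
    fix i assume "i < ?n"
    then show "map (\<lambda>i. \<Gamma> ! \<sigma> i) [0..<?n] ! \<pi> i = \<Gamma> ! i" using s bij_betwE[OF \<pi>] by simp
  qed simp
  then show ?case by (subst perm_transport[OF derives_supported[OF perm.IH] perm(2) \<pi> s])
next
  case (parr \<Gamma> A B \<Lambda>)
  let ?n = "length \<Gamma>" and ?G = "\<Gamma> @ [Bin CPar A B]"
  have g: "map ((!) ?G) [0..<?n] = \<Gamma>" by (rule nth_equalityI) (auto simp: nth_append)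
  have "lists_at ?G (part {..<?n} ?n UNIV) (\<Gamma> @ [A, B]) ((!) (pos_list [0..<?n] @ [(?n, [False]), (?n, [True])]))"
    using lists_at_both[of "[0..<?n]" "{..<?n}" ?n ?G CPar A B] unfolding g by (simp add: atLeast0LessThan)
  then have "derives d ?G (transport (lift ((!) (pos_list [0..<?n] @ [(?n, [False]), (?n, [True])]))) \<Lambda>)"
    using parr.IH by (intro derives.par[of ?n "{..<?n}" ?G A B]) (auto simp: nth_append)
  moreover have sup: "supported (Suc (Suc (length [0..<?n]))) \<Lambda>" using derives_supported[OF parr.IH] by simp
  have s2: "supported (Suc ?n) (transport (parmap ?n) \<Lambda>)"
    by (rule supported_transport[OF sup]) (auto simp: parmap_def)
  have "transport (lift ((!) (pos_list [0..<?n] @ [(?n, [False]), (?n, [True])]))) \<Lambda> = transport (parmap ?n) \<Lambda>"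
    unfolding transport_both[OF sup] using transport_upt[OF s2] by simp
  ultimately show ?case by simp
next
  case (plusr \<Gamma> b B A \<Lambda>)
  let ?n = "length \<Gamma>" and ?G = "\<Gamma> @ [Bin CPlus A B]"
  have g: "map ((!) ?G) [0..<?n] = \<Gamma>" by (rule nth_equalityI) (auto simp: nth_append)
  have "lists_at ?G (part {..<?n} ?n {b}) (\<Gamma> @ [if b then B else A]) ((!) (pos_list [0..<?n] @ [(?n, [b])]))"
    using lists_at_last[of "[0..<?n]" "{..<?n}" ?n ?G CPlus A B b] unfolding g by (simp add: atLeast0LessThan)
  then have "derives d ?G (transport (lift ((!) (pos_list [0..<?n] @ [(?n, [b])]))) \<Lambda>)"
    using plusr.IH by (intro derives.plus[of ?n "{..<?n}" ?G A B]) (auto simp: nth_append)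
  moreover have sup: "supported (Suc (length [0..<?n])) \<Lambda>" using derives_supported[OF plusr.IH] by simp
  have s2: "supported (Suc ?n) (transport (inmap ?n b) \<Lambda>)"
    by (rule supported_transport[OF sup]) (auto simp: inmap_def)
  have "transport (lift ((!) (pos_list [0..<?n] @ [(?n, [b])]))) \<Lambda> = transport (inmap ?n b) \<Lambda>"
    unfolding transport_last[OF sup, of _ _ "[]"] using transport_upt[OF s2] by simp
  ultimately show ?case by simp
next
  case (tensr \<Gamma> A \<Lambda> B \<Delta> M)
  let ?n = "length \<Gamma>" and ?G = "\<Gamma> @ [Bin CTens A B] @ \<Delta>"
  let ?m = "length \<Delta>" and ?t = "[Suc (length \<Gamma>)..<Suc (length \<Gamma> + length \<Delta>)]"
  let ?f0 = "lift ((!) (pos_list [0..<?n] @ [(?n, [False])]))" and ?f1 = "lift ((!) ((?n, [True]) # pos_list ?t))"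
  have g: "map ((!) ?G) [0..<?n] = \<Gamma>" by (rule nth_equalityI) (auto simp: nth_append)
  have h: "map ((!) ?G) ?t = \<Delta>" by (rule nth_equalityI) (auto simp: nth_append simp del: upt_Suc)
  have l0: "lists_at ?G (part {..<?n} ?n {False}) (\<Gamma> @ [A]) ((!) (pos_list [0..<?n] @ [(?n, [False])]))"
    using lists_at_last[of "[0..<?n]" "{..<?n}" ?n ?G CTens A B False] unfolding g by (simp add: atLeast0LessThan)
  have l1: "lists_at ?G (part {Suc ?n..<Suc (?n + ?m)} ?n {True}) (B # \<Delta>) ((!) ((?n, [True]) # pos_list ?t))"
    using lists_at_first[of ?t "{Suc ?n..<Suc (?n + ?m)}" ?n ?G CTens A B True] unfolding h by (simp del: upt_Suc)
  have d: "derives d (\<Gamma> @ [A]) (tag False \<Lambda>)" "derives d (B # \<Delta>) (tag True M)"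
    unfolding tag_rename using tensr.IH by (auto intro: derives_rename)
  have sup: "supported (Suc (length [0..<?n])) (tag False \<Lambda>)" "supported (Suc (length ?t)) (tag True M)"
    using d[THEN derives_supported] by (simp_all del: upt_Suc)
  have l: "[0..<?n] @ [?n] @ ?t = [0..<Suc (?n + ?m)]"
    by (rule nth_equalityI) (auto simp: nth_append nth_Cons split: nat.split simp del: upt_Suc)
  have s2: "supported (Suc (?n + ?m)) (transport (inmap ?n False) (tag False \<Lambda>))"
    by (rule supported_transport[OF sup(1)]) (auto simp: inmap_def)
  have s3: "supported (Suc (?n + ?m)) (transport (tmap ?n) (tag True M))"
    by (rule supported_transport[OF sup(2)]) (auto simp: tmap_def simp del: upt_Suc)
  have t0: "transport ?f0 (tag False \<Lambda>) = transport (inmap ?n False) (tag False \<Lambda>)"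
    unfolding transport_last[OF sup(1), of _ _ ?t] l using transport_upt[OF s2] by (simp del: upt_Suc)
  have t1: "transport ?f1 (tag True M) = transport (tmap ?n) (tag True M)"
    unfolding transport_first[OF sup(2), of _ "[0..<?n]"] l using transport_upt[OF s3] by (simp del: upt_Suc)
  have "derives d ?G (link_union True (transport ?f0 (tag False \<Lambda>)) (transport ?f1 (tag True M)))"
  proof (rule derives.tens[OF _ _ _ _ _ l0 l1 d])
    show "insert ?n ({..<?n} \<union> {Suc ?n..<Suc (?n + ?m)}) = {..<length ?G}" by auto
    show "?G ! ?n = Bin CTens A B" by (simp add: nth_append)
    show "fst (tag False \<Lambda>) \<inter> fst (tag True M) = {}" by (auto simp: tag_rename)
  qed auto
  then show ?case unfolding t0 t1 by (simp add: join_link_union tag_rename rename_transport)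
next
  case (withr \<Gamma> A \<Lambda> B M)
  let ?n = "length \<Gamma>" and ?G = "\<Gamma> @ [Bin CWith A B]"
  let ?f = "\<lambda>b. lift ((!) (pos_list [0..<?n] @ [(?n, [b])]))"
  have g: "map ((!) ?G) [0..<?n] = \<Gamma>" by (rule nth_equalityI) (auto simp: nth_append)
  have l: "lists_at ?G (part {..<?n} ?n {b}) (\<Gamma> @ [if b then B else A]) ((!) (pos_list [0..<?n] @ [(?n, [b])]))" for b
    using lists_at_last[of "[0..<?n]" "{..<?n}" ?n ?G CWith A B b] unfolding g by (simp add: atLeast0LessThan)
  have d: "derives d (\<Gamma> @ [A]) (tag False \<Lambda>)" "derives d (\<Gamma> @ [B]) (tag True M)"
    unfolding tag_rename using withr.IH by (auto intro: derives_rename)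
  have sup: "supported (Suc (length [0..<?n])) (tag False \<Lambda>)" "supported (Suc (length [0..<?n])) (tag True M)"
    using d[THEN derives_supported] by simp_all
  have s2: "supported (Suc ?n) (transport (inmap ?n False) (tag False \<Lambda>))"
    by (rule supported_transport[OF sup(1)]) (auto simp: inmap_def)
  have s3: "supported (Suc ?n) (transport (inmap ?n True) (tag True M))"
    by (rule supported_transport[OF sup(2)]) (auto simp: inmap_def)
  have t0: "transport (?f False) (tag False \<Lambda>) = transport (inmap ?n False) (tag False \<Lambda>)"
    unfolding transport_last[OF sup(1), of _ _ "[]"] using transport_upt[OF s2] by simp
  have t1: "transport (?f True) (tag True M) = transport (inmap ?n True) (tag True M)"
    unfolding transport_last[OF sup(2), of _ _ "[]"] using transport_upt[OF s3] by simp
  have "derives d ?G (link_union False (transport (?f False) (tag False \<Lambda>)) (transport (?f True) (tag True M)))"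
  proof (rule derives.withr[of ?n "{..<?n}"])
    show "insert ?n {..<?n} = {..<length ?G}" by auto
    show "?G ! ?n = Bin CWith A B" by (simp add: nth_append)
    show "fst (tag False \<Lambda>) \<inter> fst (tag True M) = {}" by (auto simp: tag_rename)
  qed (use d l[of False] l[of True] in auto)
  then show ?case unfolding t0 t1 by (simp add: join_link_union tag_rename rename_transport)
qed

text \<open>Links of a translation are boolean lists, those of a derivation are arbitrary.
  Injectivity is asked only on the links present, so that two such maps can be glued at a binary
  rule.\<close>

definition renamed_transl :: "('a \<Rightarrow> 'a) \<Rightarrow> 'a fm list \<Rightarrow> 'l linking \<Rightarrow> bool" where
  "renamed_transl d \<Gamma> \<Lambda> \<longleftrightarrow> (\<exists>M f. transl d \<Gamma> M \<and> inj_on f (fst M) \<and> \<Lambda> = rename f M)"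

lemma renamed_transl_supported:
  assumes "\<forall>a. d (d a) = a" "renamed_transl d \<Gamma> \<Lambda>"
  shows "supported (length \<Gamma>) \<Lambda>"
  using assms(2) derives_supported[OF transl_derives[OF assms(1)]] supported_rename
  unfolding renamed_transl_def by blast

lemma renamed_transl_perm:
  assumes inv: "\<forall>a. d (d a) = a" and q: "renamed_transl d \<Gamma> \<Lambda>"
    and \<pi>: "bij_betw \<pi> {..<length \<Gamma>} {..<length \<Gamma>}"
    and len: "length \<Gamma>2 = length \<Gamma>" and n: "\<And>i. i < length \<Gamma> \<Longrightarrow> \<Gamma>2 ! \<pi> i = \<Gamma> ! i"
  shows "renamed_transl d \<Gamma>2 (transport (lift (\<lambda>i. (\<pi> i, []))) \<Lambda>)"
proof -
  obtain M f where M: "transl d \<Gamma> M" "inj_on f (fst M)" "\<Lambda> = rename f M"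
    using q by (auto simp: renamed_transl_def)
  obtain T C R where TCR: "M = (T, C, R)" by (cases M)
  let ?n = "length \<Gamma>"
  define \<sigma> where "\<sigma> = inv_into {..<?n} \<pi>"
  have \<sigma>: "bij_betw \<sigma> {..<?n} {..<?n}" unfolding \<sigma>_def by (rule bij_betw_inv_into[OF \<pi>])
  have s: "\<sigma> (\<pi> i) = i" if "i < ?n" for i
    using bij_betw_inv_into_left[OF \<pi>] that by (simp add: \<sigma>_def)
  have s': "\<pi> (\<sigma> i) = i" if "i < ?n" for i
    using bij_betw_inv_into_right[OF \<pi>] that by (simp add: \<sigma>_def)
  have G: "map (\<lambda>i. \<Gamma> ! \<sigma> i) [0..<?n] = \<Gamma>2"
  proof (rule nth_equalityI)
    fix i assume "i < length (map (\<lambda>i. \<Gamma> ! \<sigma> i) [0..<?n])"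
    then have i: "i < ?n" by simp
    then have "\<sigma> i < ?n" using bij_betwE[OF \<sigma>] by simp
    then show "map (\<lambda>i. \<Gamma> ! \<sigma> i) [0..<?n] ! i = \<Gamma>2 ! i" using n[of "\<sigma> i"] i s' by simp
  qed (simp add: len)
  have sup: "supported ?n (T, C, R)"
    using derives_supported[OF transl_derives[OF inv M(1)]] TCR by simp
  have "transl d \<Gamma>2 (transport (lift (\<lambda>i. (\<pi> i, []))) M)"
    unfolding TCR using transl.perm[OF M(1)[unfolded TCR] \<sigma>] unfolding G
    by (subst perm_transport[OF sup \<sigma> \<pi> s, symmetric])
  moreover have "transport (lift (\<lambda>i. (\<pi> i, []))) \<Lambda> = rename f (transport (lift (\<lambda>i. (\<pi> i, []))) M)"
    by (simp add: M(3) rename_transport)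
  ultimately show ?thesis using M(2) unfolding renamed_transl_def by (metis fst_transport)
qed

lemma renamed_transl_relist:
  assumes inv: "\<forall>a. d (d a) = a" and q: "renamed_transl d \<Gamma>1 \<Lambda>"
    and l: "lists_at \<Gamma> E \<Gamma>1 e1" "lists_at \<Gamma> E \<Gamma>2 e2"
  obtains M where "renamed_transl d \<Gamma>2 M" "transport (lift e1) \<Lambda> = transport (lift e2) M" "fst M = fst \<Lambda>"
proof (rule relist[OF l renamed_transl_supported[OF inv q]])
  fix \<rho> assume "length \<Gamma>2 = length \<Gamma>1" "bij_betw \<rho> {..<length \<Gamma>1} {..<length \<Gamma>1}"
    "\<And>i. i < length \<Gamma>1 \<Longrightarrow> \<Gamma>2 ! \<rho> i = \<Gamma>1 ! i"
  then show "renamed_transl d \<Gamma>2 (transport (lift (\<lambda>i. (\<rho> i, []))) \<Lambda>)"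
    by (intro renamed_transl_perm[OF inv q])
qed (rule that)

text \<open>A translation rule delivers its conclusion in a canonical order \<open>js\<close>; one
  permutation restores the order of \<open>\<Gamma>\<close>.\<close>

lemma renamed_transl_arrange:
  assumes inv: "\<forall>a. d (d a) = a" and q: "renamed_transl d (map ((!) \<Gamma>) js) \<Lambda>"
    and js: "distinct js" "set js = {..<length \<Gamma>}"
  shows "renamed_transl d \<Gamma> (transport (lift (\<lambda>i. (js ! i, []))) \<Lambda>)"
proof -
  have len: "length js = length \<Gamma>" using distinct_card[OF js(1)] js(2) by simp
  have "bij_betw ((!) js) {..<length \<Gamma>} {..<length \<Gamma>}" using bij_betw_nth[OF js(1)] js(2) len by simp
  then show ?thesis by (intro renamed_transl_perm[OF inv q]) (simp_all add: len)
qed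

lemma rename_rename: "rename f (rename g \<Lambda>) = rename (f \<circ> g) \<Lambda>"
  by (cases \<Lambda>) (auto simp: rename_simp image_image map_prod_def split_beta apfst_def)

lemma renamed_transl_join:
  assumes t: "transl d \<Gamma> (join m (tag False (transport g0 M0)) (tag True (transport g1 M1)))"
    and i: "inj_on f0 (fst M0)" "inj_on f1 (fst M1)" "f0 ` fst M0 \<inter> f1 ` fst M1 = {}"
  shows "renamed_transl d \<Gamma> (link_union m (transport g0 (rename f0 M0)) (transport g1 (rename f1 M1)))"
proof -
  \<comment> \<open>The leading tag tells which premise a link comes from, hence which renaming
    applies.\<close>
  define f where "f l = (if hd l then f1 (tl l) else f0 (tl l))" for l
  have fb: "f \<circ> (#) b = (if b then f1 else f0)" for b by (auto simp: f_def)
  have rr: "rename f (rename ((#) b) L) = rename (if b then f1 else f0) L" for b L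
    by (simp add: rename_rename fb)
  have "inj_on f ((#) False ` fst M0 \<union> (#) True ` fst M1)"
    unfolding inj_on_Un
  proof (intro conjI)
    show "inj_on f ((#) False ` fst M0)" "inj_on f ((#) True ` fst M1)"
      using i(1,2) by (auto intro!: inj_on_imageI simp: fb)
    have "f ` (#) False ` fst M0 \<inter> f ` (#) True ` fst M1 = {}"
      using i(3) unfolding image_comp fb by simp
    then show "f ` ((#) False ` fst M0 - (#) True ` fst M1) \<inter> f ` ((#) True ` fst M1 - (#) False ` fst M0) = {}"
      by blast
  qed
  then have "inj_on f (fst (join m (tag False (transport g0 M0)) (tag True (transport g1 M1))))"
    by (simp add: join_link_union tag_rename)
  moreover have "link_union m (transport g0 (rename f0 M0)) (transport g1 (rename f1 M1)) =
    rename f (join m (tag False (transport g0 M0)) (tag True (transport g1 M1)))"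
    by (simp add: join_link_union tag_rename rename_link_union rr rename_transport)
  ultimately show ?thesis using t unfolding renamed_transl_def by blast
qed

text \<open>A premise enumerated in any order has the canonical shape up to permutation; the
  translation rule applies there, and rearranging its conclusion recovers \<open>\<Gamma>\<close>.
  The list \<open>s\<close> is any enumeration of the finite context.\<close>

lemma derives_transl:
  assumes inv: "\<forall>a. d (d a) = a" and "derives d \<Gamma> \<Lambda>"
  shows "renamed_transl d \<Gamma> \<Lambda>"
  using assms(2)
proof (induction rule: derives.induct)
  case (ax P l)
  show ?case unfolding renamed_transl_def
    by (intro exI conjI, rule transl.ax) (auto simp: rename_simp intro: exI[of _ "\<lambda>_. l"])
next
  case (par k S \<Gamma> A B \<Gamma>' e \<Lambda>)
  have "finite S" using par(2) by (metis finite_insert finite_lessThan)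
  then obtain s where s: "distinct s" "set s = S" using finite_distinct_list by blast
  let ?G = "map ((!) \<Gamma>) s @ [A, B]" and ?e = "(!) (pos_list s @ [(k, [False]), (k, [True])])"
  obtain M where M: "renamed_transl d ?G M" "transport (lift e) \<Lambda> = transport (lift ?e) M"
    using renamed_transl_relist[OF inv par.IH par(4) lists_at_both[OF s par(1,3)]] by blast
  obtain N f where N: "transl d ?G N" "inj_on f (fst N)" "M = rename f N" using M(1) by (auto simp: renamed_transl_def)
  have "transl d (map ((!) \<Gamma>) s @ [Bin CPar A B]) (transport (parmap (length s)) N)"
    using transl.parr[OF N(1)] by simp
  then have "renamed_transl d (map ((!) \<Gamma>) (s @ [k])) (transport (parmap (length s)) M)"
    unfolding renamed_transl_def using N(2,3) par(3)
    by (intro exI[of _ "transport (parmap (length s)) N"] exI[of _ f]) (simp add: rename_transport)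
  then have "renamed_transl d \<Gamma> (transport (lift (\<lambda>i. ((s @ [k]) ! i, []))) (transport (parmap (length s)) M))"
    by (rule renamed_transl_arrange[OF inv]) (use s par(1,2) in auto)
  moreover have "supported (Suc (Suc (length s))) M" using renamed_transl_supported[OF inv M(1)] by simp
  ultimately show ?case using M(2) by (simp add: transport_both)
next
  case (plus k S \<Gamma> A B b \<Gamma>' e \<Lambda>)
  have "finite S" using plus(2) by (metis finite_insert finite_lessThan)
  then obtain s where s: "distinct s" "set s = S" using finite_distinct_list by blast
  let ?G = "map ((!) \<Gamma>) s @ [if b then B else A]" and ?e = "(!) (pos_list s @ [(k, [b])])"
  obtain M where M: "renamed_transl d ?G M" "transport (lift e) \<Lambda> = transport (lift ?e) M"
    using renamed_transl_relist[OF inv plus.IH plus(4) lists_at_last[OF s plus(1,3)]] by blast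
  obtain N f where N: "transl d ?G N" "inj_on f (fst N)" "M = rename f N" using M(1) by (auto simp: renamed_transl_def)
  have "transl d (map ((!) \<Gamma>) s @ [Bin CPlus A B]) (transport (inmap (length s) b) N)"
    using transl.plusr[OF N(1)] by simp
  then have "renamed_transl d (map ((!) \<Gamma>) (s @ [k])) (transport (inmap (length s) b) M)"
    unfolding renamed_transl_def using N(2,3) plus(3)
    by (intro exI[of _ "transport (inmap (length s) b) N"] exI[of _ f]) (simp add: rename_transport)
  then have "renamed_transl d \<Gamma> (transport (lift (\<lambda>i. ((s @ [k]) ! i, []))) (transport (inmap (length s) b) M))"
    by (rule renamed_transl_arrange[OF inv]) (use s plus(1,2) in auto)
  moreover have "supported (Suc (length s)) M" using renamed_transl_supported[OF inv M(1)] by simp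
  ultimately show ?case using M(2) transport_last[of s M k b "[]"] by simp
next
  case (tens k S0 S1 \<Gamma> A B \<Gamma>0 e0 \<Gamma>1 e1 \<Lambda>0 \<Lambda>1)
  have "finite (insert k (S0 \<union> S1))" unfolding tens(4) by simp
  then obtain s t where s: "distinct s" "set s = S0" and t: "distinct t" "set t = S1"
    using finite_distinct_list by (metis finite_Un finite_insert)
  let ?G0 = "map ((!) \<Gamma>) s @ [A]" and ?e0 = "(!) (pos_list s @ [(k, [False])])"
  let ?G1 = "B # map ((!) \<Gamma>) t" and ?e1 = "(!) ((k, [True]) # pos_list t)"
  obtain M0 where M0: "renamed_transl d ?G0 M0" "transport (lift e0) \<Lambda>0 = transport (lift ?e0) M0" "fst M0 = fst \<Lambda>0"
    using renamed_transl_relist[OF inv tens.IH(1) tens(6) lists_at_last[OF s tens(1,5), of False, simplified]] by blast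
  obtain N0 f0 where N0: "transl d ?G0 N0" "inj_on f0 (fst N0)" "M0 = rename f0 N0"
    using M0(1) by (auto simp: renamed_transl_def)
  obtain M1 where M1: "renamed_transl d ?G1 M1" "transport (lift e1) \<Lambda>1 = transport (lift ?e1) M1" "fst M1 = fst \<Lambda>1"
    using renamed_transl_relist[OF inv tens.IH(2) tens(7) lists_at_first[OF t tens(2,5), of True, simplified]] by blast
  obtain N1 f1 where N1: "transl d ?G1 N1" "inj_on f1 (fst N1)" "M1 = rename f1 N1"
    using M1(1) by (auto simp: renamed_transl_def)
  \<comment> \<open>Relisting leaves the sets of links unchanged, so the disjointness of the
    premises carries over to the renamings to be glued.\<close>
  have "f0 ` fst N0 \<inter> f1 ` fst N1 = {}" using M0(3) M1(3) N0(3) N1(3) tens(10) by simp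
  then have "renamed_transl d (map ((!) \<Gamma>) s @ [Bin CTens A B] @ map ((!) \<Gamma>) t)
    (link_union True (transport (inmap (length s) False) M0) (transport (tmap (length s)) M1))"
    using renamed_transl_join[OF transl.tensr[OF N0(1) N1(1)] N0(2) N1(2)] N0(3) N1(3) by simp
  then have "renamed_transl d (map ((!) \<Gamma>) (s @ [k] @ t))
    (link_union True (transport (inmap (length s) False) M0) (transport (tmap (length s)) M1))"
    using tens(5) by simp
  then have "renamed_transl d \<Gamma> (transport (lift (\<lambda>i. ((s @ [k] @ t) ! i, [])))
    (link_union True (transport (inmap (length s) False) M0) (transport (tmap (length s)) M1)))"
    by (rule renamed_transl_arrange[OF inv]) (use s t tens(1-4) in auto)
  moreover have "supported (Suc (length s)) M0" "supported (Suc (length t)) M1"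
    using renamed_transl_supported[OF inv M0(1)] renamed_transl_supported[OF inv M1(1)] by simp_all
  ultimately show ?case
    unfolding M0(2) M1(2) transport_link_union
    using transport_last[of s M0 k False t] transport_first[of t M1 k s] by simp
next
  case (withr k S \<Gamma> A B \<Gamma>0 e0 \<Gamma>1 e1 \<Lambda>0 \<Lambda>1)
  have "finite S" using withr(2) by (metis finite_insert finite_lessThan)
  then obtain s where s: "distinct s" "set s = S" using finite_distinct_list by blast
  let ?G0 = "map ((!) \<Gamma>) s @ [A]" and ?e0 = "(!) (pos_list s @ [(k, [False])])"
  let ?G1 = "map ((!) \<Gamma>) s @ [B]" and ?e1 = "(!) (pos_list s @ [(k, [True])])"
  obtain M0 where M0: "renamed_transl d ?G0 M0" "transport (lift e0) \<Lambda>0 = transport (lift ?e0) M0" "fst M0 = fst \<Lambda>0"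
    using renamed_transl_relist[OF inv withr.IH(1) withr(4) lists_at_last[OF s withr(1,3), of False, simplified]] by blast
  obtain N0 f0 where N0: "transl d ?G0 N0" "inj_on f0 (fst N0)" "M0 = rename f0 N0"
    using M0(1) by (auto simp: renamed_transl_def)
  obtain M1 where M1: "renamed_transl d ?G1 M1" "transport (lift e1) \<Lambda>1 = transport (lift ?e1) M1" "fst M1 = fst \<Lambda>1"
    using renamed_transl_relist[OF inv withr.IH(2) withr(5) lists_at_last[OF s withr(1,3), of True, simplified]] by blast
  obtain N1 f1 where N1: "transl d ?G1 N1" "inj_on f1 (fst N1)" "M1 = rename f1 N1"
    using M1(1) by (auto simp: renamed_transl_def)
  have "f0 ` fst N0 \<inter> f1 ` fst N1 = {}" using M0(3) M1(3) N0(3) N1(3) withr(8) by simp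
  then have "renamed_transl d (map ((!) \<Gamma>) s @ [Bin CWith A B])
    (link_union False (transport (inmap (length s) False) M0) (transport (inmap (length s) True) M1))"
    using renamed_transl_join[OF transl.withr[OF N0(1) N1(1)] N0(2) N1(2)] N0(3) N1(3) by simp
  then have "renamed_transl d (map ((!) \<Gamma>) (s @ [k]))
    (link_union False (transport (inmap (length s) False) M0) (transport (inmap (length s) True) M1))"
    using withr(3) by simp
  then have "renamed_transl d \<Gamma> (transport (lift (\<lambda>i. ((s @ [k]) ! i, [])))
    (link_union False (transport (inmap (length s) False) M0) (transport (inmap (length s) True) M1)))"
    by (rule renamed_transl_arrange[OF inv]) (use s withr(1,2) in auto)
  moreover have "supported (Suc (length s)) M0" "supported (Suc (length s)) M1"
    using renamed_transl_supported[OF inv M0(1)] renamed_transl_supported[OF inv M1(1)] by simp_all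
  ultimately show ?case
    unfolding M0(2) M1(2) transport_link_union
    using transport_last[of s M0 k False "[]"] transport_last[of s M1 k True "[]"] by simp
qed

text \<open>An isomorphism of linkings amounts to a renaming that is injective on links. Because
  coherence and the relation to leaves mention only actual links, the images under the inverse
  bijection are equal to the given relations and do not merely agree with them on links.\<close>

lemma derives_iff_sequentializable:
  assumes inv: "\<forall>a. d (d a) = a" and l: "linking d \<Gamma> \<Lambda>"
  shows "derives d \<Gamma> \<Lambda> \<longleftrightarrow> sequentializable d \<Gamma> \<Lambda>"
proof
  assume "derives d \<Gamma> \<Lambda>"
  then obtain M f where M: "transl d \<Gamma> M" "inj_on f (fst M)" "\<Lambda> = rename f M"
    using derives_transl[OF inv] unfolding renamed_transl_def by blast
  obtain T C R where TCR: "M = (T, C, R)" by (cases M)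
  have sup: "C \<subseteq> T \<times> T" "R \<subseteq> T \<times> UNIV"
    using derives_supported[OF transl_derives[OF inv M(1)]] TCR by (auto simp: supported_def)
  have inj: "inj_on f T" using M(2) TCR by simp
  let ?g = "inv_into T f"
  have g: "?g (f x) = x" if "x \<in> T" for x using inj that by simp
  have "bij_betw ?g (f ` T) T" using inj by (simp add: bij_betw_inv_into inj_on_imp_bij_betw)
  moreover have "(f x, f y) \<in> map_prod f f ` C \<longleftrightarrow> (x, y) \<in> C" if "x \<in> T" "y \<in> T" for x y
  proof
    assume "(f x, f y) \<in> map_prod f f ` C"
    then obtain x' y' where "(x', y') \<in> C" "f x = f x'" "f y = f y'" by auto
    moreover have "x' \<in> T" "y' \<in> T" using calculation sup(1) by auto
    ultimately show "(x, y) \<in> C" using inj_onD[OF inj] that by metis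
  qed force
  moreover have "(f x, v) \<in> apfst f ` R \<longleftrightarrow> (x, v) \<in> R" if "x \<in> T" for x v
  proof
    assume "(f x, v) \<in> apfst f ` R"
    then obtain x' where "(x', v) \<in> R" "f x = f x'" by auto
    moreover have "x' \<in> T" using calculation sup(2) by auto
    ultimately show "(x, v) \<in> R" using inj_onD[OF inj] that by metis
  qed force
  ultimately have "iso_linking \<Lambda> M"
    unfolding iso_linking_def M(3) TCR rename_simp split
    by (intro exI[of _ ?g]) (simp add: g)
  then show "sequentializable d \<Gamma> \<Lambda>" using M(1) unfolding sequentializable_def by blast
next
  assume "sequentializable d \<Gamma> \<Lambda>"
  then obtain M where M: "transl d \<Gamma> M" "iso_linking \<Lambda> M" unfolding sequentializable_def by blast
  obtain T C R where TCR: "\<Lambda> = (T, C, R)" by (cases \<Lambda>)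
  obtain T' C' R' where TCR': "M = (T', C', R')" by (cases M)
  obtain f where f: "bij_betw f T T'" "\<And>x y. x \<in> T \<Longrightarrow> y \<in> T \<Longrightarrow> (x, y) \<in> C \<longleftrightarrow> (f x, f y) \<in> C'"
    "\<And>x v. x \<in> T \<Longrightarrow> (x, v) \<in> R \<longleftrightarrow> (f x, v) \<in> R'"
    using M(2) TCR TCR' by (auto simp: iso_linking_def)
  let ?g = "inv_into T f"
  have g: "bij_betw ?g T' T" by (rule bij_betw_inv_into[OF f(1)])
  have gf: "?g (f x) = x" if "x \<in> T" for x using bij_betw_inv_into_left[OF f(1)] that by simp
  have fg: "f (?g y) = y" if "y \<in> T'" for y using bij_betw_inv_into_right[OF f(1)] that by simp
  have gT: "?g y \<in> T" if "y \<in> T'" for y using bij_betwE[OF g] that by simp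
  have sup: "C \<subseteq> T \<times> T" "R \<subseteq> T \<times> UNIV" using l TCR by (auto simp: linking_def coh_space_def)
  have sup': "C' \<subseteq> T' \<times> T'" "R' \<subseteq> T' \<times> UNIV"
    using derives_supported[OF transl_derives[OF inv M(1)]] TCR' by (auto simp: supported_def)
  have "map_prod ?g ?g ` C' = C"
  proof (intro equalityI subsetI)
    fix z assume "z \<in> map_prod ?g ?g ` C'"
    then obtain x y where "(x, y) \<in> C'" "z = (?g x, ?g y)" by auto
    moreover have "x \<in> T'" "y \<in> T'" using calculation sup' by auto
    ultimately show "z \<in> C" using f(2)[of "?g x" "?g y"] fg gT by simp
  next
    fix z assume z: "z \<in> C"
    then obtain x y where xy: "z = (x, y)" "x \<in> T" "y \<in> T" using sup by auto
    then have "(f x, f y) \<in> C'" using f(2) z by simp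
    moreover have "z = map_prod ?g ?g (f x, f y)" using xy gf by simp
    ultimately show "z \<in> map_prod ?g ?g ` C'" by blast
  qed
  moreover have "apfst ?g ` R' = R"
  proof (intro equalityI subsetI)
    fix z assume "z \<in> apfst ?g ` R'"
    then obtain x v where "(x, v) \<in> R'" "z = (?g x, v)" by auto
    moreover have "x \<in> T'" using calculation sup' by auto
    ultimately show "z \<in> R" using f(3)[of "?g x" v] fg gT by simp
  next
    fix z assume z: "z \<in> R"
    then obtain x v where xy: "z = (x, v)" "x \<in> T" using sup by auto
    then have "(f x, v) \<in> R'" using f(3) z by simp
    moreover have "z = apfst ?g (f x, v)" using xy gf by simp
    ultimately show "z \<in> apfst ?g ` R'" by blast
  qed
  moreover have "?g ` T' = T" using g by (simp add: bij_betw_def)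
  ultimately have "\<Lambda> = rename ?g M" by (simp add: TCR TCR' rename_simp)
  then show "derives d \<Gamma> \<Lambda>"
    using derives_rename[OF transl_derives[OF inv M(1)], of ?g] g TCR' by (simp add: bij_betw_def)
qed

section \<open>Erasing a root inverts a rule\<close>

text \<open>All extensions of entries of \<open>part S k B\<close>, that is, the possible values of
  \<open>lift e\<close>, whether or not they are vertices of the sequent. For \<open>k\<close>
  outside \<open>S\<close> the principal root \<open>(k, [])\<close> is left out.\<close>

definition below :: "nat set \<Rightarrow> nat \<Rightarrow> bool set \<Rightarrow> pos set" where
  "below S k B = {(j, p). j \<in> S \<or> j = k \<and> p \<noteq> [] \<and> hd p \<in> B}"

text \<open>\<open>g\<close> is the relabelling performed by an erasure. The first inverse law turns
  a rule followed by its erasure into the premise, the second turns an erasure followed by the rule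
  into the original linking.\<close>

definition unlifts :: "'a fm list \<Rightarrow> nat set \<Rightarrow> nat \<Rightarrow> bool set \<Rightarrow> 'a fm list \<Rightarrow> (nat \<Rightarrow> pos) \<Rightarrow> (pos \<Rightarrow> pos) \<Rightarrow> bool" where
  "unlifts \<Gamma> S k B \<Gamma>' e g \<longleftrightarrow> lists_at \<Gamma> (part S k B) \<Gamma>' e \<and>
     (\<forall>i p. i < length \<Gamma>' \<longrightarrow> g (lift e (i, p)) = (i, p)) \<and> (\<forall>x\<in>below S k B. lift e (g x) = x)"

lemma derives_relist:
  assumes inv: "\<forall>a. d (d a) = a" and q: "derives d \<Gamma>1 \<Lambda>"
    and l: "lists_at \<Gamma> E \<Gamma>1 e1" "lists_at \<Gamma> E \<Gamma>2 e2"
  obtains M where "derives d \<Gamma>2 M" "transport (lift e1) \<Lambda> = transport (lift e2) M" "fst M = fst \<Lambda>"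
proof (rule relist[OF l derives_supported[OF q]])
  fix \<rho> assume "length \<Gamma>2 = length \<Gamma>1" "bij_betw \<rho> {..<length \<Gamma>1} {..<length \<Gamma>1}"
    "\<And>i. i < length \<Gamma>1 \<Longrightarrow> \<Gamma>2 ! \<rho> i = \<Gamma>1 ! i"
  then show "derives d \<Gamma>2 (transport (lift (\<lambda>i. (\<rho> i, []))) \<Lambda>)"
    by (intro derives_perm[OF inv q])
qed (rule that)

text \<open>The erased sequent comes in the order fixed by the erasure, which need not be that of
  the derivation at hand; both enumerate the same positions.\<close>

lemma unlifts_derives:
  assumes inv: "\<forall>a. d (d a) = a" and u: "unlifts \<Gamma> S k B \<Gamma>' e g"
    and q: "derives d \<Gamma>1 \<Lambda>" and l: "lists_at \<Gamma> (part S k B) \<Gamma>1 e1"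
  shows "derives d \<Gamma>' (transport g (transport (lift e1) \<Lambda>))"
proof -
  have l': "lists_at \<Gamma> (part S k B) \<Gamma>' e" using u by (simp add: unlifts_def)
  obtain M where M: "derives d \<Gamma>' M" "transport (lift e1) \<Lambda> = transport (lift e) M"
    using derives_relist[OF inv q l l'] by blast
  have "transport g (transport (lift e) M) = M"
    unfolding transport_transport
    using supportedD[OF derives_supported[OF M(1)]] u by (intro transport_ident) (auto simp: unlifts_def)
  then show ?thesis using M by simp
qed

lemma unlifts_transport:
  assumes u: "unlifts \<Gamma> S k B \<Gamma>' e g" and R: "snd ` snd (snd \<Lambda>) \<subseteq> below S k B"
  shows "transport (lift e) (transport g \<Lambda>) = \<Lambda>"
  unfolding transport_transport
proof (rule transport_ident)
  fix l x assume "(l, x) \<in> snd (snd \<Lambda>)"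
  then have "x \<in> below S k B" using R by force
  then show "(lift e \<circ> g) x = x" using u by (auto simp: unlifts_def)
qed

section \<open>The number of connectives of a sequent\<close>

fun connectives :: "'a fm \<Rightarrow> nat" where
  "connectives (Lit a) = 0"
| "connectives (Bin c A B) = Suc (connectives A + connectives B)"

definition weight :: "'a fm list \<Rightarrow> nat" where
  "weight \<Gamma> = (\<Sum>i<length \<Gamma>. connectives (\<Gamma> ! i))"

text \<open>The positions of a premise are among its context and the two immediate subformulas,
  which together have one connective less than the principal formula. Enlarging to both subformulas
  gives a single estimate for all rules, and a smaller context only helps.\<close>

lemma lists_at_weight:
  assumes l: "lists_at \<Gamma> (part S k B) \<Gamma>' e" and S: "k \<notin> S" "insert k S \<subseteq> {..<length \<Gamma>}"
    and f: "\<Gamma> ! k = Bin c A0 A1"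
  shows "weight \<Gamma>' < weight \<Gamma>"
proof -
  \<comment> \<open>The default 0 is never taken on the positions summed over.\<close>
  let ?h = "\<lambda>(j, p). case subf (\<Gamma> ! j) p of None \<Rightarrow> 0 | Some A \<Rightarrow> connectives A"
  have fin: "finite S" using S(2) finite_subset by auto
  have "weight \<Gamma>' = (\<Sum>i<length \<Gamma>'. ?h (e i))"
    using l by (auto simp: weight_def lists_at_def split_beta intro!: sum.cong)
  also have "\<dots> = sum ?h (part S k B)"
    using l by (intro sum.reindex_bij_betw) (simp add: lists_at_def)
  also have "\<dots> \<le> sum ?h ((\<lambda>j. (j, [])) ` S \<union> (\<lambda>b. (k, [b])) ` UNIV)"
    using fin by (intro sum_mono2) (auto simp: part_def)
  also have "\<dots> = sum ?h ((\<lambda>j. (j, [])) ` S) + sum ?h ((\<lambda>b. (k, [b])) ` UNIV)"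
    using fin by (intro sum.union_disjoint) auto
  also have "sum ?h ((\<lambda>j. (j, [])) ` S) = (\<Sum>j\<in>S. connectives (\<Gamma> ! j))"
    by (subst sum.reindex) (auto simp: inj_on_def)
  also have "sum ?h ((\<lambda>b. (k, [b])) ` UNIV) = connectives A0 + connectives A1"
    using f by (subst sum.reindex) (auto simp: inj_on_def UNIV_bool)
  also have "(\<Sum>j\<in>S. connectives (\<Gamma> ! j)) + (connectives A0 + connectives A1) < (\<Sum>j\<in>insert k S. connectives (\<Gamma> ! j))"
    using f fin S(1) by simp
  also have "\<dots> \<le> weight \<Gamma>"
    unfolding weight_def using S(2) by (intro sum_mono2) auto
  finally show ?thesis .
qed

section \<open>Relabellings of erasures as inverses of leaf inclusions\<close>

lemma lift_par: 
  \<comment> \<open>Erasing a par puts its right half at index \<open>Suc k\<close>, so every later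
    formula moves up by one; \<open>i - 1\<close> takes this back.\<close>
  assumes "e = (\<lambda>i. if i < k then (i, []) else if i = k then (k, [False]) else if i = Suc k then (k, [True]) else (i - 1, []))"
    "g = (\<lambda>(j, p). if j < k then (j, p) else if j = k then (if hd p then Suc k else k, tl p) else (Suc j, p))"
  shows "g (lift e x) = x" "x \<in> below S k UNIV \<Longrightarrow> k \<notin> S \<Longrightarrow> lift e (g x) = x"
proof -
  obtain i p where x: "x = (i, p)" by (cases x)
  consider "i < k" | "i = k" | "i = Suc k" | "i > Suc k" by linarith
  then show "g (lift e x) = x" unfolding x assms lift_def by cases auto
  assume "x \<in> below S k UNIV" "k \<notin> S"
  then consider "i < k" | "i = k" "p \<noteq> []" | "i > k" unfolding x below_def by fastforce
  then show "lift e (g x) = x" unfolding x assms lift_def by cases (auto, (metis list.collapse)+)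
qed

lemma unlifts_par:
  assumes k: "k \<notin> S" and S: "insert k S = {..<length \<Gamma>}" and f: "\<Gamma> ! k = Bin c A0 A1"
  shows "\<exists>e. unlifts \<Gamma> S k UNIV (take k \<Gamma> @ [A0, A1] @ drop (Suc k) \<Gamma>) e
    (\<lambda>(j, p). if j < k then (j, p) else if j = k then (if hd p then Suc k else k, tl p) else (Suc j, p))"
    (is "\<exists>e. unlifts _ _ _ _ ?G e ?g")
proof -
  let ?e = "\<lambda>i. if i < k then (i, []) else if i = k then (k, [False]) else if i = Suc k then (k, [True]) else (i - 1, [])"
  have kn: "k < length \<Gamma>" using S by auto
  have len: "length ?G = Suc (length \<Gamma>)" using kn by simp
  have "bij_betw ?e {..<length ?G} (part S k UNIV)"
    unfolding bij_betw_def
  proof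
    show "inj_on ?e {..<length ?G}" by (auto simp: inj_on_def split: if_splits)
    show "?e ` {..<length ?G} = part S k UNIV"
    proof (intro equalityI subsetI)
      fix y assume "y \<in> ?e ` {..<length ?G}"
      then obtain i where i: "i < Suc (length \<Gamma>)" "y = ?e i" unfolding len by blast
      moreover have "j \<in> S" if "j < length \<Gamma>" "j \<noteq> k" for j using S that by auto
      ultimately show "y \<in> part S k UNIV" using kn by (auto simp: part_def split: if_splits)
    next
      fix y assume "y \<in> part S k UNIV"
      then consider j where "y = (j, [])" "j \<in> S" | b where "y = (k, [b])" by (auto simp: part_def)
      then show "y \<in> ?e ` {..<length ?G}"
      proof cases
        case 1
        then have "j < length \<Gamma>" "j \<noteq> k" using S k by auto
        then have "y = ?e (if j < k then j else Suc j)" "(if j < k then j else Suc j) < length ?G" 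
          using 1 len by auto
        then show ?thesis by blast
      next
        case 2
        then have "y = ?e (if b then Suc k else k)" "(if b then Suc k else k) < length ?G"
          using kn len by auto
        then show ?thesis by blast
      qed
    qed
  qed
  moreover have "subf (\<Gamma> ! fst (?e i)) (snd (?e i)) = Some (?G ! i)" if "i < length ?G" for i
  proof -
    consider "i < k" | "i = k" | "i = Suc k" | m where "i = Suc (Suc (k + m))"
      by (metis less_Suc_eq less_iff_Suc_add linorder_less_linear)
    then show ?thesis using that kn f by cases (auto simp: nth_append)
  qed
  ultimately have "lists_at \<Gamma> (part S k UNIV) ?G ?e" by (simp add: lists_at_def)
  then have "unlifts \<Gamma> S k UNIV ?G ?e ?g"
    unfolding unlifts_def using lift_par[OF refl refl] k by blast
  then show ?thesis by blast
qed

lemma unlifts_choose: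
  assumes k: "k \<notin> S" and S: "insert k S = {..<length \<Gamma>}" and f: "\<Gamma> ! k = Bin c A0 A1"
  shows "\<exists>e. unlifts \<Gamma> S k {b} (\<Gamma>[k := sub b (\<Gamma> ! k)]) e
    (\<lambda>(j, p). if j = k then (k, tl p) else (j, p))" (is "\<exists>e. unlifts _ _ _ _ ?G e ?g")
proof -
  let ?e = "\<lambda>i. if i = k then (k, [b]) else (i, [])"
  have kn: "k < length \<Gamma>" using S by auto
  have "bij_betw ?e {..<length ?G} (part S k {b})"
    unfolding bij_betw_def
  proof
    show "inj_on ?e {..<length ?G}" by (auto simp: inj_on_def split: if_splits)
    have "?e ` insert k S = part S k {b}" using k by (force simp: part_def)
    then show "?e ` {..<length ?G} = part S k {b}" using S by simp
  qed
  moreover have "subf (\<Gamma> ! fst (?e i)) (snd (?e i)) = Some (?G ! i)" if "i < length ?G" for i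
    using that f by (auto simp: nth_list_update)
  ultimately have "lists_at \<Gamma> (part S k {b}) ?G ?e" by (simp add: lists_at_def)
  moreover have "?g (lift ?e x) = x" for x by (cases x) (auto simp: lift_def)
  moreover have "lift ?e (?g x) = x" if "x \<in> below S k {b}" for x
    using that k by (cases x; cases "snd x") (auto simp: lift_def below_def)
  ultimately have "unlifts \<Gamma> S k {b} ?G ?e ?g" unfolding unlifts_def by blast
  then show ?thesis by blast
qed

lemma sorted_list_facts:
  fixes S :: "nat set"
  assumes "finite S"
  shows "set (sorted_list_of_set S) = S" "distinct (sorted_list_of_set S)"
    "length (sorted_list_of_set S) = card S" "sorted_wrt (<) (sorted_list_of_set S)"
  using assms by auto

text \<open>\<open>tens_part\<close> numbers a kept formula by how many kept indices are smaller;
  this is its place in the sorted list from which the new sequent is formed.\<close>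

lemma rank_nth:
  fixes S :: "nat set"
  assumes "finite S" "i < card S"
  shows "card {s \<in> S. s < sorted_list_of_set S ! i} = i"
proof -
  let ?l = "sorted_list_of_set S"
  have l: "set ?l = S" "distinct ?l" "length ?l = card S" "sorted_wrt (<) ?l" using sorted_list_facts[OF assms(1)] by blast+
  have mono: "?l ! a < ?l ! b \<longleftrightarrow> a < b" if "a < card S" "b < card S" for a b
    using sorted_wrt_nth_less[OF l(4)] that l(3) by (metis linorder_neqE_nat less_asym less_irrefl)
  have "{s \<in> S. s < ?l ! i} = (!) ?l ` {..<i}"
  proof (intro equalityI subsetI)
    fix s assume s: "s \<in> {s \<in> S. s < ?l ! i}"
    then obtain a where "a < card S" "s = ?l ! a" using l(1,3) by (metis (mono_tags, lifting) in_set_conv_nth mem_Collect_eq)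
    then show "s \<in> (!) ?l ` {..<i}" using s mono assms(2) by auto
  next
    fix s assume "s \<in> (!) ?l ` {..<i}"
    then obtain a where "a < i" "s = ?l ! a" by auto
    then show "s \<in> {s \<in> S. s < ?l ! i}" using mono[of a i] assms(2) nth_mem[of a ?l] l(1,3) by simp
  qed
  moreover have "inj_on ((!) ?l) {..<i}" using l(2,3) assms(2) by (intro inj_on_nth) auto
  ultimately show ?thesis by (simp add: card_image)
qed

lemma unlifts_tens:
  assumes k: "k \<notin> S" and S: "insert k S \<subseteq> {..<length \<Gamma>}" and f: "\<Gamma> ! k = Bin c A0 A1"
  shows "\<exists>e. unlifts \<Gamma> S k {b}
    (map (\<lambda>j. if j = k then sub b (\<Gamma> ! k) else \<Gamma> ! j) (sorted_list_of_set (S \<union> {k}))) e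
    (\<lambda>(j, p). if j = k then (card {s \<in> S \<union> {k}. s < j}, tl p) else (card {s \<in> S \<union> {k}. s < j}, p))"
    (is "\<exists>e. unlifts _ _ _ _ ?G e ?g")
proof -
  let ?l = "sorted_list_of_set (S \<union> {k})"
  let ?h = "\<lambda>j. if j = k then (k, [b]) else (j, [])"
  let ?e = "(!) (map ?h ?l)"
  have fin: "finite (S \<union> {k})" using S finite_subset by auto
  have l: "set ?l = S \<union> {k}" "distinct ?l" "length ?l = card (S \<union> {k})"
    using sorted_list_facts[OF fin] by blast+
  have "lists_at \<Gamma> (part S k {b}) ?G ?e"
  proof (rule lists_atI)
    show "distinct (map ?h ?l)" using l(2) by (auto simp: distinct_map inj_on_def)
    have "?h ` insert k S = part S k {b}" using k by (force simp: part_def)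
    then show "set (map ?h ?l) = part S k {b}" using l(1) by simp
    show "list_all2 (\<lambda>x A. subf (\<Gamma> ! fst x) (snd x) = Some A) (map ?h ?l) ?G"
      using f by (simp add: list_all2_map1 list_all2_map2 list_all2_same)
  qed
  moreover have "?g (lift ?e (i, p)) = (i, p)" if "i < length ?G" for i p
  proof -
    have i: "i < length ?l" using that by simp
    then have "card {s \<in> S \<union> {k}. s < ?l ! i} = i" using rank_nth[OF fin] l(3) by simp
    then show ?thesis using i by (auto simp: lift_def)
  qed
  moreover have "lift ?e (?g x) = x" if "x \<in> below S k {b}" for x
  proof -
    obtain j p where x: "x = (j, p)" by (cases x)
    then have j: "j \<in> S \<union> {k}" and p: "j = k \<longrightarrow> p = b # tl p" using that k by (cases p; auto simp: below_def)+
    obtain i where i: "i < length ?l" "j = ?l ! i" using j l(1) by (metis in_set_conv_nth)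
    then have r: "card {s \<in> S \<union> {k}. s < j} = i" using rank_nth[OF fin] l(3) by simp
    show ?thesis
    proof (cases "j = k")
      case True
      then have "?g x = (i, tl p)" using x r by simp
      then show ?thesis using i True p x by (simp add: lift_def)
    next
      case False
      then have "?g x = (i, p)" using x r by simp
      then show ?thesis using i False x by (simp add: lift_def)
    qed
  qed
  ultimately have "unlifts \<Gamma> S k {b} ?G ?e ?g" unfolding unlifts_def by blast
  then show ?thesis by blast
qed

section \<open>Connectedness\<close>

abbreviation walks :: "'a fm list \<Rightarrow> 'l linking \<Rightarrow> ('l + pos) set \<Rightarrow> (('l + pos) \<times> ('l + pos)) set" where
  "walks \<Gamma> \<Lambda> V \<equiv> (sharp_E \<Gamma> \<Lambda> \<inter> V \<times> V)\<^sup>*"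

abbreviation unrooted :: "'a fm list \<Rightarrow> 'l linking \<Rightarrow> nat \<Rightarrow> ('l + pos) set" where
  "unrooted \<Gamma> \<Lambda> k \<equiv> sharp_V \<Gamma> \<Lambda> - {Inr (k, [])}"

lemma walks_sym: "(u, w) \<in> walks \<Gamma> \<Lambda> V \<Longrightarrow> (w, u) \<in> walks \<Gamma> \<Lambda> V"
proof -
  have "sym (sharp_E \<Gamma> \<Lambda> \<inter> V \<times> V)" by (auto simp: sharp_E_def sym_def)
  then have "sym (walks \<Gamma> \<Lambda> V)" by (rule sym_rtrancl)
  then show "(u, w) \<in> walks \<Gamma> \<Lambda> V \<Longrightarrow> (w, u) \<in> walks \<Gamma> \<Lambda> V" by (rule symD)
qed

lemma walks_edge:
  assumes "(x, y) \<in> sharp_E0 \<Gamma> \<Lambda>" "x \<in> V" "y \<in> V"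
  shows "(u, x) \<in> walks \<Gamma> \<Lambda> V \<longleftrightarrow> (u, y) \<in> walks \<Gamma> \<Lambda> V"
proof -
  have "(x, y) \<in> walks \<Gamma> \<Lambda> V" using assms by (auto simp: sharp_E_def)
  from rtrancl_trans[OF _ this] rtrancl_trans[OF _ walks_sym[OF this]] show ?thesis by blast
qed

lemma comp_minus_walks: "comp_minus \<Gamma> \<Lambda> k v = {u. (v, u) \<in> walks \<Gamma> \<Lambda> (unrooted \<Gamma> \<Lambda> k)}"
  by (simp add: comp_minus_def Let_def)

lemma comp_minus_eq:
  assumes "w \<in> comp_minus \<Gamma> \<Lambda> k v"
  shows "comp_minus \<Gamma> \<Lambda> k w = comp_minus \<Gamma> \<Lambda> k v"
proof -
  have vw: "(v, w) \<in> walks \<Gamma> \<Lambda> (unrooted \<Gamma> \<Lambda> k)" using assms by (simp add: comp_minus_walks)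
  show ?thesis unfolding comp_minus_walks
    using rtrancl_trans[OF vw] rtrancl_trans[OF walks_sym[OF vw]] by blast
qed

lemma comp_minus_self: "v \<in> comp_minus \<Gamma> \<Lambda> k v"
  by (simp add: comp_minus_walks)

lemma comp_minus_edge:
  assumes "(x, y) \<in> sharp_E0 \<Gamma> \<Lambda>" "x \<in> unrooted \<Gamma> \<Lambda> k" "y \<in> unrooted \<Gamma> \<Lambda> k"
  shows "x \<in> comp_minus \<Gamma> \<Lambda> k v \<longleftrightarrow> y \<in> comp_minus \<Gamma> \<Lambda> k v"
  using walks_edge[OF assms] by (simp add: comp_minus_walks)

text \<open>A component is recognised by being closed along edges and reachable from one vertex.
  Closure is an equivalence over the oriented edges \<open>sharp_E0\<close>, which takes care of
  both orientations at once.\<close>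

lemma comp_minus_eqI:
  assumes v: "v \<in> K" and K: "K \<subseteq> unrooted \<Gamma> \<Lambda> k"
    and closed: "\<And>x y. (x, y) \<in> sharp_E0 \<Gamma> \<Lambda> \<Longrightarrow> x \<in> unrooted \<Gamma> \<Lambda> k \<Longrightarrow> y \<in> unrooted \<Gamma> \<Lambda> k \<Longrightarrow> x \<in> K \<longleftrightarrow> y \<in> K"
    and reach: "\<And>w. w \<in> K \<Longrightarrow> (v, w) \<in> walks \<Gamma> \<Lambda> (unrooted \<Gamma> \<Lambda> k)"
  shows "comp_minus \<Gamma> \<Lambda> k v = K"
proof -
  have "w \<in> K" if "(v, w) \<in> walks \<Gamma> \<Lambda> (unrooted \<Gamma> \<Lambda> k)" for w
    using that
  proof (induction rule: rtrancl_induct)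
    case base
    show ?case by (rule v)
  next
    case (step y z)
    then show ?case using closed[of y z] closed[of z y] by (auto simp: sharp_E_def)
  qed
  then show ?thesis using reach unfolding comp_minus_walks by blast
qed

section \<open>Labellings that are constant along edges\<close>

lemma leaves_vertices: "leaves \<Gamma> \<subseteq> vertices \<Gamma>"
  by (auto simp: leaves_def vertices_def)

lemma vertices_prefix: "(i, q @ p) \<in> vertices \<Gamma> \<Longrightarrow> (i, q) \<in> vertices \<Gamma>"
  using subf_prefix by (fastforce simp: vertices_def)

lemma tree_edge: "(i, p @ [b]) \<in> vertices \<Gamma> \<Longrightarrow> (Inr (i, p @ [b]), Inr (i, p)) \<in> sharp_E0 \<Gamma> \<Lambda>"
  by (cases \<Lambda>) (auto simp: sharp_E0_def)

text \<open>Only edges inside the subtree at \<open>q\<close> are used, so \<open>V\<close> may omit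
  the vertices above it. The lemma thus applies to a branch of a deleted root as well as to an
  entire parse tree.\<close>

lemma tree_constant:
  assumes "(i, q @ p) \<in> vertices \<Gamma>"
    and Q: "\<And>x y. (x, y) \<in> sharp_E0 \<Gamma> \<Lambda> \<Longrightarrow> x \<in> V \<Longrightarrow> y \<in> V \<Longrightarrow> Q x = Q y"
    and V: "\<And>p. (i, q @ p) \<in> vertices \<Gamma> \<Longrightarrow> Inr (i, q @ p) \<in> V"
  shows "Q (Inr (i, q @ p)) = Q (Inr (i, q))"
  using assms(1)
proof (induction p rule: rev_induct)
  case Nil
  then show ?case by simp
next
  case (snoc b p)
  then have v: "(i, (q @ p) @ [b]) \<in> vertices \<Gamma>" by simp
  then have v': "(i, q @ p) \<in> vertices \<Gamma>" by (rule vertices_prefix)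
  have "Q (Inr (i, (q @ p) @ [b])) = Q (Inr (i, q @ p))"
    by (rule Q[OF tree_edge[OF v]]) (use V[of p] V[of "p @ [b]"] v v' in auto)
  then show ?case using snoc.IH[OF v'] by simp
qed

text \<open>The labelling by reachability from a fixed vertex is constant on each parse tree, so it
  descends to a labelling of links and formulas, to which \<open>coupled\<close> applies.\<close>

lemma coupled_connected:
  assumes l: "linking d \<Gamma> \<Lambda>" and c: "coupled (length \<Gamma>) \<Lambda>" and ne: "fst \<Lambda> \<noteq> {}"
  shows "sl_connected \<Gamma> \<Lambda>"
proof -
  obtain T C R where L: "\<Lambda> = (T, C, R)" by (cases \<Lambda>)
  let ?V = "sharp_V \<Gamma> \<Lambda>"
  have R: "R \<subseteq> T \<times> leaves \<Gamma>" using l L by (simp add: linking_def)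
  have "(u, v) \<in> walks \<Gamma> \<Lambda> ?V" if uv: "u \<in> ?V" "v \<in> ?V" for u v
  proof -
    define Q where "Q w \<longleftrightarrow> (u, w) \<in> walks \<Gamma> \<Lambda> ?V" for w
    have Q: "Q x = Q y" if "(x, y) \<in> sharp_E0 \<Gamma> \<Lambda>" "x \<in> ?V" "y \<in> ?V" for x y
      unfolding Q_def using walks_edge[OF that] .
    have tree: "Q (Inr (i, p)) = Q (Inr (i, []))" if "(i, p) \<in> vertices \<Gamma>" for i p
      using tree_constant[of i "[]" p \<Gamma> \<Lambda> ?V Q] that Q by (auto simp: sharp_V_def L)
    have "Q (Inl l) = Q (Inl l')" if "conf T C l l'" for l l'
      by (rule Q) (use that in \<open>auto simp: sharp_E0_def sharp_V_def L conf_def\<close>)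
    moreover have "Q (Inl l) = Q (Inr (i, []))" if r: "(l, (i, p)) \<in> R" for l i p
    proof -
      have "l \<in> T" "(i, p) \<in> vertices \<Gamma>" using r R leaves_vertices by auto
      moreover have "Q (Inl l) = Q (Inr (i, p))"
        by (rule Q) (use r calculation in \<open>auto simp: sharp_E0_def sharp_V_def L\<close>)
      ultimately show ?thesis using tree by simp
    qed
    ultimately obtain b where b: "\<forall>l\<in>T. Q (Inl l) = b" "\<forall>i<length \<Gamma>. Q (Inr (i, [])) = b"
      using c[unfolded L coupled_def split, rule_format, of "\<lambda>l. Q (Inl l)" "\<lambda>i. Q (Inr (i, []))"] by blast
    have "Q w = b" if "w \<in> ?V" for w
    proof (cases w)
      case (Inl l)
      then show ?thesis using that b(1) by (auto simp: sharp_V_def L)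
    next
      case (Inr x)
      obtain i p where x: "x = (i, p)" by (cases x)
      then have "(i, p) \<in> vertices \<Gamma>" using that Inr by (auto simp: sharp_V_def L)
      then show ?thesis using tree[of i p] b(2) Inr x by (simp add: vertices_def)
    qed
    then have "Q u = Q v" using uv by simp
    then show ?thesis by (simp add: Q_def)
  qed
  then show ?thesis using ne by (simp add: sl_connected_def)
qed

lemma derives_connected: "derives d \<Gamma> \<Lambda> \<Longrightarrow> sl_connected \<Gamma> \<Lambda>"
  using derives_sound[of d \<Gamma> \<Lambda>] coupled_connected[of d \<Gamma> \<Lambda>]
  by (cases \<Lambda>) (auto simp: slicing_def touching_def)

context premise
begin

lemma lift_below: "fst x < length \<Gamma>' \<Longrightarrow> lift e x \<in> below S k B"
  using e_in[of "fst x"] by (auto simp: lift_def below_def part_def)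

text \<open>A premise stays connected inside the conclusion after the principal root is deleted: its
  conflicts and its relation to leaves persist, so by \<open>coupled\<close> the labelling by
  reachability from the kept subformula is constant on it.\<close>

lemma lift_reaches:
  assumes b: "B = {b}" and c: "coupled (length \<Gamma>') (T', C', R')"
    and R': "R' \<subseteq> T' \<times> leaves \<Gamma>'"
    and T: "T' \<subseteq> T" "\<And>l l'. conf T' C' l l' \<Longrightarrow> conf T C l l'" "apsnd (lift e) ` R' \<subseteq> R"
    and w: "w \<in> Inl ` T' \<union> Inr ` (vertices \<Gamma> \<inter> below S k B)"
  shows "(Inr (k, [b]), w) \<in> walks \<Gamma> (T, C, R) (unrooted \<Gamma> (T, C, R) k)"
proof -
  let ?V = "unrooted \<Gamma> (T, C, R) k"
  define Q where "Q w \<longleftrightarrow> (Inr (k, [b]), w) \<in> walks \<Gamma> (T, C, R) ?V" for w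
  \<comment> \<open>At index \<open>k\<close> the label is read at the subformula, since the root
    itself is no longer in the graph.\<close>
  define qi where "qi i = Q (if i = k then Inr (k, [b]) else Inr (i, []))" for i
  have Q: "Q x = Q y" if "(x, y) \<in> sharp_E0 \<Gamma> (T, C, R)" "x \<in> ?V" "y \<in> ?V" for x y
    unfolding Q_def using walks_edge[OF that] .
  have tree: "Q (Inr (i, p)) = qi i" if ip: "(i, p) \<in> vertices \<Gamma>" "(i, p) \<in> below S k B" for i p
  proof (cases "i = k")
    case True
    then obtain p' where p: "p = [b] @ p'" using ip(2) b kS by (cases p) (auto simp: below_def)
    show ?thesis
      using tree_constant[of k "[b]" p' \<Gamma> "(T, C, R)" ?V Q] ip(1) p True Q
      by (auto simp: sharp_V_def qi_def)
  next
    case False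
    then show ?thesis
      using tree_constant[of i "[]" p \<Gamma> "(T, C, R)" ?V Q] ip(1) Q
      by (auto simp: sharp_V_def qi_def)
  qed
  have "\<exists>b. (\<forall>l\<in>T'. Q (Inl l) = b) \<and> (\<forall>y\<in>part S k B. qi (fst y) = b)"
  proof (rule lift_coupled[OF c])
    fix l l' assume "conf T' C' l l'"
    then have "conf T C l l'" by (rule T(2))
    then show "Q (Inl l) = Q (Inl l')"
      by (intro Q) (auto simp: sharp_E0_def sharp_V_def conf_def)
  next
    fix l i p assume r: "(l, i, p) \<in> apsnd (lift e) ` R'"
    then obtain x where x: "(l, x) \<in> R'" "(i, p) = lift e x" by (auto simp: apsnd_image_iff)
    then have xl: "x \<in> leaves \<Gamma>'" "l \<in> T" using R' T(1) by auto
    then have bl: "(i, p) \<in> below S k B" using lift_below leavesD x(2) by simp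
    have v: "(i, p) \<in> vertices \<Gamma>" using lift_leaf[OF xl(1)] x(2) leaves_vertices by auto
    have "Q (Inl l) = Q (Inr (i, p))"
      by (rule Q) (use r T(3) xl v bl kS in \<open>auto simp: sharp_E0_def sharp_V_def below_def\<close>)
    then show "Q (Inl l) = qi i" using tree[OF v bl] by simp
  qed
  then obtain b' where b': "\<forall>l\<in>T'. Q (Inl l) = b'" "\<And>y. y\<in>part S k B \<Longrightarrow> qi (fst y) = b'" by blast
  have "qi k = b'" using b'(2)[of "(k, [b])"] b by (simp add: part_def)
  moreover have "qi k" by (simp add: qi_def Q_def)
  ultimately have "b'" by simp
  moreover have "qi i = b'" if "i \<in> insert k S" for i
    using b'(2)[of "(i, [])"] \<open>qi k = b'\<close> that by (auto simp: part_def)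
  ultimately have "Q w" using w b'(1) tree by (auto simp: below_def)
  then show ?thesis by (simp add: Q_def)
qed

end

text \<open>Once the root is gone no edge joins the two vertex sets: tree edges stay within one
  formula or one branch, conflicts do not cross because the sides are mutually coherent, and a link
  meets only leaves of its own premise. Within each set everything is reachable by
  \<open>lift_reaches\<close>.\<close>

lemma tensor_components:
  assumes k: "k \<notin> S0" "k \<notin> S1" and S: "S0 \<inter> S1 = {}" and all: "insert k (S0 \<union> S1) = {..<length \<Gamma>}"
    and f: "\<Gamma> ! k = Bin CTens A B"
    and l0: "lists_at \<Gamma> (part S0 k {False}) \<Gamma>0 e0" and l1: "lists_at \<Gamma> (part S1 k {True}) \<Gamma>1 e1"
    and d0: "derives d \<Gamma>0 \<Lambda>0" and d1: "derives d \<Gamma>1 \<Lambda>1" and dis: "fst \<Lambda>0 \<inter> fst \<Lambda>1 = {}"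
    and \<Lambda>: "\<Lambda> = link_union True (transport (lift e0) \<Lambda>0) (transport (lift e1) \<Lambda>1)"
  shows "comp_minus \<Gamma> \<Lambda> k (Inr (k, [False])) = Inl ` fst \<Lambda>0 \<union> Inr ` (vertices \<Gamma> \<inter> below S0 k {False})" (is "?c0 = ?K0")
    and "comp_minus \<Gamma> \<Lambda> k (Inr (k, [True])) = Inl ` fst \<Lambda>1 \<union> Inr ` (vertices \<Gamma> \<inter> below S1 k {True})" (is "?c1 = ?K1")
    and "comp_minus \<Gamma> \<Lambda> k (Inr (k, [False])) \<union> comp_minus \<Gamma> \<Lambda> k (Inr (k, [True])) = unrooted \<Gamma> \<Lambda> k"
    and "comp_minus \<Gamma> \<Lambda> k (Inr (k, [False])) \<inter> comp_minus \<Gamma> \<Lambda> k (Inr (k, [True])) = {}"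
proof -
  obtain T0 C0 R0 where L0: "\<Lambda>0 = (T0, C0, R0)" by (cases \<Lambda>0)
  obtain T1 C1 R1 where L1: "\<Lambda>1 = (T1, C1, R1)" by (cases \<Lambda>1)
  interpret p0: premise \<Gamma> S0 k "{False}" \<Gamma>0 e0 CTens A B
    using k all f l0 by unfold_locales auto
  interpret p1: premise \<Gamma> S1 k "{True}" \<Gamma>1 e1 CTens A B
    using k all f l1 by unfold_locales auto
  define Q0 Q1 where Q: "Q0 = apsnd (lift e0) ` R0" "Q1 = apsnd (lift e1) ` R1"
  define C where "C = C0 \<union> C1 \<union> (T0 \<times> T1 \<union> T1 \<times> T0)"
  have L: "\<Lambda> = (T0 \<union> T1, C, Q0 \<union> Q1)" by (simp add: \<Lambda> L0 L1 link_union_def transport_simp Q C_def)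
  have s: "slicing d \<Gamma>0 (T0, C0, R0)" "slicing d \<Gamma>1 (T1, C1, R1)"
    and c: "coupled (length \<Gamma>0) (T0, C0, R0)" "coupled (length \<Gamma>1) (T1, C1, R1)"
    using derives_sound[OF d0] derives_sound[OF d1] L0 L1 by auto
  have Cs: "C0 \<subseteq> T0 \<times> T0" "C1 \<subseteq> T1 \<times> T1" and R: "R0 \<subseteq> T0 \<times> leaves \<Gamma>0" "R1 \<subseteq> T1 \<times> leaves \<Gamma>1"
    using s by (auto simp: slicing_def linking_def coh_space_def)
  have dT: "T0 \<inter> T1 = {}" using dis L0 L1 by simp
  note cu = conf_union_mixed[OF dT Cs, folded C_def]
  let ?V = "unrooted \<Gamma> \<Lambda> k"
  have Qb: "Q0 \<subseteq> T0 \<times> below S0 k {False}" "Q1 \<subseteq> T1 \<times> below S1 k {True}"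
    using R p0.lift_below p0.leavesD p1.lift_below p1.leavesD unfolding Q by auto
  have bd: "below S0 k {False} \<inter> below S1 k {True} = {}"
    using k S by (auto simp: below_def)
  have kr: "(k, []) \<notin> below S0 k {False}" "(k, []) \<notin> below S1 k {True}" using k by (auto simp: below_def)
  have bu: "x \<in> below S0 k {False} \<union> below S1 k {True}" if "x \<in> vertices \<Gamma>" "x \<noteq> (k, [])" for x
  proof -
    obtain j p where x: "x = (j, p)" by (cases x)
    have "j < length \<Gamma>" using that x by (auto simp: vertices_def)
    then have "j \<in> S0 \<or> j \<in> S1 \<or> j = k" using all by blast
    then show ?thesis using that x by (auto simp: below_def)
  qed
  define K0 K1 where KK: "K0 = ?K0" "K1 = ?K1"
  have K: "K0 \<union> K1 = ?V"
  proof -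
    have "vertices \<Gamma> \<inter> below S0 k {False} \<union> vertices \<Gamma> \<inter> below S1 k {True} = vertices \<Gamma> - {(k, [])}"
      using bu kr by blast
    moreover have "?V = Inl ` (T0 \<union> T1) \<union> Inr ` (vertices \<Gamma> - {(k, [])})"
      by (auto simp: L sharp_V_def)
    ultimately show ?thesis unfolding KK by (auto simp: L0 L1)
  qed
  have Kd: "K0 \<inter> K1 = {}" using bd dT unfolding KK by (auto simp: L0 L1)
  have closed: "x \<in> K0 \<longleftrightarrow> y \<in> K0" if e: "(x, y) \<in> sharp_E0 \<Gamma> \<Lambda>" and V: "x \<in> ?V" "y \<in> ?V" for x y
  proof -
    consider i p b where "x = Inr (i, p @ [b])" "y = Inr (i, p)"
      | l l' where "x = Inl l" "y = Inl l'" "conf (T0 \<union> T1) C l l'"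
      | l z where "x = Inl l" "y = Inr z" "(l, z) \<in> Q0 \<union> Q1"
      using e unfolding sharp_E0_def L by auto
    then show ?thesis
    proof cases
      case 1
      have "(i, p @ [b]) \<in> vertices \<Gamma>" "(i, p) \<in> vertices \<Gamma>" "(i, p) \<noteq> (k, [])"
        using V 1 by (auto simp: sharp_V_def L)
      then have "(i, p @ [b]) \<in> below S0 k {False} \<longleftrightarrow> (i, p) \<in> below S0 k {False}"
        by (auto simp: below_def)
      then show ?thesis using 1 V unfolding KK by (auto simp: sharp_V_def L)
    next
      case 2
      then have "l \<in> T0 \<longleftrightarrow> l' \<in> T0" unfolding cu using conf_mem[of T0 C0] conf_mem[of T1 C1] dT by blast
      then show ?thesis using 2 unfolding KK by (auto simp: L0)
    next
      case 3
      then have "l \<in> T0 \<longleftrightarrow> z \<in> below S0 k {False}" using Qb dT bd by blast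
      moreover have "z \<in> vertices \<Gamma>" using 3 V by (auto simp: sharp_V_def L)
      ultimately show ?thesis using 3 unfolding KK by (auto simp: L0)
    qed
  qed
  have kv: "(k, [b]) \<in> vertices \<Gamma>" for b
    using f all by (auto simp: vertices_def)
  have 0: "?c0 = K0"
  proof (rule comp_minus_eqI[OF _ _ closed])
    show "Inr (k, [False]) \<in> K0" using kv unfolding KK by (auto simp: below_def)
    show "K0 \<subseteq> ?V" using K by blast
    fix w assume "w \<in> K0"
    then show "(Inr (k, [False]), w) \<in> walks \<Gamma> \<Lambda> ?V"
      unfolding L KK L0
      by (intro p0.lift_reaches[OF refl c(1) R(1)]) (simp_all add: cu Q)
  qed
  have 1: "?c1 = K1"
  proof (rule comp_minus_eqI)
    show "Inr (k, [True]) \<in> K1" using kv unfolding KK by (auto simp: below_def)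
    show "K1 \<subseteq> ?V" using K by blast
    fix x y assume "(x, y) \<in> sharp_E0 \<Gamma> \<Lambda>" "x \<in> ?V" "y \<in> ?V"
    then show "x \<in> K1 \<longleftrightarrow> y \<in> K1" using closed[of x y] K Kd by blast
  next
    fix w assume "w \<in> K1"
    then show "(Inr (k, [True]), w) \<in> walks \<Gamma> \<Lambda> ?V"
      unfolding L KK L1
      by (intro p1.lift_reaches[OF refl c(2) R(2)]) (simp_all add: cu Q)
  qed
  show "?c0 = ?K0" "?c1 = ?K1" using 0 1 KK by simp_all
  show "?c0 \<union> ?c1 = ?V" "?c0 \<inter> ?c1 = {}" unfolding 0 1 by (rule K, rule Kd)
qed

text \<open>The coherent pairs added by a mixed union all cross the sides, so restricting to one set
  of links cuts them away.\<close>

lemma restrict_link_union: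
  assumes "supported n \<Lambda>0" "supported n \<Lambda>1" "fst \<Lambda>0 \<inter> fst \<Lambda>1 = {}"
  shows "restrict_links (link_union m \<Lambda>0 \<Lambda>1) (fst \<Lambda>0) = \<Lambda>0"
    and "restrict_links (link_union m \<Lambda>0 \<Lambda>1) (fst \<Lambda>1) = \<Lambda>1"
proof -
  obtain T0 C0 R0 where L0: "\<Lambda>0 = (T0, C0, R0)" by (cases \<Lambda>0)
  obtain T1 C1 R1 where L1: "\<Lambda>1 = (T1, C1, R1)" by (cases \<Lambda>1)
  have a: "C0 \<subseteq> T0 \<times> T0" "C1 \<subseteq> T1 \<times> T1" "R0 \<subseteq> T0 \<times> UNIV" "R1 \<subseteq> T1 \<times> UNIV" "T0 \<inter> T1 = {}"
    using assms by (auto simp: L0 L1 supported_def)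
  have "C0 \<union> C1 \<union> (if m then T0 \<times> T1 \<union> T1 \<times> T0 else {}) = C \<Longrightarrow> C \<inter> T0 \<times> T0 = C0 \<and> C \<inter> T1 \<times> T1 = C1" for C
    using a by (cases m) auto
  moreover have "{(l, x). (l, x) \<in> R0 \<union> R1 \<and> l \<in> T0} = R0" "{(l, x). (l, x) \<in> R0 \<union> R1 \<and> l \<in> T1} = R1"
    using a by blast+
  moreover have "(T0 \<union> T1) \<inter> T0 = T0" "(T0 \<union> T1) \<inter> T1 = T1" by blast+
  ultimately show "restrict_links (link_union m \<Lambda>0 \<Lambda>1) (fst \<Lambda>0) = \<Lambda>0"
    "restrict_links (link_union m \<Lambda>0 \<Lambda>1) (fst \<Lambda>1) = \<Lambda>1"
    unfolding restrict_links_def link_union_def L0 L1 by simp_all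
qed

section \<open>Erasure and sequentialization\<close>

lemma is_root_of_iff: "k < length \<Gamma> \<Longrightarrow> \<Gamma> ! k = Bin c A0 A1 \<Longrightarrow> is_root_of \<Gamma> k c' \<longleftrightarrow> c' = c"
  by (auto simp: is_root_of_def)

lemma unlifts_weight:
  assumes "unlifts \<Gamma> S k B \<Gamma>' e g" "k \<notin> S" "insert k S \<subseteq> {..<length \<Gamma>}" "\<Gamma> ! k = Bin c A0 A1"
  shows "weight \<Gamma>' < weight \<Gamma>"
  using lists_at_weight[OF _ assms(2-4)] assms(1) unfolding unlifts_def by blast

lemma par_part_unlifts:
  assumes "k \<notin> S" "insert k S = {..<length \<Gamma>}" "\<Gamma> ! k = Bin c A0 A1"
  shows "\<exists>\<Gamma>' e g. unlifts \<Gamma> S k UNIV \<Gamma>' e g \<and>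
    (\<forall>\<Lambda> :: 'l linking. par_part \<Gamma> \<Lambda> k = (\<Gamma>', transport g \<Lambda>))"
proof -
  obtain e where "unlifts \<Gamma> S k UNIV (take k \<Gamma> @ [A0, A1] @ drop (Suc k) \<Gamma>) e
    (\<lambda>(j, p). if j < k then (j, p) else if j = k then (if hd p then Suc k else k, tl p) else (Suc j, p))"
    using unlifts_par[OF assms] by blast
  moreover have "par_part \<Gamma> \<Lambda> k = (take k \<Gamma> @ [A0, A1] @ drop (Suc k) \<Gamma>, transport
    (\<lambda>(j, p). if j < k then (j, p) else if j = k then (if hd p then Suc k else k, tl p) else (Suc j, p)) \<Lambda>)"
    for \<Lambda> :: "'l linking"
    using assms(3) by (simp add: par_part_def relabel_def)
  ultimately show ?thesis by blast
qed

lemma choose_part_unlifts: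
  assumes "k \<notin> S" "insert k S = {..<length \<Gamma>}" "\<Gamma> ! k = Bin c A0 A1"
  shows "\<exists>\<Gamma>' e g. unlifts \<Gamma> S k {b} \<Gamma>' e g \<and>
    (\<forall>\<Lambda> :: 'l linking. choose_part \<Gamma> \<Lambda> k b = (\<Gamma>', transport g \<Lambda>))"
proof -
  obtain e where "unlifts \<Gamma> S k {b} (\<Gamma>[k := sub b (\<Gamma> ! k)]) e (\<lambda>(j, p). if j = k then (k, tl p) else (j, p))"
    using unlifts_choose[OF assms] by blast
  moreover have "choose_part \<Gamma> \<Lambda> k b = (\<Gamma>[k := sub b (\<Gamma> ! k)],
    transport (\<lambda>(j, p). if j = k then (k, tl p) else (j, p)) \<Lambda>)" for \<Lambda> :: "'l linking"
    by (simp add: choose_part_def relabel_def)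
  ultimately show ?thesis by blast
qed

lemma tens_part_unlifts:
  assumes f: "k < length \<Gamma>" "\<Gamma> ! k = Bin c A0 A1"
    and S: "S = {j. j < length \<Gamma> \<and> j \<noteq> k \<and> Inr (j, []) \<in> comp_minus \<Gamma> \<Lambda> k (Inr (k, [b]))}"
    and T: "T = {l. Inl l \<in> comp_minus \<Gamma> \<Lambda> k (Inr (k, [b]))}"
  shows "\<exists>\<Gamma>' e g. unlifts \<Gamma> S k {b} \<Gamma>' e g \<and>
    tens_part \<Gamma> \<Lambda> k b = (\<Gamma>', transport g (restrict_links \<Lambda> T))"
proof -
  have "k \<notin> S" "insert k S \<subseteq> {..<length \<Gamma>}" using f S by auto
  then obtain e where "unlifts \<Gamma> S k {b}
    (map (\<lambda>j. if j = k then sub b (\<Gamma> ! k) else \<Gamma> ! j) (sorted_list_of_set (S \<union> {k}))) e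
    (\<lambda>(j, p). if j = k then (card {s \<in> S \<union> {k}. s < j}, tl p) else (card {s \<in> S \<union> {k}. s < j}, p))"
    using unlifts_tens[OF _ _ f(2)] by blast
  then show ?thesis unfolding tens_part_def Let_def relabel_def S T by blast
qed

text \<open>The two components may still coincide here; the cardinality in the readiness condition,
  or a separate disjointness argument, tells them apart.\<close>

lemma comps_minus_two:
  assumes f: "k < length \<Gamma>" "\<Gamma> ! k = Bin c A0 A1"
    and u: "comp_minus \<Gamma> \<Lambda> k (Inr (k, [False])) \<union> comp_minus \<Gamma> \<Lambda> k (Inr (k, [True])) = unrooted \<Gamma> \<Lambda> k"
  shows "comps_minus \<Gamma> \<Lambda> k = {comp_minus \<Gamma> \<Lambda> k (Inr (k, [False])), comp_minus \<Gamma> \<Lambda> k (Inr (k, [True]))}"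
    (is "_ = {?c0, ?c1}")
proof -
  have "comp_minus \<Gamma> \<Lambda> k v \<in> {?c0, ?c1}" if "v \<in> unrooted \<Gamma> \<Lambda> k" for v
    using that comp_minus_eq unfolding u[symmetric] by blast
  moreover have "Inr (k, [False]) \<in> unrooted \<Gamma> \<Lambda> k" "Inr (k, [True]) \<in> unrooted \<Gamma> \<Lambda> k"
    unfolding u[symmetric] using comp_minus_self by blast+
  ultimately show ?thesis unfolding comps_minus_def by blast
qed

text \<open>\<open>P\<close> is a set of links containing \<open>l\<close> and its coherent
  neighbours: all links in the case of plus, a piece in the case of with. That the kept branch is
  reached is \<open>touching\<close>; that no other is reached follows from the shape of the
  inclusion.\<close>

lemma (in premise) touches_iff:
  assumes b: "B = {b}" and t: "touching (length \<Gamma>') (T, C, R)" and R: "R \<subseteq> T \<times> leaves \<Gamma>'"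
    and l: "l \<in> T" "l \<in> P" "\<And>l'. (l, l') \<in> C \<Longrightarrow> l' \<in> P"
  shows "(\<exists>m\<in>P. \<exists>q. (m, (k, b' # q)) \<in> apsnd (lift e) ` R) \<longleftrightarrow> b' = b"
proof
  assume "\<exists>m\<in>P. \<exists>q. (m, (k, b' # q)) \<in> apsnd (lift e) ` R"
  then obtain m q x where x: "(m, x) \<in> R" "(k, b' # q) = lift e x" by (auto simp: apsnd_image_iff)
  then have "x \<in> leaves \<Gamma>'" using R by blast
  then have "(k, b' # q) \<in> below S k B" using lift_below leavesD x(2) by simp
  then show "b' = b" using kS b by (simp add: below_def)
next
  assume "b' = b"
  then have "(k, [b']) \<in> part S k B" using b by (simp add: part_def)
  then show "\<exists>m\<in>P. \<exists>q. (m, (k, b' # q)) \<in> apsnd (lift e) ` R"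
    using lift_touch[OF t l(1), of k "[b']"] l(2,3) by (auto simp del: image_iff)
qed

text \<open>Inverts the last rule of a derivation. The bound two on the number of results and the
  drop in weight are what the termination measure needs.\<close>

lemma derives_step:
  fixes \<Lambda> :: "'l linking"
  assumes inv: "\<forall>a. d (d a) = a" and der: "derives d \<Gamma> \<Lambda>"
  shows "(\<exists>P l. \<Gamma> = [Lit P, Lit (d P)] \<and> \<Lambda> = ({l}, {}, {(l, (0, [])), (l, (1, []))})) \<or>
    (\<exists>k. ready \<Gamma> \<Lambda> k \<and> finite (erase \<Gamma> \<Lambda> k) \<and> card (erase \<Gamma> \<Lambda> k) \<le> 2 \<and>
      (\<forall>(\<Gamma>', \<Lambda>')\<in>erase \<Gamma> \<Lambda> k. derives d \<Gamma>' \<Lambda>' \<and> weight \<Gamma>' < weight \<Gamma>))"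
  using der
proof cases
  case (ax P l)
  then show ?thesis by blast
next
  case (par k S A B \<Gamma>' e M)
  have k: "k < length \<Gamma>" using par(3) by auto
  obtain \<Gamma>2 e2 g where u: "unlifts \<Gamma> S k UNIV \<Gamma>2 e2 g" "par_part \<Gamma> \<Lambda> k = (\<Gamma>2, transport g \<Lambda>)"
    using par_part_unlifts[OF par(2-4)] by blast
  have e: "erase \<Gamma> \<Lambda> k = {(\<Gamma>2, transport g \<Lambda>)}"
    using is_root_of_iff[OF k par(4)] u(2) by (simp add: erase_def)
  have "derives d \<Gamma>2 (transport g \<Lambda>)"
    using unlifts_derives[OF inv u(1) par(6,5)] par(1) by simp
  moreover have "weight \<Gamma>2 < weight \<Gamma>"
    using unlifts_weight[OF u(1) par(2) _ par(4)] par(3) by simp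
  moreover have "ready \<Gamma> \<Lambda> k" using is_root_of_iff[OF k par(4)] by (simp add: ready_def)
  ultimately show ?thesis using e by (intro disjI2 exI[of _ k]) simp
next
  case (plus k S A B b \<Gamma>' e M)
  interpret premise \<Gamma> S k "{b}" \<Gamma>' e CPlus A B
    using plus by unfold_locales auto
  obtain T C R where M: "M = (T, C, R)" by (cases M)
  have so: "slicing d \<Gamma>' (T, C, R)" "touching (length \<Gamma>') (T, C, R)"
    using derives_sound[OF plus(6)] M by auto
  then have R: "R \<subseteq> T \<times> leaves \<Gamma>'" and C: "C \<subseteq> T \<times> T" by (auto simp: slicing_def linking_def coh_space_def)
  have L: "\<Lambda> = (T, C, apsnd (lift e) ` R)" using plus(1) M by (simp add: transport_simp)
  obtain l where l: "l \<in> T" using so(2) by (auto simp: touching_def)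
  have t: "touches \<Lambda> (fst \<Lambda>) k b' \<longleftrightarrow> b' = b" for b'
    using touches_iff[OF refl so(2) R l, of T b'] l C unfolding touches_def L by auto
  have k: "k < length \<Gamma>" using plus(3) by auto
  obtain \<Gamma>2 e2 g where u: "unlifts \<Gamma> S k {b} \<Gamma>2 e2 g" "choose_part \<Gamma> \<Lambda> k b = (\<Gamma>2, transport g \<Lambda>)"
    using choose_part_unlifts[OF plus(2-4)] by blast
  have tb: "touches \<Lambda> (fst \<Lambda>) k True = b" using t by simp
  have e: "erase \<Gamma> \<Lambda> k = {(\<Gamma>2, transport g \<Lambda>)}"
    using is_root_of_iff[OF k plus(4)] u(2) by (simp add: erase_def tb)
  have "derives d \<Gamma>2 (transport g \<Lambda>)"
    using unlifts_derives[OF inv u(1) plus(6,5)] plus(1) by simp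
  moreover have "weight \<Gamma>2 < weight \<Gamma>"
    using unlifts_weight[OF u(1) plus(2) _ plus(4)] plus(3) by simp
  moreover have "ready \<Gamma> \<Lambda> k" using is_root_of_iff[OF k plus(4)] t by (simp add: ready_def unary_def)
  ultimately show ?thesis using e by (intro disjI2 exI[of _ k]) simp
next
  case (tens k S0 S1 A B \<Gamma>0 e0 \<Gamma>1 e1 \<Lambda>0 \<Lambda>1)
  have k: "k < length \<Gamma>" using tens(5) by auto
  note comp = tensor_components[OF tens(2-11) tens(1)]
  have bounds: "S0 \<subseteq> {..<length \<Gamma>}" "S1 \<subseteq> {..<length \<Gamma>}" using tens(5) by blast+
  have roots: "(j, []) \<in> vertices \<Gamma> \<longleftrightarrow> j < length \<Gamma>" for j by (simp add: vertices_def)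
  \<comment> \<open>The rule's split of the context is visible in the components, which is where the
    erasure looks for it.\<close>
  have S0: "S0 = {j. j < length \<Gamma> \<and> j \<noteq> k \<and> Inr (j, []) \<in> comp_minus \<Gamma> \<Lambda> k (Inr (k, [False]))}"
    unfolding comp(1) using bounds tens(2) by (auto simp: roots below_def)
  have S1: "S1 = {j. j < length \<Gamma> \<and> j \<noteq> k \<and> Inr (j, []) \<in> comp_minus \<Gamma> \<Lambda> k (Inr (k, [True]))}"
    unfolding comp(2) using bounds tens(3) by (auto simp: roots below_def)
  have T0: "fst \<Lambda>0 = {l. Inl l \<in> comp_minus \<Gamma> \<Lambda> k (Inr (k, [False]))}" unfolding comp(1) by auto
  have T1: "fst \<Lambda>1 = {l. Inl l \<in> comp_minus \<Gamma> \<Lambda> k (Inr (k, [True]))}" unfolding comp(2) by auto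
  obtain G0 f0 g0 where u0: "unlifts \<Gamma> S0 k {False} G0 f0 g0"
    "tens_part \<Gamma> \<Lambda> k False = (G0, transport g0 (restrict_links \<Lambda> (fst \<Lambda>0)))"
    using tens_part_unlifts[OF k tens(6) S0 T0] by blast
  obtain G1 f1 g1 where u1: "unlifts \<Gamma> S1 k {True} G1 f1 g1"
    "tens_part \<Gamma> \<Lambda> k True = (G1, transport g1 (restrict_links \<Lambda> (fst \<Lambda>1)))"
    using tens_part_unlifts[OF k tens(6) S1 T1] by blast
  interpret p0: premise \<Gamma> S0 k "{False}" \<Gamma>0 e0 CTens A B
    using tens by unfold_locales auto
  interpret p1: premise \<Gamma> S1 k "{True}" \<Gamma>1 e1 CTens A B
    using tens by unfold_locales auto
  have sup: "supported (length \<Gamma>) (transport (lift e0) \<Lambda>0)" "supported (length \<Gamma>) (transport (lift e1) \<Lambda>1)"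
    using supported_transport[OF derives_supported[OF tens(9)]] supported_transport[OF derives_supported[OF tens(10)]]
      p0.fst_e p1.fst_e by (auto simp: lift_def)
  have "restrict_links \<Lambda> (fst \<Lambda>0) = transport (lift e0) \<Lambda>0" "restrict_links \<Lambda> (fst \<Lambda>1) = transport (lift e1) \<Lambda>1"
    using restrict_link_union[OF sup, of True] tens(11) unfolding tens(1) by simp_all
  then have "derives d G0 (transport g0 (restrict_links \<Lambda> (fst \<Lambda>0)))" "derives d G1 (transport g1 (restrict_links \<Lambda> (fst \<Lambda>1)))"
    using unlifts_derives[OF inv u0(1) tens(9,7)] unlifts_derives[OF inv u1(1) tens(10,8)] by simp_all
  moreover have "weight G0 < weight \<Gamma>" "weight G1 < weight \<Gamma>"
    using unlifts_weight[OF u0(1) tens(2) _ tens(6)] unlifts_weight[OF u1(1) tens(3) _ tens(6)] bounds k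
    by simp_all
  moreover have "erase \<Gamma> \<Lambda> k = {tens_part \<Gamma> \<Lambda> k False, tens_part \<Gamma> \<Lambda> k True}"
    using is_root_of_iff[OF k tens(6)] by (simp add: erase_def)
  moreover have "ready \<Gamma> \<Lambda> k"
  proof -
    have "comp_minus \<Gamma> \<Lambda> k (Inr (k, [False])) \<noteq> comp_minus \<Gamma> \<Lambda> k (Inr (k, [True]))"
      using comp(4) comp_minus_self by blast
    then show ?thesis
      using comps_minus_two[OF k tens(6) comp(3)] is_root_of_iff[OF k tens(6)] by (simp add: ready_def)
  qed
  ultimately show ?thesis using u0(2) u1(2)
    by (intro disjI2 exI[of _ k]) (simp add: card_insert_if)
next
  case (withr k S A B \<Gamma>0 e0 \<Gamma>1 e1 \<Lambda>0 \<Lambda>1)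
  have k: "k < length \<Gamma>" using withr(3) by auto
  interpret p0: premise \<Gamma> S k "{False}" \<Gamma>0 e0 CWith A B
    using withr by unfold_locales auto
  interpret p1: premise \<Gamma> S k "{True}" \<Gamma>1 e1 CWith A B
    using withr by unfold_locales auto
  obtain T0 C0 R0 where L0: "\<Lambda>0 = (T0, C0, R0)" by (cases \<Lambda>0)
  obtain T1 C1 R1 where L1: "\<Lambda>1 = (T1, C1, R1)" by (cases \<Lambda>1)
  define Q0 Q1 where Q: "Q0 = apsnd (lift e0) ` R0" "Q1 = apsnd (lift e1) ` R1"
  have L: "\<Lambda> = (T0 \<union> T1, C0 \<union> C1, Q0 \<union> Q1)"
    using withr(1) by (simp add: L0 L1 link_union_def transport_simp Q)
  have s: "slicing d \<Gamma>0 (T0, C0, R0)" "slicing d \<Gamma>1 (T1, C1, R1)"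
    and t: "touching (length \<Gamma>0) (T0, C0, R0)" "touching (length \<Gamma>1) (T1, C1, R1)"
    using derives_sound[OF withr(7)] derives_sound[OF withr(8)] L0 L1 by auto
  have C: "C0 \<subseteq> T0 \<times> T0" "C1 \<subseteq> T1 \<times> T1" and R: "R0 \<subseteq> T0 \<times> leaves \<Gamma>0" "R1 \<subseteq> T1 \<times> leaves \<Gamma>1"
    using s by (auto simp: slicing_def linking_def coh_space_def)
  have dis: "T0 \<inter> T1 = {}" using withr(9) L0 L1 by simp
  have QT: "Q0 \<subseteq> T0 \<times> UNIV" "Q1 \<subseteq> T1 \<times> UNIV" using R unfolding Q by auto
  define piece where "piece l = {l'. (l, l') \<in> (C0 \<union> C1)\<^sup>*}" for l
  have pieces: "pieces \<Lambda> = piece ` (T0 \<union> T1)" by (auto simp: pieces_def L piece_def)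
  \<comment> \<open>Coherence never crosses the sides in the conclusion of a with, so the piece of a
    link stays inside its premise and touches exactly the branch of that premise.\<close>
  have p0: "piece l \<subseteq> T0 \<and> (\<forall>b. touches \<Lambda> (piece l) k b \<longleftrightarrow> b = False)" if l: "l \<in> T0" for l
  proof -
    have "l' \<in> T0" if "(l, l') \<in> (C0 \<union> C1)\<^sup>*" for l'
      using that by (induction rule: rtrancl_induct) (use l C dis in blast)+
    then have sub: "piece l \<subseteq> T0" by (auto simp: piece_def)
    have "touches \<Lambda> (piece l) k b \<longleftrightarrow> (\<exists>m\<in>piece l. \<exists>q. (m, (k, b # q)) \<in> Q0)" for b
      using sub QT dis unfolding touches_def L by auto
    moreover have "(\<exists>m\<in>piece l. \<exists>q. (m, (k, b # q)) \<in> Q0) \<longleftrightarrow> b = False" for b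
      unfolding Q by (rule p0.touches_iff[OF refl t(1) R(1) l]) (auto simp: piece_def)
    ultimately show ?thesis using sub by simp
  qed
  have p1: "piece l \<subseteq> T1 \<and> (\<forall>b. touches \<Lambda> (piece l) k b \<longleftrightarrow> b = True)" if l: "l \<in> T1" for l
  proof -
    have "l' \<in> T1" if "(l, l') \<in> (C0 \<union> C1)\<^sup>*" for l'
      using that by (induction rule: rtrancl_induct) (use l C dis in blast)+
    then have sub: "piece l \<subseteq> T1" by (auto simp: piece_def)
    have "touches \<Lambda> (piece l) k b \<longleftrightarrow> (\<exists>m\<in>piece l. \<exists>q. (m, (k, b # q)) \<in> Q1)" for b
      using sub QT dis unfolding touches_def L by auto
    moreover have "(\<exists>m\<in>piece l. \<exists>q. (m, (k, b # q)) \<in> Q1) \<longleftrightarrow> b = True" for b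
      unfolding Q by (rule p1.touches_iff[OF refl t(2) R(2) l]) (auto simp: piece_def)
    ultimately show ?thesis using sub by simp
  qed
  have self: "l \<in> piece l" for l by (simp add: piece_def)
  \<comment> \<open>The erasure collects whole pieces; those choosing a branch add up to exactly the
    links of its premise.\<close>
  have U0: "\<Union>{P \<in> pieces \<Lambda>. touches \<Lambda> P k False \<and> \<not> touches \<Lambda> P k True} = T0"
  proof (intro equalityI subsetI)
    fix l assume "l \<in> \<Union>{P \<in> pieces \<Lambda>. touches \<Lambda> P k False \<and> \<not> touches \<Lambda> P k True}"
    then obtain m where m: "m \<in> T0 \<union> T1" "l \<in> piece m" "touches \<Lambda> (piece m) k False" unfolding pieces by blast
    have "m \<notin> T1"
    proof
      assume "m \<in> T1"
      then show False using p1 m(3) by simp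
    qed
    then have "m \<in> T0" using m(1) by blast
    then show "l \<in> T0" using p0 m(2) by blast
  next
    fix l assume l: "l \<in> T0"
    then have "piece l \<in> pieces \<Lambda>" "touches \<Lambda> (piece l) k False \<and> \<not> touches \<Lambda> (piece l) k True"
      using p0[OF l] l unfolding pieces by simp_all
    then show "l \<in> \<Union>{P \<in> pieces \<Lambda>. touches \<Lambda> P k False \<and> \<not> touches \<Lambda> P k True}" using self by blast
  qed
  have U1: "\<Union>{P \<in> pieces \<Lambda>. touches \<Lambda> P k True \<and> \<not> touches \<Lambda> P k False} = T1"
  proof (intro equalityI subsetI)
    fix l assume "l \<in> \<Union>{P \<in> pieces \<Lambda>. touches \<Lambda> P k True \<and> \<not> touches \<Lambda> P k False}"
    then obtain m where m: "m \<in> T0 \<union> T1" "l \<in> piece m" "touches \<Lambda> (piece m) k True" unfolding pieces by blast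
    have "m \<notin> T0"
    proof
      assume "m \<in> T0"
      then show False using p0 m(3) by simp
    qed
    then have "m \<in> T1" using m(1) by blast
    then show "l \<in> T1" using p1 m(2) by blast
  next
    fix l assume l: "l \<in> T1"
    then have "piece l \<in> pieces \<Lambda>" "touches \<Lambda> (piece l) k True \<and> \<not> touches \<Lambda> (piece l) k False"
      using p1[OF l] l unfolding pieces by simp_all
    then show "l \<in> \<Union>{P \<in> pieces \<Lambda>. touches \<Lambda> P k True \<and> \<not> touches \<Lambda> P k False}" using self by blast
  qed
  obtain G0 f0 g0 where u0: "unlifts \<Gamma> S k {False} G0 f0 g0"
    "\<And>\<Lambda> :: 'l linking. choose_part \<Gamma> \<Lambda> k False = (G0, transport g0 \<Lambda>)"
    using choose_part_unlifts[OF withr(2-4)] by blast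
  obtain G1 f1 g1 where u1: "unlifts \<Gamma> S k {True} G1 f1 g1"
    "\<And>\<Lambda> :: 'l linking. choose_part \<Gamma> \<Lambda> k True = (G1, transport g1 \<Lambda>)"
    using choose_part_unlifts[OF withr(2-4)] by blast
  have sup: "supported (length \<Gamma>) (transport (lift e0) \<Lambda>0)" "supported (length \<Gamma>) (transport (lift e1) \<Lambda>1)"
    using supported_transport[OF derives_supported[OF withr(7)]] supported_transport[OF derives_supported[OF withr(8)]]
      p0.fst_e p1.fst_e by (auto simp: lift_def)
  have r: "restrict_links \<Lambda> T0 = transport (lift e0) \<Lambda>0" "restrict_links \<Lambda> T1 = transport (lift e1) \<Lambda>1"
    using restrict_link_union[OF sup, of False] withr(9) L0 L1 unfolding withr(1) by simp_all
  have "{F b | b. b \<in> {False, True}} = {F False, F True}" for F :: "bool \<Rightarrow> 'a fm list \<times> 'l linking"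
    by (simp add: Setcompr_eq_image del: insert_iff)
  then have e: "erase \<Gamma> \<Lambda> k = {(G0, transport g0 (transport (lift e0) \<Lambda>0)), (G1, transport g1 (transport (lift e1) \<Lambda>1))}"
    using is_root_of_iff[OF k withr(4)] by (simp add: erase_def U0 U1 r u0(2) u1(2))
  have "derives d G0 (transport g0 (transport (lift e0) \<Lambda>0))" "derives d G1 (transport g1 (transport (lift e1) \<Lambda>1))"
    using unlifts_derives[OF inv u0(1) withr(7,5)] unlifts_derives[OF inv u1(1) withr(8,6)] by simp_all
  moreover have "weight G0 < weight \<Gamma>" "weight G1 < weight \<Gamma>"
    using unlifts_weight[OF u0(1) withr(2) _ withr(4)] unlifts_weight[OF u1(1) withr(2) _ withr(4)] withr(3)
    by simp_all
  moreover have "ready \<Gamma> \<Lambda> k"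
    using is_root_of_iff[OF k withr(4)] p0 p1 by (auto simp: ready_def pieces unary_def)
  ultimately show ?thesis using e
    by (intro disjI2 exI[of _ k]) (simp add: card_insert_if)
qed

lemma leaf_below:
  assumes "x \<in> leaves \<Gamma>" "\<Gamma> ! k = Bin c A0 A1"
  shows "x \<in> below ({..<length \<Gamma>} - {k}) k UNIV"
  using assms by (cases x; cases "snd x") (auto simp: leaves_def below_def)

text \<open>Each readiness condition says that the rule can be reassembled. For plus, all linked
  leaves lie in one branch; for with, the pieces divide the links so that no coherent pair is
  separated; for tensor, links in different components have no conflict edge between them and so are
  coherent. Relabelling is undone by \<open>unlifts_transport\<close>.\<close>

lemma derives_unerase:
  fixes \<Lambda> :: "'l linking"
  assumes link: "linking d \<Gamma> \<Lambda>" and conn: "sl_connected \<Gamma> \<Lambda>" and rd: "ready \<Gamma> \<Lambda> k"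
    and der: "\<And>\<Gamma>' \<Lambda>'. (\<Gamma>', \<Lambda>') \<in> erase \<Gamma> \<Lambda> k \<Longrightarrow> derives d \<Gamma>' \<Lambda>'"
  shows "derives d \<Gamma> \<Lambda>"
proof -
  obtain T C R where L: "\<Lambda> = (T, C, R)" by (cases \<Lambda>)
  have C: "C \<subseteq> T \<times> T" "sym C" "\<And>x. (x, x) \<notin> C" and R: "R \<subseteq> T \<times> leaves \<Gamma>"
    using link by (auto simp: L linking_def coh_space_def)
  obtain c A B where k: "k < length \<Gamma>" "\<Gamma> ! k = Bin c A B"
    using rd by (auto simp: ready_def is_root_of_def)
  note root = is_root_of_iff[OF k]
  define S where "S = {..<length \<Gamma>} - {k}"
  have S: "k \<notin> S" "insert k S = {..<length \<Gamma>}" using k by (auto simp: S_def)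
  have RB: "x \<in> below S k UNIV" if "(l, x) \<in> R" for l x
    using that R leaf_below[OF _ k(2)] unfolding S_def by blast
  have Rk: "\<exists>b q. p = b # q" if "(l, (k, p)) \<in> R" for l p
    using RB[OF that] S(1) by (cases p) (auto simp: below_def)
  show ?thesis
  proof (cases c)
    case CPar
    obtain \<Gamma>' e g where u: "unlifts \<Gamma> S k UNIV \<Gamma>' e g" "par_part \<Gamma> \<Lambda> k = (\<Gamma>', transport g \<Lambda>)"
      using par_part_unlifts[OF S k(2)] by blast
    have "derives d \<Gamma>' (transport g \<Lambda>)" using u(2) root CPar by (intro der) (simp add: erase_def)
    then have "derives d \<Gamma> (transport (lift e) (transport g \<Lambda>))"
      using u(1) k(2) CPar by (intro derives.par[OF S]) (auto simp: unlifts_def)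
    moreover have "transport (lift e) (transport g \<Lambda>) = \<Lambda>"
      using RB by (intro unlifts_transport[OF u(1)]) (auto simp: L)
    ultimately show ?thesis by simp
  next
    case CPlus
    define b where "b = touches \<Lambda> (fst \<Lambda>) k True"
    have un: "unary \<Lambda> (fst \<Lambda>) k" using rd root CPlus by (simp add: ready_def)
    have "x \<in> below S k {b}" if lx: "(l, x) \<in> R" for l x
    proof -
      obtain j p where x: "x = (j, p)" by (cases x)
      show ?thesis
      proof (cases "j = k")
        case True
        then obtain b' q where p: "p = b' # q" using Rk lx x by blast
        then have "touches \<Lambda> (fst \<Lambda>) k b'" using lx x True R by (auto simp: touches_def L)
        then have "b' = b" using un by (cases b') (auto simp: unary_def b_def)
        then show ?thesis using x p True by (simp add: below_def)
      next
        case False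
        then show ?thesis using RB[OF lx] x by (auto simp: below_def)
      qed
    qed
    then have sub: "snd ` snd (snd \<Lambda>) \<subseteq> below S k {b}" by (auto simp: L)
    obtain \<Gamma>' e g where u: "unlifts \<Gamma> S k {b} \<Gamma>' e g" "choose_part \<Gamma> \<Lambda> k b = (\<Gamma>', transport g \<Lambda>)"
      using choose_part_unlifts[OF S k(2)] by blast
    have "derives d \<Gamma>' (transport g \<Lambda>)"
      using u(2) root CPlus by (intro der) (simp add: erase_def b_def)
    then have "derives d \<Gamma> (transport (lift e) (transport g \<Lambda>))"
      using u(1) k(2) CPlus by (intro derives.plus[OF S]) (auto simp: unlifts_def)
    then show ?thesis using unlifts_transport[OF u(1) sub] by simp
  next
    case CWith
    have un: "unary \<Lambda> P k" if "P \<in> pieces \<Lambda>" for P using rd root CWith that by (simp add: ready_def)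
    define piece where "piece l = {l'. (l, l') \<in> C\<^sup>*}" for l
    have pieces: "pieces \<Lambda> = piece ` T" by (auto simp: pieces_def L piece_def)
    have same: "piece l' = piece l" if "l' \<in> piece l" for l l'
    proof -
      have "(l, l') \<in> C\<^sup>*" using that by (simp add: piece_def)
      moreover have "(l', l) \<in> C\<^sup>*" using symD[OF sym_rtrancl[OF C(2)]] calculation by blast
      ultimately show ?thesis unfolding piece_def by (meson Collect_cong rtrancl_trans)
    qed
    have self: "l \<in> piece l" for l by (simp add: piece_def)
    define U where "U b = \<Union>{P \<in> pieces \<Lambda>. touches \<Lambda> P k b \<and> \<not> touches \<Lambda> P k (\<not> b)}" for b
    have U: "l \<in> U b \<longleftrightarrow> touches \<Lambda> (piece l) k b" if l: "l \<in> T" for l b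
    proof
      assume "l \<in> U b"
      then obtain m where "l \<in> piece m" "touches \<Lambda> (piece m) k b" unfolding U_def pieces by blast
      then show "touches \<Lambda> (piece l) k b" using same by simp
    next
      assume t: "touches \<Lambda> (piece l) k b"
      have P: "piece l \<in> pieces \<Lambda>" using l pieces by simp
      then have "\<not> touches \<Lambda> (piece l) k (\<not> b)" using un[OF P] t by (cases b) (auto simp: unary_def)
      then show "l \<in> U b" using P t self unfolding U_def by blast
    qed
    \<comment> \<open>Every piece being unary, it belongs to exactly one of the two unions.\<close>
    have part: "l \<in> U True \<longleftrightarrow> l \<notin> U False" if l: "l \<in> T" for l
      using un[of "piece l"] l unfolding U[OF l] unary_def pieces by blast
    \<comment> \<open>Coherent links share a piece, so all of \<open>C\<close> lies within the two
      parts, and the union with \<open>m = False\<close> restores it exactly.\<close>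
    have coh: "l \<in> U b \<longleftrightarrow> l' \<in> U b" if "(l, l') \<in> C" for l l' b
    proof -
      have "l' \<in> piece l" using that by (auto simp: piece_def)
      then show ?thesis using same[of l' l] U[of l b] U[of l' b] that C(1) by auto
    qed
    let ?L = "\<lambda>b. restrict_links \<Lambda> (U b)"
    have sub: "snd ` snd (snd (?L b)) \<subseteq> below S k {b}" for b
    proof
      fix x assume "x \<in> snd ` snd (snd (?L b))"
      then obtain l i p where x: "x = (i, p)" and lx: "(l, i, p) \<in> R" "l \<in> U b"
        by (auto simp: restrict_links_def L)
      then have l: "l \<in> T" using R by auto
      show "x \<in> below S k {b}"
      proof (cases "i = k")
        case True
        then obtain b' q where p: "p = b' # q" using Rk lx by blast
        then have "touches \<Lambda> (piece l) k b'" using lx True self by (auto simp: touches_def L)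
        then have "l \<in> U b'" using U[OF l] by simp
        then have "b' = b" using lx(2) part[OF l] by (cases b; cases b') auto
        then show ?thesis using p True x by (simp add: below_def)
      next
        case False
        then show ?thesis using RB[OF lx(1)] x by (auto simp: below_def)
      qed
    qed
    obtain \<Gamma>0 e0 g0 where u0: "unlifts \<Gamma> S k {False} \<Gamma>0 e0 g0"
      "choose_part \<Gamma> (?L False) k False = (\<Gamma>0, transport g0 (?L False))"
      using choose_part_unlifts[OF S k(2)] by blast
    obtain \<Gamma>1 e1 g1 where u1: "unlifts \<Gamma> S k {True} \<Gamma>1 e1 g1"
      "choose_part \<Gamma> (?L True) k True = (\<Gamma>1, transport g1 (?L True))"
      using choose_part_unlifts[OF S k(2)] by blast
    have er: "erase \<Gamma> \<Lambda> k = {choose_part \<Gamma> (?L b) k b | b. b \<in> {False, True}}"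
      using root CWith by (simp add: erase_def U_def)
    have "choose_part \<Gamma> (?L b) k b \<in> erase \<Gamma> \<Lambda> k" for b unfolding er by (cases b) blast+
    from this[of False] this[of True]
    have "derives d \<Gamma>0 (transport g0 (?L False))" "derives d \<Gamma>1 (transport g1 (?L True))"
      unfolding u0(2) u1(2) by (auto intro: der)
    moreover have "fst (?L False) \<inter> fst (?L True) = {}" using part by (auto simp: restrict_links_def L)
    ultimately have "derives d \<Gamma> (link_union False (transport (lift e0) (transport g0 (?L False)))
        (transport (lift e1) (transport g1 (?L True))))"
      using u0(1) u1(1) k(2) CWith by (intro derives.withr[OF S]) (auto simp: unlifts_def)
    moreover have "link_union False (?L False) (?L True) = \<Lambda>"
    proof -
      have "T \<inter> U False \<union> T \<inter> U True = T" using part by blast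
      moreover have "C \<inter> (T \<inter> U False) \<times> (T \<inter> U False) \<union> C \<inter> (T \<inter> U True) \<times> (T \<inter> U True) = C"
      proof (intro equalityI subsetI)
        fix z assume z: "z \<in> C"
        then obtain x y where xy: "z = (x, y)" "x \<in> T" "y \<in> T" using C(1) by auto
        then show "z \<in> C \<inter> (T \<inter> U False) \<times> (T \<inter> U False) \<union> C \<inter> (T \<inter> U True) \<times> (T \<inter> U True)"
          using coh[of x y True] coh[of x y False] part[of x] z by auto
      qed blast
      moreover have "{(l, x). (l, x) \<in> R \<and> l \<in> U False} \<union> {(l, x). (l, x) \<in> R \<and> l \<in> U True} = R"
        using part R by blast
      ultimately show ?thesis by (simp add: link_union_def restrict_links_def L)
    qed
    ultimately show ?thesis using unlifts_transport[OF u0(1) sub] unlifts_transport[OF u1(1) sub] by simp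
  next
    case CTens
    let ?V = "unrooted \<Gamma> \<Lambda> k"
    define K where "K b = comp_minus \<Gamma> \<Lambda> k (Inr (k, [b]))" for b
    have kv: "Inr (k, [b]) \<in> ?V" for b using k by (auto simp: sharp_V_def L vertices_def)
    have KV: "K b \<subseteq> ?V" for b
    proof
      fix w assume "w \<in> K b"
      then have "(Inr (k, [b]), w) \<in> walks \<Gamma> \<Lambda> ?V" by (simp add: K_def comp_minus_walks)
      then show "w \<in> ?V" using kv by (induction rule: rtrancl_induct) auto
    qed
    have edge: "x \<in> K b \<longleftrightarrow> y \<in> K b" if "(x, y) \<in> sharp_E0 \<Gamma> \<Lambda>" "x \<in> ?V" "y \<in> ?V" for x y b
      unfolding K_def using comp_minus_edge[OF that] .
    \<comment> \<open>The only neighbours of the root are the roots of its two subformulas, so any further component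
      would already be disconnected from it before the deletion.\<close>
    have KU: "K False \<union> K True = ?V"
    proof (rule ccontr)
      assume "K False \<union> K True \<noteq> ?V"
      then obtain v where v: "v \<in> ?V - (K False \<union> K True)" using KV by blast
      have nbr: "z \<in> K False \<union> K True"
        if zE: "(Inr (k, []), z) \<in> sharp_E \<Gamma> \<Lambda>" for z
      proof -
        have "(k, []) \<notin> leaves \<Gamma>" using k by (simp add: leaves_def)
        then have "(l, (k, [])) \<notin> R" for l using R by blast
        then obtain b where "z = Inr (k, [b])"
          using zE by (auto simp: sharp_E_def sharp_E0_def L)
        then have "z \<in> K b" by (simp add: K_def comp_minus_self)
        then show ?thesis by (cases b) simp_all
      qed
      have sym: "(y, x) \<in> sharp_E \<Gamma> \<Lambda>" if "(x, y) \<in> sharp_E \<Gamma> \<Lambda>" for x y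
        using that by (auto simp: sharp_E_def)
      have closed: "z \<in> ?V - (K False \<union> K True)"
        if y: "y \<in> ?V - (K False \<union> K True)" and e: "(y, z) \<in> sharp_E \<Gamma> \<Lambda>" and z: "z \<in> sharp_V \<Gamma> \<Lambda>" for y z
      proof -
        have "z \<noteq> Inr (k, [])" using nbr[of y] sym[OF e] y by blast
        then have zV: "z \<in> ?V" using z by simp
        have "z \<in> K b \<longleftrightarrow> y \<in> K b" for b
          using e edge[of y z b] edge[of z y b] y zV by (auto simp: sharp_E_def)
        then show ?thesis using y zV by blast
      qed
      have rootV: "Inr (k, []) \<in> sharp_V \<Gamma> \<Lambda>" using k by (auto simp: sharp_V_def L vertices_def)
      then have walk: "(v, Inr (k, [])) \<in> walks \<Gamma> \<Lambda> (sharp_V \<Gamma> \<Lambda>)" using conn v by (auto simp: sl_connected_def)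
      have "w \<in> ?V - (K False \<union> K True)" if "(v, w) \<in> walks \<Gamma> \<Lambda> (sharp_V \<Gamma> \<Lambda>)" for w
        using that
      proof (induction rule: rtrancl_induct)
        case base
        show ?case by (rule v)
      next
        case (step y z)
        then show ?case using closed[of y z] by blast
      qed
      from this[OF walk] show False by simp
    qed
    have "card (comps_minus \<Gamma> \<Lambda> k) = 2" using rd root CTens by (simp add: ready_def)
    moreover have "comps_minus \<Gamma> \<Lambda> k = {K False, K True}"
      using comps_minus_two[OF k] KU unfolding K_def by blast
    ultimately have "K False \<noteq> K True" by (auto simp: card_insert_if split: if_splits)
    \<comment> \<open>Components that meet are equal, so different ones are disjoint.\<close>
    then have Kd: "K False \<inter> K True = {}" unfolding K_def using comp_minus_eq by (metis disjoint_iff)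
    define T' S' where TS: "T' b = {l. Inl l \<in> K b}"
      "S' b = {j. j < length \<Gamma> \<and> j \<noteq> k \<and> Inr (j, []) \<in> K b}" for b
    have VS: "Inr x \<in> sharp_V \<Gamma> \<Lambda> \<longleftrightarrow> x \<in> vertices \<Gamma>" for x
      by (auto simp: sharp_V_def L)
    have VV: "Inl l \<in> ?V \<longleftrightarrow> l \<in> T" "Inr x \<in> ?V \<longleftrightarrow> x \<in> vertices \<Gamma> \<and> x \<noteq> (k, [])" for l x
      by (auto simp: sharp_V_def L)
    have T': "T' False \<union> T' True = T" "T' False \<inter> T' True = {}"
      using KU Kd VV(1) unfolding TS by blast+
    have S': "k \<notin> S' b" for b by (simp add: TS)
    have SU: "insert k (S' False \<union> S' True) = {..<length \<Gamma>}" "S' False \<inter> S' True = {}"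
    proof -
      have "Inr (j, []) \<in> K False \<union> K True" if "j < length \<Gamma>" "j \<noteq> k" for j
        unfolding KU VV using that by (simp add: vertices_def)
      then show "insert k (S' False \<union> S' True) = {..<length \<Gamma>}" using k(1) unfolding TS by auto
      show "S' False \<inter> S' True = {}" using Kd unfolding TS by blast
    qed
    let ?L = "\<lambda>b. restrict_links \<Lambda> (T' b)"
    have sub: "snd ` snd (snd (?L b)) \<subseteq> below (S' b) k {b}" for b
    proof
      fix x assume "x \<in> snd ` snd (snd (?L b))"
      then obtain l i p where x: "x = (i, p)" and lx: "(l, i, p) \<in> R" "Inl l \<in> K b"
        by (auto simp: restrict_links_def L TS)
      have v: "(i, p) \<in> vertices \<Gamma>" and lT: "l \<in> T" using lx R leaves_vertices by auto
      have nr: "(i, p) \<noteq> (k, [])" using Rk lx(1) by blast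
      have "(Inl l, Inr (i, p)) \<in> sharp_E0 \<Gamma> \<Lambda>" using lx(1) by (auto simp: sharp_E0_def L)
      then have ip: "Inr (i, p) \<in> K b" using edge[of "Inl l" "Inr (i, p)" b] lx(2) v nr lT VV by blast
      show "x \<in> below (S' b) k {b}"
      proof (cases "i = k")
        case True
        then obtain b' q where "p = b' # q" using Rk lx(1) by blast
        then have p: "p = [b'] @ q" by simp
        \<comment> \<open>The leaf is joined by tree edges to the subformula on its branch
          \<open>b'\<close>, whose component is \<open>K b'\<close>; disjointness then forces
          \<open>b' = b\<close>.\<close>
        have "(Inr (k, [b'] @ q) \<in> K b) = (Inr (k, [b']) \<in> K b)"
          by (rule tree_constant[where V = ?V and \<Lambda> = \<Lambda> and \<Gamma> = \<Gamma>])
            (use v p True edge VS in auto)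
        then have "Inr (k, [b']) \<in> K b" using ip p True by simp
        moreover have "Inr (k, [b']) \<in> K b'" unfolding K_def by (rule comp_minus_self)
        ultimately have "b' = b" using Kd by (cases b; cases b') auto
        then show ?thesis using p True x by (simp add: below_def)
      next
        case False
        have "(Inr (i, [] @ p) \<in> K b) = (Inr (i, []) \<in> K b)"
          by (rule tree_constant[where V = ?V and \<Lambda> = \<Lambda> and \<Gamma> = \<Gamma>])
            (use v False edge VS in auto)
        then have "i \<in> S' b" using ip False v by (simp add: TS vertices_def)
        then show ?thesis using x by (simp add: below_def)
      qed
    qed
    obtain \<Gamma>0 e0 g0 where u0: "unlifts \<Gamma> (S' False) k {False} \<Gamma>0 e0 g0"
      "tens_part \<Gamma> \<Lambda> k False = (\<Gamma>0, transport g0 (?L False))"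
      using tens_part_unlifts[OF k, of "S' False" \<Lambda> False "T' False"] unfolding TS K_def by blast
    obtain \<Gamma>1 e1 g1 where u1: "unlifts \<Gamma> (S' True) k {True} \<Gamma>1 e1 g1"
      "tens_part \<Gamma> \<Lambda> k True = (\<Gamma>1, transport g1 (?L True))"
      using tens_part_unlifts[OF k, of "S' True" \<Lambda> True "T' True"] unfolding TS K_def by blast
    have "erase \<Gamma> \<Lambda> k = {tens_part \<Gamma> \<Lambda> k False, tens_part \<Gamma> \<Lambda> k True}"
      using root CTens by (simp add: erase_def)
    then have "derives d \<Gamma>0 (transport g0 (?L False))" "derives d \<Gamma>1 (transport g1 (?L True))"
      using u0(2) u1(2) by (auto intro: der)
    moreover have "fst (?L False) \<inter> fst (?L True) = {}" using T' by (auto simp: restrict_links_def L)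
    ultimately have "derives d \<Gamma> (link_union True (transport (lift e0) (transport g0 (?L False)))
        (transport (lift e1) (transport g1 (?L True))))"
      using u0(1) u1(1) k(2) CTens by (intro derives.tens[OF S' S' SU(2) SU(1)]) (auto simp: unlifts_def)
    moreover have "link_union True (?L False) (?L True) = \<Lambda>"
    proof -
      define T0 T1 where T01: "T0 = T' False" "T1 = T' True"
      have T: "T \<inter> T0 = T0" "T \<inter> T1 = T1" "T0 \<union> T1 = T" "T0 \<inter> T1 = {}" using T' unfolding T01 by blast+
      \<comment> \<open>Distinct links without a conflict edge are coherent, so separation of the
        components yields the full product of the two parts.\<close>
      have cross: "(l, l') \<in> C \<and> (l', l) \<in> C" if "l \<in> T0" "l' \<in> T1" for l l'
      proof -
        have ll: "l \<in> T" "l' \<in> T" "l \<noteq> l'" using that T by blast+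
        have "\<not> conf T C l l'"
        proof
          assume "conf T C l l'"
          then have "(Inl l, Inl l') \<in> sharp_E0 \<Gamma> \<Lambda>" by (auto simp: sharp_E0_def L)
          then have "Inl l \<in> K False \<longleftrightarrow> Inl l' \<in> K False" using edge ll VV(1) by blast
          then show False using that T(4) unfolding T01 TS by blast
        qed
        then have "(l, l') \<in> C" using ll by (auto simp: conf_def)
        then show ?thesis using C(2) by (auto dest: symD)
      qed
      have "C \<inter> T0 \<times> T0 \<union> C \<inter> T1 \<times> T1 \<union> (T0 \<times> T1 \<union> T1 \<times> T0) = C"
      proof (intro equalityI subsetI)
        fix z assume z: "z \<in> C"
        then obtain x y where "z = (x, y)" "x \<in> T0 \<union> T1" "y \<in> T0 \<union> T1" using C(1) T(3) by auto
        then show "z \<in> C \<inter> T0 \<times> T0 \<union> C \<inter> T1 \<times> T1 \<union> (T0 \<times> T1 \<union> T1 \<times> T0)" using z by auto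
      qed (use cross in blast)
      moreover have "{(l, x). (l, x) \<in> R \<and> l \<in> T0} \<union> {(l, x). (l, x) \<in> R \<and> l \<in> T1} = R"
        using R T(3) by blast
      ultimately show ?thesis unfolding T01[symmetric] by (simp add: link_union_def restrict_links_def L T(1-3))
    qed
    ultimately show ?thesis using unlifts_transport[OF u0(1) sub] unlifts_transport[OF u1(1) sub] by simp
  qed
qed

text \<open>Derivability of all members is carried backwards from the empty cluster. It fails for
  the error symbol, so no error step lies on such a reduction. A root step is inverted by
  \<open>derives_unerase\<close>, whose linking hypothesis comes from
  \<open>is_cluster\<close>.\<close>

lemma erasable_derives:
  fixes Y :: "('a fm list \<times> 'l linking) set"
  assumes "(erase_step d)\<^sup>*\<^sup>* (Some Y) (Some {})" "(\<Gamma>, \<Lambda>) \<in> Y"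
  shows "derives d \<Gamma> \<Lambda>"
proof -
  define good :: "('a fm list \<times> 'l linking) set option \<Rightarrow> bool" where
    "good c \<longleftrightarrow> (\<exists>Y. c = Some Y \<and> (\<forall>(\<Gamma>, \<Lambda>)\<in>Y. derives d \<Gamma> \<Lambda>))" for c
  have "good (Some Y)"
    using assms(1)
  proof (induction rule: converse_rtranclp_induct)
    case base
    show ?case by (simp add: good_def)
  next
    case (step c c')
    have cl: "is_cluster d c" and raw: "erase_raw d c c'" using step.hyps(1) by (auto simp: erase_step_def)
    show ?case
      using raw
    proof cases
      case (err \<Gamma> \<Lambda> Y)
      then show ?thesis using step.IH by (simp add: good_def)
    next
      case (root \<Gamma> \<Lambda> X k)
      have IH: "\<forall>(\<Gamma>, \<Lambda>)\<in>X \<union> erase \<Gamma> \<Lambda> k. derives d \<Gamma> \<Lambda>" using step.IH root(2) by (simp add: good_def)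
      have "linking d \<Gamma> \<Lambda>" using cl root(1) by (simp add: is_cluster_def slicing_def split: prod.splits)
      then have "derives d \<Gamma> \<Lambda>" using derives_unerase[OF _ root(4,5)] IH by blast
      then show ?thesis using IH root(1) by (auto simp: good_def)
    next
      case (axiom \<Gamma> \<Lambda> X P l)
      then show ?thesis using step.IH derives.ax[of d P l] by (auto simp: good_def)
    qed
  qed
  then show ?thesis using assms(2) by (auto simp: good_def)
qed

text \<open>Generalised to any finite cluster of derivable slicings, since a binary rule leaves
  several of them to erase. Derivability makes all members connected, as the steps demand, so any
  member may be chosen next.\<close>

lemma derives_erasable:
  fixes Y :: "('a fm list \<times> 'l linking) set"
  assumes inv: "\<forall>a. d (d a) = a" and "finite Y" "\<forall>(\<Gamma>, \<Lambda>)\<in>Y. derives d \<Gamma> \<Lambda>"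
  shows "(erase_step d)\<^sup>*\<^sup>* (Some Y) (Some {})"
  using assms(2,3)
proof (induction "\<Sum>y\<in>Y. (3 :: nat) ^ weight (fst y)" arbitrary: Y rule: less_induct)
  case less
  let ?\<mu> = "\<lambda>Y :: ('a fm list \<times> 'l linking) set. \<Sum>y\<in>Y. (3 :: nat) ^ weight (fst y)"
  show ?case
  proof (cases "Y = {}")
    case True
    then show ?thesis by simp
  next
    case False
    then obtain \<Gamma> \<Lambda> where y: "(\<Gamma>, \<Lambda>) \<in> Y" by auto
    define X where "X = Y - {(\<Gamma>, \<Lambda>)}"
    have Y: "Y = insert (\<Gamma>, \<Lambda>) X" "(\<Gamma>, \<Lambda>) \<notin> X" "finite X" using y less.prems(1) by (auto simp: X_def)
    have cl: "is_cluster d (Some Z)" if "\<forall>(\<Gamma>, \<Lambda>)\<in>Z. derives d \<Gamma> \<Lambda>" for Z :: "('a fm list \<times> 'l linking) set"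
      using that derives_sound by (fastforce simp: is_cluster_def)
    have dX: "\<forall>(\<Gamma>, \<Lambda>)\<in>X. derives d \<Gamma> \<Lambda>" and dy: "derives d \<Gamma> \<Lambda>" using less.prems(2) Y(1) by auto
    have cX: "all_connected X" using dX derives_connected by (fastforce simp: all_connected_def)
    have \<mu>: "?\<mu> Y = 3 ^ weight \<Gamma> + ?\<mu> X" unfolding Y(1) using Y(2,3) by simp
    have "\<exists>Z. finite Z \<and> (\<forall>(\<Gamma>, \<Lambda>)\<in>Z. derives d \<Gamma> \<Lambda>) \<and> ?\<mu> Z < ?\<mu> Y \<and> erase_raw d (Some Y) (Some Z)"
      using derives_step[OF inv dy]
    proof (elim disjE exE conjE)
      fix P l assume "\<Gamma> = [Lit P, Lit (d P)]" "\<Lambda> = ({l}, {}, {(l, (0, [])), (l, (1, []))})"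
      then have "erase_raw d (Some Y) (Some X)" unfolding Y(1) by (rule erase_raw.axiom[OF Y(2) _ _ cX])
      moreover have "?\<mu> X < ?\<mu> Y" unfolding \<mu> by simp
      ultimately show ?thesis using dX Y(3) by blast
    next
      fix k assume rd: "ready \<Gamma> \<Lambda> k" and E: "finite (erase \<Gamma> \<Lambda> k)" "card (erase \<Gamma> \<Lambda> k) \<le> 2"
        "\<forall>(\<Gamma>', \<Lambda>')\<in>erase \<Gamma> \<Lambda> k. derives d \<Gamma>' \<Lambda>' \<and> weight \<Gamma>' < weight \<Gamma>"
      let ?E = "erase \<Gamma> \<Lambda> k"
      have "erase_raw d (Some Y) (Some (X \<union> ?E))"
        unfolding Y(1) by (rule erase_raw.root[OF Y(2) derives_connected[OF dy] rd cX])
      moreover have "?\<mu> (X \<union> ?E) < ?\<mu> Y"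
      proof -
        \<comment> \<open>The base exceeds the number of premises: two results of weight at most
          \<open>w - 1\<close> count at most \<open>2 * 3 ^ (w - 1)\<close>, strictly less than
          \<open>3 ^ w\<close>, whereas base 2 would only give equality in the worst case.\<close>
        have "3 * 3 ^ weight (fst y) \<le> (3 :: nat) ^ weight \<Gamma>" if "y \<in> ?E" for y
        proof -
          have "Suc (weight (fst y)) \<le> weight \<Gamma>" using E(3) that by auto
          from power_increasing[OF this, of "3 :: nat"] show ?thesis by simp
        qed
        then have "(\<Sum>y\<in>?E. 3 * 3 ^ weight (fst y)) \<le> of_nat (card ?E) * (3 :: nat) ^ weight \<Gamma>"
          by (rule sum_bounded_above)
        also have "\<dots> \<le> 2 * 3 ^ weight \<Gamma>" using E(2) by simp
        finally have "3 * ?\<mu> ?E \<le> 2 * 3 ^ weight \<Gamma>" by (simp add: sum_distrib_left)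
        moreover have "(3 :: nat) ^ weight \<Gamma> > 0" by simp
        ultimately have "?\<mu> ?E < 3 ^ weight \<Gamma>" by linarith
        \<comment> \<open>Only an inequality, since the union may merge equal slicings.\<close>
        moreover have "?\<mu> (X \<union> ?E) \<le> ?\<mu> X + ?\<mu> ?E" using Y(3) E(1) by (simp add: sum_Un_nat)
        ultimately show ?thesis unfolding \<mu> by linarith
      qed
      moreover have "\<forall>(\<Gamma>, \<Lambda>)\<in>X \<union> ?E. derives d \<Gamma> \<Lambda>" using dX E(3) by blast
      ultimately show ?thesis using Y(3) E(1) by (metis finite_Un)
    qed
    then obtain Z where Z: "finite Z" "\<forall>(\<Gamma>, \<Lambda>)\<in>Z. derives d \<Gamma> \<Lambda>" "?\<mu> Z < ?\<mu> Y" "erase_raw d (Some Y) (Some Z)"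
      by blast
    have "erase_step d (Some Y) (Some Z)"
      unfolding erase_step_def using Z(4) cl[OF Z(2)] cl[OF less.prems(2)] by blast
    then show ?thesis using less.hyps[OF Z(3,1,2)] by (rule converse_rtranclp_into_rtranclp)
  qed
qed

theorem mainTheorem10:
  fixes dual :: "'a \<Rightarrow> 'a" and \<Gamma> :: "'a fm list" and \<Lambda> :: "'l linking"
  assumes "\<forall>a. dual a \<noteq> a" and "\<forall>a. dual (dual a) = a"
    and "linking dual \<Gamma> \<Lambda>"
  shows "conflict_net dual \<Gamma> \<Lambda> \<longleftrightarrow> sequentializable dual \<Gamma> \<Lambda>"
proof -
  have "conflict_net dual \<Gamma> \<Lambda> \<longleftrightarrow> derives dual \<Gamma> \<Lambda>"
  proof
    assume "conflict_net dual \<Gamma> \<Lambda>"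
    then show "derives dual \<Gamma> \<Lambda>" unfolding conflict_net_def using erasable_derives by blast
  next
    assume "derives dual \<Gamma> \<Lambda>"
    then show "conflict_net dual \<Gamma> \<Lambda>"
      unfolding conflict_net_def using derives_sound derives_erasable[OF assms(2), of "{(\<Gamma>, \<Lambda>)}"] by blast
  qed
  then show ?thesis using derives_iff_sequentializable[OF assms(2,3)] by simp
qed

end
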